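(* Let $D\subset\mathbb{R}^d$ be a bounded open domain with $C^2$ boundary, let $x_0\in D$, and let $\mathcal{K}=(\mathcal{K}_1,\dots,\mathcal{K}_m)\in\mathscr{K}$ be an $m$-tuple of admissible linear feedback operators. Suppose that the maximum closed invariant set $\Lambda_D^{\mathcal{K}}\subset D\cup\partial D$ of the deterministic system $$\dot{x}^0(t)=Ax^0(t)+\sum_{i=1}^m B_i(\mathcal{K}_i x^0)(t)$$ is nonempty. For $\epsilon>0$ let $\lambda_\epsilon^{\mathcal{K}}$ be the principal eigenvalue of $-\mathcal{L}_\epsilon^{\mathcal{K}}$ in $D$ with zero boundary conditions on $\partial D$, where $$\mathcal{L}_\epsilon^{\mathcal{K}}(\cdot)(x)=\Bigl\langle\nabla(\cdot),\,Ax+\sum_{i=1}^m B_i\mathcal{K}_i x\Bigr\rangle+\frac{\epsilon}{2}\operatorname{tr}\bigl\{\sigma(x)\sigma^T(x)\nabla^2(\cdot)\bigr\}.$$ Then $$\lambda_\epsilon^{\mathcal{K}}=\epsilon^{-1}r(\mathcal{K})+o(\epsilon^{-1})\quad\text{as }\epsilon\to 0,$$ where $$r(\mathcal{K})=\limsup_{T\to\infty}\ \inf_{\substack{\varphi\in C_{0T}([0,T],\mathbb{R}^d)\\ \varphi(0)=x_0}}\frac{1}{T}\Bigl\{S_{0T}^{\mathcal{K}}(\varphi)\ \Big|\ \varphi(t)\in D\cup\partial D\ \ \forall t\in[0,T]\Bigr\}.$$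
   Context: Data. $A\in\mathbb{R}^{d\times d}$ and $B_i\in\mathbb{R}^{d\times r_i}$ for $i=1,\dots,m$. The map $\sigma:\mathbb{R}^d\to\mathbb{R}^{d\times d}$ is Lipschitz, and there is $\kappa>0$ with $\sigma(x)\sigma^T(x)\ge\kappa I_{d\times d}$ for all $x\in\mathbb{R}^d$. $W$ is a $d$-dimensional standard Wiener process. $D\subset\mathbb{R}^d$ is a bounded open domain whose boundary $\partial D$ is a manifold of class $C^2$. Admissible feedbacks. $\mathcal{X}\subseteq\mathbb{R}^d$ is the state space and $\mathcal{U}_i\subset\mathbb{R}^{r_i}$ is the (measurable) set of control values for channel $i$. $\mathscr{K}_i[\mathcal{X},\mathcal{U}_i]$ is a closed subspace of bounded linear feedback operators from $\mathcal{X}$ to $\mathcal{U}_i$; each $\mathcal{K}_i$ is given by a real $r_i\times d$ matrix, with $(\mathcal{K}_i x)(t)=\mathcal{K}_i x(t)$. For $\mathcal{K}=(\mathcal{K}_1,\dots,\mathcal{K}_m)$, let $\phi(t;0,x_0,(\mathcal{K}x^0)(t))$ denote the unique solution at time $t$ of $\dot{x}^0(t)=Ax^0(t)+\sum_{i=1}^m B_i(\mathcal{K}_i x^0)(t)$, $x^0(0)=x_0$. The class of admissible feedbacks satisfies $$\mathscr{K}\subseteq\Bigl\{\mathcal{K}\in\prod_{i=1}^m\mathscr{K}_i[\mathcal{X},\mathcal{U}_i]\ \Big|\ \phi(t;0,x_0,(\mathcal{K}x^0)(t))\in\Omega\ \ \forall t\ge0,\ \forall x_0\in\Omega\Bigr\},$$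 where $\Omega$ is a bounded open set in $D\cup\partial D$ that contains the origin. Maximum closed invariant set. For $\mathcal{K}\in\mathscr{K}$, $\Lambda_D^{\mathcal{K}}\subset D\cup\partial D$ is the closed invariant set that contains every set $\Omega'\subset D\cup\partial D$ satisfying $\phi(t;0,x_0,(\mathcal{K}x^0)(t))\in\Omega'$ for all $t\ge0$ and all $x_0\in\Omega'$ (invariant means having this last property). Diffusion and principal eigenvalue. $x^\epsilon$ solves $$dx^\epsilon(t)=Ax^\epsilon(t)\,dt+\sum_{i=1}^m B_i(\mathcal{K}_i x^\epsilon)(t)\,dt+\sqrt{\epsilon}\,\sigma(x^\epsilon(t))\,dW(t),\qquad x^\epsilon(0)=x_0,$$ with generator $\mathcal{L}_\epsilon^{\mathcal{K}}$, and $\tau_D^\epsilon=\inf\{t>0\mid x^\epsilon(t)\in\partial D\}$. The principal eigenvalue $\lambda_\epsilon^{\mathcal{K}}$ is the eigenvalue for which there is $\upsilon\in W^{2,p}_{loc}\cap C(D\cup\partial D)$, $p>2$, with $\upsilon>0$ in $D$, $-\mathcal{L}_\epsilon^{\mathcal{K}}\upsilon=\lambda_\epsilon^{\mathcal{K}}\upsilon$ in $D$ and $\upsilon=0$ on $\partial D$; it is given by $$\lambda_\epsilon^{\mathcal{K}}=-\limsup_{T\to\infty}\frac1T\log\mathbb{P}_\epsilon^{\mathcal{K}}\{\tau_D^\epsilon>T\},$$ where $\mathbb{P}_\epsilon^{\mathcal{K}}$ is the law of $x^\epsilon$ started at $x_0\in D$ under the feedback $\mathcal{K}$. Action functional. $C_{0T}([0,T],\mathbb{R}^d)$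 is the space of continuous functions $\varphi:[0,T]\to\mathbb{R}^d$. For absolutely continuous $\varphi$, writing $b(x)=Ax+\sum_{i=1}^m B_i\mathcal{K}_i x$, $$S_{0T}^{\mathcal{K}}(\varphi)=\frac12\int_0^T\bigl[\dot\varphi(t)-b(\varphi(t))\bigr]^T\bigl(\sigma(\varphi(t))\sigma^T(\varphi(t))\bigr)^{-1}\bigl[\dot\varphi(t)-b(\varphi(t))\bigr]dt,$$ and $S_{0T}^{\mathcal{K}}(\varphi)=+\infty$ if $\varphi$ is not absolutely continuous. *)

theory Defs
  imports "HOL-Analysis.Analysis" "HOL-Library.Landau_Symbols"
begin

section \<open>Linear feedback systems\<close>

text \<open>
  The control dimensions \<open>r i\<close> vary with the channel \<open>i\<close>, so they cannot be types. A point of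
  \<open>r\<close>-dimensional control space is a function in \<open>{..<r} \<rightarrow>\<^sub>E UNIV\<close>; a matrix of size \<open>r \<times> d\<close> is
  the family \<open>K\<close> of its rows \<open>K 0, ..., K (r - 1)\<close>, and a matrix of size \<open>d \<times> r\<close> is the family
  \<open>B\<close> of its columns \<open>B 0, ..., B (r - 1)\<close>.
\<close>

definition rows_mult :: "nat \<Rightarrow> (nat \<Rightarrow> real^'d) \<Rightarrow> real^'d \<Rightarrow> nat \<Rightarrow> real" where
  "rows_mult r K x = (\<lambda>j\<in>{..<r}. K j \<bullet> x)"

definition cols_mult :: "nat \<Rightarrow> (nat \<Rightarrow> real^'d) \<Rightarrow> (nat \<Rightarrow> real) \<Rightarrow> real^'d" where
  "cols_mult r B u = (\<Sum>j<r. u j *\<^sub>R B j)"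

definition feedback_drift ::
  "real^'d^'d \<Rightarrow> nat \<Rightarrow> (nat \<Rightarrow> nat) \<Rightarrow> (nat \<Rightarrow> nat \<Rightarrow> real^'d) \<Rightarrow> (nat \<Rightarrow> nat \<Rightarrow> real^'d)
     \<Rightarrow> real^'d \<Rightarrow> real^'d" where
  "feedback_drift A m r B K x =
     A *v x + (\<Sum>i=1..m. cols_mult (r i) (B i) (rows_mult (r i) (K i) x))"

text \<open>
  A closed linear subspace of the matrices of size \<open>r \<times> d\<close>, each of which maps \<open>X\<close> into \<open>U\<close>.
  On these (extensional) row families the product topology is the usual one.
\<close>

definition feedback_space ::
  "nat \<Rightarrow> (real^'d) set \<Rightarrow> (nat \<Rightarrow> real) set \<Rightarrow> (nat \<Rightarrow> real^'d) set \<Rightarrow> bool" where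
  "feedback_space r X U \<K> \<longleftrightarrow>
     \<K> \<subseteq> ({..<r} \<rightarrow>\<^sub>E UNIV) \<and>
     (\<lambda>j\<in>{..<r}. 0) \<in> \<K> \<and>
     (\<forall>K\<in>\<K>. \<forall>L\<in>\<K>. \<forall>a b. (\<lambda>j\<in>{..<r}. a *\<^sub>R K j + b *\<^sub>R L j) \<in> \<K>) \<and>
     closed \<K> \<and>
     (\<forall>K\<in>\<K>. \<forall>x\<in>X. rows_mult r K x \<in> U)"

definition ode_solution :: "(real^'d \<Rightarrow> real^'d) \<Rightarrow> real^'d \<Rightarrow> (real \<Rightarrow> real^'d) \<Rightarrow> bool" where
  "ode_solution b x0 y \<longleftrightarrow>
     y 0 = x0 \<and> (\<forall>t\<ge>0. (y has_vector_derivative b (y t)) (at t within {0..}))"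

definition flow :: "(real^'d \<Rightarrow> real^'d) \<Rightarrow> real^'d \<Rightarrow> real \<Rightarrow> real^'d" where
  "flow b x0 t = (THE z. \<exists>y. ode_solution b x0 y \<and> y t = z)"

definition flow_invariant :: "(real^'d \<Rightarrow> real^'d) \<Rightarrow> (real^'d) set \<Rightarrow> bool" where
  "flow_invariant b S \<longleftrightarrow> (\<forall>x0\<in>S. \<forall>t\<ge>0. flow b x0 t \<in> S)"

definition max_closed_invariant ::
  "(real^'d) set \<Rightarrow> (real^'d \<Rightarrow> real^'d) \<Rightarrow> (real^'d) set \<Rightarrow> bool" where
  "max_closed_invariant D b \<Lambda> \<longleftrightarrow>
     \<Lambda> \<subseteq> closure D \<and> closed \<Lambda> \<and> flow_invariant b \<Lambda> \<and>
     (\<forall>S. S \<subseteq> closure D \<and> flow_invariant b S \<longrightarrow> S \<subseteq> \<Lambda>)"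

definition admissible_feedbacks ::
  "real^'d^'d \<Rightarrow> nat \<Rightarrow> (nat \<Rightarrow> nat) \<Rightarrow> (nat \<Rightarrow> nat \<Rightarrow> real^'d) \<Rightarrow> (nat \<Rightarrow> (nat \<Rightarrow> real^'d) set)
     \<Rightarrow> (real^'d) set \<Rightarrow> (nat \<Rightarrow> nat \<Rightarrow> real^'d) set" where
  "admissible_feedbacks A m r B \<K> \<Omega> =
     {K \<in> (\<Pi>\<^sub>E i\<in>{1..m}. \<K> i). flow_invariant (feedback_drift A m r B K) \<Omega>}"

section \<open>Hypersurfaces and Sobolev functions\<close>

text \<open>Embedded \<open>C\<^sup>2\<close> hypersurface, given locally as a regular level set.\<close>

definition C2_hypersurface :: "(real^'d) set \<Rightarrow> bool" where
  "C2_hypersurface S \<longleftrightarrow>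
     (\<forall>p\<in>S. \<exists>V g (G :: real^'d \<Rightarrow> real^'d) (H :: real^'d \<Rightarrow> real^'d^'d).
        open V \<and> p \<in> V \<and>
        (\<forall>x\<in>V. GDERIV g x :> G x) \<and>
        (\<forall>x\<in>V. (G has_derivative (\<lambda>h. H x *v h)) (at x)) \<and>
        continuous_on V H \<and>
        (\<forall>x\<in>V. G x \<noteq> 0) \<and>
        S \<inter> V = {x \<in> V. g x = 0})"

definition Lp_loc :: "real \<Rightarrow> (real^'d) set \<Rightarrow> (real^'d \<Rightarrow> real) \<Rightarrow> bool" where
  "Lp_loc p D f \<longleftrightarrow>
     set_borel_measurable lebesgue D f \<and>
     (\<forall>C. compact C \<and> C \<subseteq> D \<longrightarrow> set_integrable lebesgue C (\<lambda>x. \<bar>f x\<bar> powr p))"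

text \<open>
  Weak derivatives are tested against \<open>C\<^sup>1\<close> functions of compact support in \<open>D\<close>; by mollification
  this is equivalent to testing against smooth ones.
\<close>

definition weak_gradient ::
  "(real^'d) set \<Rightarrow> (real^'d \<Rightarrow> real) \<Rightarrow> (real^'d \<Rightarrow> real^'d) \<Rightarrow> bool" where
  "weak_gradient D u G \<longleftrightarrow>
     Lp_loc 1 D u \<and> (\<forall>i. Lp_loc 1 D (\<lambda>x. G x $ i)) \<and>
     (\<forall>\<eta> (\<eta>' :: real^'d \<Rightarrow> real^'d).
        (\<forall>x. GDERIV \<eta> x :> \<eta>' x) \<and> continuous_on UNIV \<eta>' \<and>
        (\<exists>C. compact C \<and> C \<subseteq> D \<and> (\<forall>x. x \<notin> C \<longrightarrow> \<eta> x = 0)) \<longrightarrow>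
        (\<forall>i. (LINT x:D|lebesgue. u x * \<eta>' x $ i) = - (LINT x:D|lebesgue. G x $ i * \<eta> x)))"

text \<open>Membership in \<open>W\<^sup>2\<^sup>,\<^sup>p\<close> locally on \<open>D\<close>, with weak gradient \<open>G\<close> and weak Hessian \<open>H\<close>.\<close>

definition W2p_loc ::
  "real \<Rightarrow> (real^'d) set \<Rightarrow> (real^'d \<Rightarrow> real) \<Rightarrow> (real^'d \<Rightarrow> real^'d) \<Rightarrow> (real^'d \<Rightarrow> real^'d^'d)
     \<Rightarrow> bool" where
  "W2p_loc p D u G H \<longleftrightarrow>
     Lp_loc p D u \<and> (\<forall>i. Lp_loc p D (\<lambda>x. G x $ i)) \<and> (\<forall>i j. Lp_loc p D (\<lambda>x. H x $ i $ j)) \<and>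
     weak_gradient D u G \<and> (\<forall>i. weak_gradient D (\<lambda>x. G x $ i) (\<lambda>x. H x $ i))"

section \<open>Generator and principal eigenvalue\<close>

text \<open>
  Value at \<open>x\<close> of the generator of \<open>dx = b(x) dt + sqrt \<epsilon> \<sigma>(x) dW\<close> on a function with gradient
  \<open>G\<close> and Hessian \<open>H\<close>.
\<close>

definition generator ::
  "(real^'d \<Rightarrow> real^'d) \<Rightarrow> (real^'d \<Rightarrow> real^'d^'d) \<Rightarrow> real \<Rightarrow>
     (real^'d \<Rightarrow> real^'d) \<Rightarrow> (real^'d \<Rightarrow> real^'d^'d) \<Rightarrow> real^'d \<Rightarrow> real" where
  "generator b \<sigma> \<epsilon> G H x =
     G x \<bullet> b x + \<epsilon> / 2 * trace (\<sigma> x ** transpose (\<sigma> x) ** H x)"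

definition principal_eigenvalue ::
  "(real^'d) set \<Rightarrow> (real^'d \<Rightarrow> real^'d) \<Rightarrow> (real^'d \<Rightarrow> real^'d^'d) \<Rightarrow> real \<Rightarrow> real \<Rightarrow> bool" where
  "principal_eigenvalue D b \<sigma> \<epsilon> \<mu> \<longleftrightarrow>
     (\<exists>p>2. \<exists>u G H.
        W2p_loc p D u G H \<and> continuous_on (closure D) u \<and>
        (\<forall>x\<in>D. u x > 0) \<and>
        (AE x in lebesgue. x \<in> D \<longrightarrow> - generator b \<sigma> \<epsilon> G H x = \<mu> * u x) \<and>
        (\<forall>x\<in>frontier D. u x = 0))"

section \<open>Action functional\<close>

definition absolutely_continuous_path :: "real \<Rightarrow> (real \<Rightarrow> real^'d) \<Rightarrow> bool" where
  "absolutely_continuous_path T \<phi> \<longleftrightarrow>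
     (\<forall>e>0. \<exists>\<delta>>0. \<forall>(n::nat) (s :: nat \<Rightarrow> real) t.
        (\<forall>k<n. 0 \<le> s k \<and> s k \<le> t k \<and> t k \<le> T) \<and>
        disjoint_family_on (\<lambda>k. {s k<..<t k}) {..<n} \<and>
        (\<Sum>k<n. t k - s k) < \<delta> \<longrightarrow>
        (\<Sum>k<n. norm (\<phi> (t k) - \<phi> (s k))) < e)"

text \<open>
  An absolutely continuous path is differentiable almost everywhere; the null set where
  \<open>vector_derivative\<close> is unspecified does not affect the integral.
\<close>

definition action ::
  "(real^'d \<Rightarrow> real^'d) \<Rightarrow> (real^'d \<Rightarrow> real^'d^'d) \<Rightarrow> real \<Rightarrow> (real \<Rightarrow> real^'d) \<Rightarrow> ereal" where
  "action b \<sigma> T \<phi> =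
     (if absolutely_continuous_path T \<phi>
      then enn2ereal (\<integral>\<^sup>+t\<in>{0..T}.
        ennreal (1 / 2 *
          ((vector_derivative \<phi> (at t) - b (\<phi> t)) \<bullet>
           (matrix_inv (\<sigma> (\<phi> t) ** transpose (\<sigma> (\<phi> t))) *v
              (vector_derivative \<phi> (at t) - b (\<phi> t))))) \<partial>lebesgue)
      else \<infinity>)"

definition action_rate ::
  "(real^'d) set \<Rightarrow> (real^'d \<Rightarrow> real^'d) \<Rightarrow> (real^'d \<Rightarrow> real^'d^'d) \<Rightarrow> real^'d \<Rightarrow> ereal" where
  "action_rate D b \<sigma> x0 =
     Limsup at_top (\<lambda>T::real.
       INF \<phi>\<in>{\<phi>. continuous_on {0..T} \<phi> \<and> \<phi> 0 = x0 \<and> (\<forall>t\<in>{0..T}. \<phi> t \<in> closure D)}.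
         ereal (1 / T) * action b \<sigma> T \<phi>)"

end

theory Submission
  imports Defs
begin

text \<open>
  Write \<open>b\<close> for the linear drift and \<open>a = \<sigma> \<sigma>\<^sup>T\<close>. The origin is an equilibrium of \<open>b\<close>, and it
  lies in \<open>closure D\<close> because \<open>\<Omega>\<close> does. The rate is therefore zero: in unit time and at finite
  cost a path reaches a point \<open>z \<in> D\<close> near the origin, and resting at \<open>z\<close> costs at most
  \<open>\<bar>b z\<bar>\<^sup>2 / (2 \<kappa>)\<close> per unit of time, which is as small as desired (\<open>action_rate_zero\<close>). What has
  to be proved about the principal eigenvalue \<open>\<mu>\<close> is thus \<open>\<epsilon> \<mu> \<rightarrow> 0\<close>. Two energy arguments give
  this. Each of them multiplies the equation by a function of the eigenfunction \<open>u\<close> and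
  integrates by parts.

  For the upper bound (\<open>eigenvalue_test_function_bound\<close>) the multiplier is \<open>\<eta>\<^sup>2 / u\<close> with a bump
  function \<open>\<eta>\<close>. The diffusion then contributes a negative definite quadratic form in \<open>\<nabla>u / u\<close>, and
  completing the square removes \<open>u\<close> from the estimate:
  \<open>\<epsilon> \<mu> \<integral>\<eta>\<^sup>2 \<le> \<integral>(\<bar>\<eta>\<bar> \<beta> + O(\<epsilon>))\<^sup>2 / (2 \<kappa>)\<close>, where \<open>\<beta>\<close> bounds \<open>\<bar>b\<bar>\<close> on the support of \<open>\<eta>\<close>. A support
  close to the origin makes \<open>\<beta>\<close> small.

  For the lower bound \<open>\<mu> \<ge> 0\<close> (\<open>eigenvalue_nonneg\<close>), a maximum principle, the multiplier is
  \<open>((u - k)\<^sup>+)\<^sup>2\<close> with \<open>k\<close> just below \<open>max u\<close>. Its logarithmic derivative in \<open>u\<close> is so large that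
  the diffusion absorbs the first-order terms, and a negative \<open>\<mu>\<close> gives a contradiction.

  The eigenfunction has only weak derivatives and solves the equation almost everywhere, and \<open>a\<close>
  is merely Lipschitz. Both \<open>u\<close> and \<open>a\<close> are therefore mollified at scale \<open>\<delta>\<close>. Since \<open>a\<close> and \<open>b\<close> are
  Lipschitz, moving them across the convolution costs an error of size \<open>O(\<delta>)\<close> in \<open>L\<^sup>1\<close>, so that
  classical calculus applies up to an error that vanishes with \<open>\<delta>\<close>
  (\<open>approximate_weak_formulation\<close>).
\<close>

section \<open>Matrix estimates\<close>

lemma norm_matrix_vector_mult_le:
  fixes M :: "real^'n^'m"
  shows "norm (M *v x) \<le> norm M * norm x"
proof -
  have "norm (M *v x) = L2_set (\<lambda>i. \<bar>M $ i \<bullet> x\<bar>) UNIV"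
    by (simp add: norm_vec_def matrix_vector_mult_def inner_vec_def)
  also have "\<dots> \<le> L2_set (\<lambda>i. norm (M $ i) * norm x) UNIV"
    by (intro L2_set_mono) (auto simp: Cauchy_Schwarz_ineq2)
  also have "\<dots> = norm M * norm x"
    by (simp add: norm_vec_def L2_set_left_distrib)
  finally show ?thesis .
qed

lemma inner_matrix_le:
  fixes M :: "real^'n^'m"
  shows "\<bar>x \<bullet> (M *v y)\<bar> \<le> norm M * norm x * norm y"
proof -
  have "\<bar>x \<bullet> (M *v y)\<bar> \<le> norm x * norm (M *v y)" by (rule Cauchy_Schwarz_ineq2)
  also have "\<dots> \<le> norm x * (norm M * norm y)"
    by (intro mult_left_mono norm_matrix_vector_mult_le) auto
  finally show ?thesis by (simp add: mult_ac)
qed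

lemma abs_matrix_entry_le:
  fixes M :: "real^'n^'m"
  shows "\<bar>M $ i $ j\<bar> \<le> norm M"
  by (meson component_le_norm_cart Finite_Cartesian_Product.norm_nth_le order_trans)

lemma trace_matrix_mult:
  fixes M N :: "real^'d^'d"
  shows "trace (M ** N) = (\<Sum>i\<in>UNIV. \<Sum>k\<in>UNIV. M $ i $ k * N $ k $ i)"
  by (simp add: trace_def matrix_matrix_mult_def)

lemma abs_trace_mult_le:
  fixes M N :: "real^'d^'d"
  shows "\<bar>trace (M ** N)\<bar> \<le> (real CARD('d))\<^sup>2 * norm M * norm N"
proof -
  have "\<bar>trace (M ** N)\<bar> \<le> (\<Sum>i\<in>(UNIV::'d set). \<Sum>k\<in>(UNIV::'d set). \<bar>M $ i $ k\<bar> * \<bar>N $ k $ i\<bar>)"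
    unfolding trace_matrix_mult abs_mult[symmetric]
    by (intro order_trans[OF sum_abs] sum_mono) auto
  also have "\<dots> \<le> (\<Sum>i\<in>(UNIV::'d set). \<Sum>k\<in>(UNIV::'d set). norm M * norm N)"
    by (intro sum_mono mult_mono abs_matrix_entry_le) auto
  also have "\<dots> = (real CARD('d))\<^sup>2 * norm M * norm N" by (simp add: power2_eq_square)
  finally show ?thesis .
qed

lemma bounded_bilinear_trace_mult: "bounded_bilinear (\<lambda>(M::real^'d^'d) N. trace (M ** N))"
  by (rule bilinear_conv_bounded_bilinear[THEN iffD1])
    (auto simp: bilinear_def linear_iff trace_matrix_mult algebra_simps sum.distrib sum_distrib_left)

lemma bounded_bilinear_matrix_mult: "bounded_bilinear (\<lambda>(M::real^'d^'d) (N::real^'d^'d). M ** N)"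
  by (rule bilinear_conv_bounded_bilinear[THEN iffD1])
    (auto simp: bilinear_def linear_iff matrix_matrix_mult_def vec_eq_iff algebra_simps sum.distrib sum_distrib_left)

lemma bounded_bilinear_matrix_vector: "bounded_bilinear (\<lambda>(M::real^'d^'d) (x::real^'d). M *v x)"
  by (rule bilinear_conv_bounded_bilinear[THEN iffD1])
    (auto simp: bilinear_def linear_iff matrix_vector_mult_def vec_eq_iff algebra_simps sum.distrib sum_distrib_left)

lemma bounded_linear_transpose: "bounded_linear (transpose :: real^'d^'d \<Rightarrow> real^'d^'d)"
  by (rule linear_conv_bounded_linear[THEN iffD1]) (auto simp: linear_iff transpose_def vec_eq_iff)

text \<open>
  With \<open>y = M\<^sup>-\<^sup>1 w\<close>, ellipticity gives \<open>\<kappa> \<bar>y\<bar>\<^sup>2 \<le> y \<bullet> w\<close>, hence \<open>\<bar>y\<bar> \<le> \<bar>w\<bar> / \<kappa>\<close>. This bounds the Lagrangian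
  of the action by the squared distance of the velocity from the drift.
\<close>

lemma elliptic_matrix_inv_le:
  fixes M :: "real^'d^'d"
  assumes "\<kappa> > 0" and ell: "\<And>\<xi>. \<kappa> * (\<xi> \<bullet> \<xi>) \<le> \<xi> \<bullet> (M *v \<xi>)"
  shows "w \<bullet> (matrix_inv M *v w) \<le> (norm w)\<^sup>2 / \<kappa>"
proof -
  have "\<xi> = 0" if "M *v \<xi> = 0" for \<xi>
    using ell[of \<xi>] that assms(1) by (simp add: mult_le_0_iff) (meson inner_gt_zero_iff not_le)
  then have "inj ((*v) M)"
    using linear_injective_0[OF matrix_vector_mul_linear] by blast
  then have "invertible M"
    by (simp add: invertible_left_inverse matrix_left_invertible_injective)
  define y where "y = matrix_inv M *v w"
  have My: "M *v y = w"
    unfolding y_def using someI_ex[OF \<open>invertible M\<close>[unfolded invertible_def]]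
    by (simp add: matrix_inv_def matrix_vector_mul_assoc)
  have 1: "\<kappa> * (norm y)\<^sup>2 \<le> y \<bullet> w"
    using ell[of y] My by (simp add: power2_norm_eq_inner)
  have 2: "y \<bullet> w \<le> norm y * norm w" by (rule norm_cauchy_schwarz)
  have ny: "\<kappa> * norm y \<le> norm w"
  proof (cases "y = 0")
    case False
    have "(\<kappa> * norm y) * norm y \<le> norm w * norm y" using 1 2 by (simp add: power2_eq_square mult_ac)
    then show ?thesis using False by simp
  qed auto
  have "w \<bullet> y \<le> norm w * norm y" by (rule norm_cauchy_schwarz)
  also have "\<dots> \<le> norm w * (norm w / \<kappa>)"
    using ny assms(1) by (intro mult_left_mono) (auto simp: field_simps)
  finally show ?thesis by (simp add: y_def power2_eq_square)
qed

section \<open>Calculus and integration on Euclidean space\<close>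

text \<open>
  Squaring makes the positive part differentiable at its corner. This function provides both the
  mollifying kernel and the multiplier of the maximum principle.
\<close>

lemma DERIV_pos_part_square: "((\<lambda>s::real. (max 0 s)\<^sup>2) has_field_derivative 2 * max 0 s) (at s)"
proof -
  have key: "\<bar>(max 0 t)\<^sup>2 - (max 0 s)\<^sup>2 - 2 * max 0 s * (t - s)\<bar> \<le> (t - s)\<^sup>2" for t
  proof -
    consider "s \<ge> 0" "t \<ge> 0" | "s \<ge> 0" "t < 0" | "s < 0" "t \<ge> 0" | "s < 0" "t < 0" by linarith
    then show ?thesis
    proof cases
      case 1
      have "t\<^sup>2 - s\<^sup>2 - 2 * s * (t - s) = (t - s)\<^sup>2" by (simp add: power2_eq_square algebra_simps)
      then show ?thesis using 1 by simp
    next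
      case 2
      have "t * s \<le> 0" using 2 by (simp add: mult_nonpos_nonneg)
      have "\<bar>(max 0 t)\<^sup>2 - (max 0 s)\<^sup>2 - 2 * max 0 s * (t - s)\<bar> = \<bar>s * s - 2 * (t * s)\<bar>"
        using 2 by (simp add: max_def power2_eq_square algebra_simps)
      also have "\<dots> = s * s - 2 * (t * s)" using \<open>t * s \<le> 0\<close> zero_le_square[of s] by linarith
      also have "\<dots> \<le> s * s - 2 * (t * s) + t * t" by simp
      also have "\<dots> = (t - s)\<^sup>2" by (simp add: power2_eq_square algebra_simps)
      finally show ?thesis .
    next
      case 3
      have "t * s \<le> 0" using 3 by (simp add: mult_nonneg_nonpos)
      then have "t * t \<le> t * t - 2 * (t * s) + s * s" using zero_le_square[of s] by linarith
      then have "t\<^sup>2 \<le> (t - s)\<^sup>2" by (simp add: power2_eq_square algebra_simps)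
      then show ?thesis using 3 by (simp add: max_def)
    qed (auto simp: max_def)
  qed
  show ?thesis
    unfolding has_field_derivative_def has_derivative_at_alt
  proof (intro conjI allI impI)
    fix e :: real assume "e > 0"
    show "\<exists>d>0. \<forall>t. norm (t - s) < d \<longrightarrow>
      norm ((max 0 t)\<^sup>2 - (max 0 s)\<^sup>2 - 2 * max 0 s * (t - s)) \<le> e * norm (t - s)"
    proof (intro exI[of _ e] conjI allI impI)
      fix t assume t: "norm (t - s) < e"
      have "(t - s)\<^sup>2 \<le> e * norm (t - s)"
        using mult_right_mono[OF less_imp_le[OF t], of "norm (t - s)"] by (simp add: power2_eq_square)
      then show "norm ((max 0 t)\<^sup>2 - (max 0 s)\<^sup>2 - 2 * max 0 s * (t - s)) \<le> e * norm (t - s)"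
        using key[of t] by simp
    qed fact
  qed (rule bounded_linear_mult_right)
qed

lemma lborel_distr_reflect: "distr lborel borel (\<lambda>y. x - y) = (lborel :: ('a::euclidean_space) measure)"
  using lborel_affine[of "-1" x] by (simp add: density_1)

text \<open>
  Substituting \<open>x - y\<close> for \<open>y\<close> lets a convolution act on either of its factors.
\<close>

lemma integral_reflect:
  fixes f :: "'a::euclidean_space \<Rightarrow> 'b::euclidean_space"
  assumes "f \<in> borel_measurable borel"
  shows "(\<integral>y. f (x - y) \<partial>lebesgue) = (\<integral>y. f y \<partial>lebesgue)"
proof -
  have "(\<integral>y. f (x - y) \<partial>lborel) = (\<integral>y. f y \<partial>distr lborel borel (\<lambda>y. x - y))"
    using assms by (subst integral_distr) auto
  then show ?thesis
    using assms by (simp add: lborel_distr_reflect integral_completion)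
qed

lemma integrable_continuous_bounded_support:
  fixes f :: "'a::euclidean_space \<Rightarrow> 'b::euclidean_space"
  assumes "continuous_on UNIV f" "\<And>x. norm x > R \<Longrightarrow> f x = 0"
  shows "integrable lebesgue f"
proof -
  have "integrable lborel (\<lambda>x. indicator (cball 0 R) x *\<^sub>R f x)"
    by (rule borel_integrable_compact) (auto intro: continuous_on_subset[OF assms(1)])
  moreover have "(\<lambda>x. indicator (cball 0 R) x *\<^sub>R f x) = f"
    using assms(2) by (auto simp: fun_eq_iff indicator_def)
  ultimately have "integrable lborel f" by simp
  then show ?thesis by (simp add: integrable_completion)
qed

text \<open>
  The estimate is uniform in the point of evaluation, so it may be integrated against any locally
  integrable function; continuity and differentiability of convolutions come from this.
\<close>

lemma continuous_bounded_support_uniform: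
  fixes f :: "'a::euclidean_space \<Rightarrow> 'b::real_normed_vector"
  assumes "continuous_on UNIV f" "\<And>x. norm x \<ge> R \<Longrightarrow> f x = 0" "e > 0"
  obtains d where "0 < d" "d \<le> 1" "\<And>z h. norm h < d \<Longrightarrow> norm (f (z + h) - f z) \<le> e"
proof -
  have "uniformly_continuous_on (cball 0 (R + 2)) f"
    by (rule compact_uniformly_continuous) (auto intro: continuous_on_subset[OF assms(1)])
  then obtain d where d: "d > 0"
      "\<And>x y. x \<in> cball 0 (R+2) \<Longrightarrow> y \<in> cball 0 (R+2) \<Longrightarrow> dist y x < d \<Longrightarrow> dist (f y) (f x) < e"
    unfolding uniformly_continuous_on_def using \<open>e > 0\<close> by meson
  show ?thesis
  proof (rule that[of "min d 1"])
    fix z h :: 'a assume h: "norm h < min d 1"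
    show "norm (f (z + h) - f z) \<le> e"
    proof (cases "norm z \<le> R + 1")
      case True
      then have "z \<in> cball 0 (R+2)" "z + h \<in> cball 0 (R+2)"
        using h norm_triangle_ineq[of z h] by auto
      then show ?thesis using d(2)[of z "z + h"] h by (simp add: dist_norm)
    next
      case False
      then have "norm (z + h) \<ge> R" using h norm_triangle_ineq4[of "z + h" h] by auto
      then show ?thesis using False assms(2,3) by simp
    qed
  qed (use d in auto)
qed

lemma continuous_bounded_support_bound:
  fixes f :: "'a::euclidean_space \<Rightarrow> 'b::real_normed_vector"
  assumes "continuous_on UNIV f" "\<And>x. norm x \<ge> R \<Longrightarrow> f x = 0"
  obtains B where "B > 0" "\<And>x. norm (f x) \<le> B"
proof -
  have "compact (f ` cball 0 R)"
    by (rule compact_continuous_image) (auto intro: continuous_on_subset[OF assms(1)])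
  then obtain B where B: "B > 0" "\<And>y. y \<in> f ` cball 0 R \<Longrightarrow> norm y \<le> B"
    by (meson bounded_pos compact_imp_bounded)
  have "norm (f x) \<le> B" for x
    using B assms(2)[of x] by (cases "norm x \<le> R") auto
  with B that show ?thesis by blast
qed

lemma lipschitz_imp_continuous_on_UNIV:
  fixes f :: "'a::real_normed_vector \<Rightarrow> 'b::real_normed_vector"
  assumes "\<And>x y. norm (f x - f y) \<le> L * norm (x - y)" "L \<ge> 0"
  shows "continuous_on UNIV f"
  by (rule lipschitz_on_continuous_on[of L], rule lipschitz_onI) (use assms in \<open>auto simp: dist_norm\<close>)

lemma continuous_on_compact_norm_bound:
  fixes f :: "'a::topological_space \<Rightarrow> 'b::real_normed_vector"
  assumes "compact S" "continuous_on S f"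
  obtains B where "B > 0" "\<And>x. x \<in> S \<Longrightarrow> norm (f x) \<le> B"
proof -
  have "bounded (f ` S)" by (intro compact_imp_bounded compact_continuous_image assms)
  then obtain B where "B > 0" "\<forall>y\<in>f ` S. norm y \<le> B" unfolding bounded_pos by blast
  then show ?thesis by (intro that[of B]) auto
qed

section \<open>Convolution with kernels of bounded support\<close>

definition locally_integrable :: "('a::euclidean_space \<Rightarrow> 'b::euclidean_space) \<Rightarrow> bool" where
  "locally_integrable f \<longleftrightarrow> (\<forall>r. integrable lebesgue (\<lambda>y. indicator (cball 0 r) y *\<^sub>R f y))"

definition conv :: "('a::euclidean_space \<Rightarrow> real) \<Rightarrow> ('a \<Rightarrow> 'b::euclidean_space) \<Rightarrow> 'a \<Rightarrow> 'b" where
  "conv k f x = (\<integral>y. k (x - y) *\<^sub>R f y \<partial>lebesgue)"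

lemma continuous_imp_locally_integrable:
  "continuous_on UNIV f \<Longrightarrow> locally_integrable f"
  unfolding locally_integrable_def
proof
  fix r assume "continuous_on UNIV f"
  then have "integrable lborel (\<lambda>y. indicator (cball 0 r) y *\<^sub>R f y)"
    by (intro borel_integrable_compact) (auto intro: continuous_on_subset)
  then show "integrable lebesgue (\<lambda>y. indicator (cball 0 r) y *\<^sub>R f y)"
    using borel_measurable_integrable by (subst integrable_completion) auto
qed

lemma integrable_imp_locally_integrable:
  "integrable lebesgue f \<Longrightarrow> locally_integrable f"
  unfolding locally_integrable_def by (auto intro!: integrable_mult_indicator)

text \<open>
  The common estimate behind all convolutions: the kernel is controlled in the supremum norm, the
  function in \<open>L\<^sup>1\<close> of a ball that contains the support of the kernel.
\<close>

lemma locally_integrable_dominated: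
  fixes f :: "'a::euclidean_space \<Rightarrow> 'b::euclidean_space"
  assumes f: "locally_integrable f" and k: "k \<in> borel_measurable borel"
    and b: "\<And>y. \<bar>k y\<bar> \<le> B" and s: "\<And>y. norm y > r \<Longrightarrow> k y = 0"
  shows "integrable lebesgue (\<lambda>y. k y *\<^sub>R f y)"
    and "norm (\<integral>y. k y *\<^sub>R f y \<partial>lebesgue) \<le> B * (\<integral>y. norm (indicator (cball 0 r) y *\<^sub>R f y) \<partial>lebesgue)"
proof -
  let ?g = "\<lambda>y. indicator (cball 0 r) y *\<^sub>R f y"
  have g: "integrable lebesgue ?g" using f by (auto simp: locally_integrable_def)
  have eq: "(\<lambda>y. k y *\<^sub>R f y) = (\<lambda>y. k y *\<^sub>R ?g y)"
    using s by (force simp: fun_eq_iff indicator_def)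
  have meas: "(\<lambda>y. k y *\<^sub>R ?g y) \<in> borel_measurable lebesgue"
    by (rule borel_measurable_scaleR[OF measurable_completion borel_measurable_integrable[OF g]])
      (use k in simp)
  have Bg: "integrable lebesgue (\<lambda>y. B * norm (?g y))" by (intro integrable_mult_right integrable_norm g)
  have le: "norm (k y *\<^sub>R ?g y) \<le> B * norm (?g y)" for y
    using mult_right_mono[OF b[of y] norm_ge_zero[of "?g y"]] by (simp only: norm_scaleR)
  have le': "norm (k y *\<^sub>R ?g y) \<le> norm (B * norm (?g y))" for y
    using le[of y] unfolding real_norm_def by (rule order_trans) (rule abs_ge_self)
  show *: "integrable lebesgue (\<lambda>y. k y *\<^sub>R f y)"
    unfolding eq by (rule Bochner_Integration.integrable_bound[OF Bg meas]) (use le' in blast)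
  have "norm (\<integral>y. k y *\<^sub>R f y \<partial>lebesgue) \<le> (\<integral>y. B * norm (?g y) \<partial>lebesgue)"
    using Bochner_Integration.integral_norm_bound_integral[OF *[unfolded eq] Bg le] unfolding eq .
  then show "norm (\<integral>y. k y *\<^sub>R f y \<partial>lebesgue) \<le> B * (\<integral>y. norm (?g y) \<partial>lebesgue)"
    by simp
qed

lemma conv_integrable:
  fixes f :: "'a::euclidean_space \<Rightarrow> 'b::euclidean_space"
  assumes "continuous_on UNIV k" "\<And>x. norm x \<ge> \<delta> \<Longrightarrow> k x = 0" "locally_integrable f"
  shows "integrable lebesgue (\<lambda>y. k (x - y) *\<^sub>R f y)"
proof -
  obtain B where "\<And>x. norm (k x) \<le> B" using continuous_bounded_support_bound[OF assms(1,2)] by metis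
  moreover have "(\<lambda>y. k (x - y)) \<in> borel_measurable borel"
    by (intro borel_measurable_continuous_onI continuous_on_compose2[OF assms(1)] continuous_intros) auto
  moreover have "k (x - y) = 0" if "norm y > norm x + \<delta>" for y
    using that norm_triangle_ineq2[of y x] by (intro assms(2)) (simp add: norm_minus_commute)
  ultimately show ?thesis
    using locally_integrable_dominated(1)[OF assms(3), of "\<lambda>y. k (x - y)" B "norm x + \<delta>"] by simp
qed

lemma conv_continuous:
  fixes f :: "'a::euclidean_space \<Rightarrow> 'b::euclidean_space"
  assumes k: "continuous_on UNIV k" "\<And>x. norm x \<ge> \<delta> \<Longrightarrow> k x = 0" and f: "locally_integrable f"
  shows "continuous_on UNIV (conv k f)"
  unfolding continuous_on_iff
proof (intro ballI allI impI)
  fix x :: 'a and e :: real assume "e > 0"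
  define I where "I = (\<integral>y. norm (indicator (cball 0 (norm x + \<delta> + 1)) y *\<^sub>R f y) \<partial>lebesgue)"
  have I: "I \<ge> 0" unfolding I_def by simp
  obtain d where d: "0 < d" "d \<le> 1" "\<And>z h. norm h < d \<Longrightarrow> norm (k (z + h) - k z) \<le> e / (2 * (I + 1))"
    using continuous_bounded_support_uniform[where f = k and R = \<delta> and e = "e / (2 * (I + 1))"] k \<open>e > 0\<close> I by auto
  show "\<exists>d>0. \<forall>x'\<in>UNIV. dist x' x < d \<longrightarrow> dist (conv k f x') (conv k f x) < e"
  proof (intro exI[of _ d] conjI ballI impI)
    fix x' :: 'a assume x': "dist x' x < d"
    have small: "norm (k (x' - y) - k (x - y)) \<le> e / (2 * (I + 1))" for y
      using d(3)[of "x' - x" "x - y"] x' by (simp add: dist_norm)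
    have "norm (\<integral>y. (k (x' - y) - k (x - y)) *\<^sub>R f y \<partial>lebesgue) \<le> e / (2 * (I + 1)) * I"
      unfolding I_def
    proof (rule locally_integrable_dominated(2)[OF f])
      show "(\<lambda>y. k (x' - y) - k (x - y)) \<in> borel_measurable borel"
        by (intro borel_measurable_continuous_onI continuous_intros continuous_on_compose2[OF k(1)]) auto
      fix y :: 'a assume y: "norm y > norm x + \<delta> + 1"
      have "norm (x - y) \<ge> \<delta>" using y norm_triangle_ineq2[of y x] by (simp add: norm_minus_commute)
      moreover have "norm (x' - y) \<ge> \<delta>"
        using y norm_triangle_ineq2[of y x'] norm_triangle_ineq2[of x' x] x' d(2)
        by (simp add: norm_minus_commute dist_norm)
      ultimately show "k (x' - y) - k (x - y) = 0" using k(2) by simp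
    qed (use small in \<open>auto simp: I_def\<close>)
    also have "\<dots> < e" using mult_nonneg_nonneg[OF I less_imp_le[OF \<open>e > 0\<close>]] I \<open>e > 0\<close> by (simp add: field_simps add_nonneg_pos)
    also have "(\<integral>y. (k (x' - y) - k (x - y)) *\<^sub>R f y \<partial>lebesgue) = conv k f x' - conv k f x"
      unfolding conv_def scaleR_left_diff_distrib
      by (intro Bochner_Integration.integral_diff conv_integrable[OF k f])
    finally show "dist (conv k f x') (conv k f x) < e" by (simp add: dist_norm)
  qed (use d in auto)
qed

lemma GDERIV_imp_continuous: "(\<And>x. GDERIV f x :> f' x) \<Longrightarrow> continuous_on S f"
  by (meson continuous_at_imp_continuous_on gderiv_def has_derivative_continuous)

lemma GDERIV_zero_outside:
  assumes "GDERIV f x :> c" and "x \<notin> C" "closed C" "\<And>y. y \<notin> C \<Longrightarrow> f y = 0"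
  shows "c = 0"
proof -
  have "(f has_derivative (\<lambda>h. 0)) (at x)"
  proof (rule has_derivative_transform_within_open[where s = "- C"])
    show "((\<lambda>y. 0) has_derivative (\<lambda>h. 0)) (at x)" by (rule has_derivative_const)
  qed (use assms in auto)
  then have "(\<lambda>h. h \<bullet> c) = (\<lambda>h. 0)"
    using assms(1) unfolding gderiv_def by (rule has_derivative_unique[rotated])
  then have "c \<bullet> c = 0" by meson
  then show ?thesis by simp
qed

text \<open>
  Outside the closed ball derivatives are local; the sphere is reached by continuity of the gradient.
\<close>

lemma GDERIV_zero_outside_ball:
  fixes k :: "'a::euclidean_space \<Rightarrow> real"
  assumes "\<And>x. GDERIV k x :> k' x" "continuous_on UNIV k'" "\<And>x. norm x \<ge> \<delta> \<Longrightarrow> k x = 0"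
    and "norm x \<ge> \<delta>"
  shows "k' x = 0"
proof -
  have 0: "k' y = 0" if "norm y > \<delta>" for y
    by (rule GDERIV_zero_outside[OF assms(1), of _ "cball 0 \<delta>"]) (use that assms(3) in auto)
  show ?thesis
  proof (cases "norm x > \<delta> \<or> x = 0")
    case True
    show ?thesis
    proof (cases "x = 0 \<and> \<not> norm x > \<delta>")
      case True
      then have "k y = 0" for y using assms(4) norm_ge_zero[of y] by (intro assms(3)) auto
      then show ?thesis by (intro GDERIV_zero_outside[OF assms(1), of _ "{}"]) auto
    qed (use True 0 in auto)
  next
    case False
    then have x: "norm x = \<delta>" "x \<noteq> 0" using assms(4) by auto
    have lim: "((\<lambda>t. k' (t *\<^sub>R x)) \<longlongrightarrow> k' (1 *\<^sub>R x)) (at_right 1)"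
      by (intro continuous_on_tendsto_compose[OF assms(2)] tendsto_intros) auto
    have "eventually (\<lambda>t. k' (t *\<^sub>R x) = 0) (at_right (1::real))"
      unfolding eventually_at_right_field
      using x by (intro exI[of _ 2]) (auto intro!: 0)
    then have "((\<lambda>t. k' (t *\<^sub>R x)) \<longlongrightarrow> 0) (at_right (1::real))" by (rule tendsto_eventually)
    then have "k' (1 *\<^sub>R x) = 0"
      by (rule tendsto_unique[OF trivial_limit_at_right_real lim])
    then show ?thesis by simp
  qed
qed

lemma GDERIV_linear_error:
  fixes k :: "'a::euclidean_space \<Rightarrow> real"
  assumes "\<And>x. GDERIV k x :> k' x" and "\<And>t. 0 \<le> t \<Longrightarrow> t \<le> 1 \<Longrightarrow> norm (k' (z + t *\<^sub>R h) - k' z) \<le> e"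
  shows "\<bar>k (z + h) - k z - h \<bullet> k' z\<bar> \<le> e * norm h"
proof -
  have D: "((\<lambda>t. k (z + t *\<^sub>R h)) has_field_derivative (h \<bullet> k' (z + t *\<^sub>R h))) (at t)" for t :: real
  proof -
    have "((\<lambda>t. z + t *\<^sub>R h) has_derivative (\<lambda>s. s *\<^sub>R h)) (at t)"
      by (auto intro!: derivative_eq_intros)
    from has_derivative_compose[OF this assms(1)[of "z + t *\<^sub>R h", unfolded gderiv_def]]
    have "((\<lambda>t. k (z + t *\<^sub>R h)) has_derivative (\<lambda>s. (s *\<^sub>R h) \<bullet> k' (z + t *\<^sub>R h))) (at t)" .
    then show ?thesis by (simp add: has_field_derivative_def mult_commute_abs)
  qed
  obtain t where t: "0 < t" "t < 1" "k (z + 1 *\<^sub>R h) - k (z + 0 *\<^sub>R h) = (1 - 0) * (h \<bullet> k' (z + t *\<^sub>R h))"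
    using MVT2[OF zero_less_one, of "\<lambda>t. k (z + t *\<^sub>R h)" "\<lambda>t. h \<bullet> k' (z + t *\<^sub>R h)"] D by blast
  then have "k (z + h) - k z - h \<bullet> k' z = h \<bullet> (k' (z + t *\<^sub>R h) - k' z)"
    by (simp add: inner_diff_right)
  also have "\<bar>\<dots>\<bar> \<le> norm h * norm (k' (z + t *\<^sub>R h) - k' z)" by (rule Cauchy_Schwarz_ineq2)
  also have "\<dots> \<le> norm h * e" using t assms(2)[of t] by (intro mult_left_mono) auto
  finally show ?thesis by (simp add: mult.commute)
qed

text \<open>
  Convolution with a \<open>C\<^sup>1\<close> kernel is \<open>C\<^sup>1\<close> for any locally integrable function: by uniform continuity of
  \<open>k'\<close> the first-order Taylor error of the kernel is \<open>o(\<bar>h\<bar>)\<close> uniformly, and it can be integrated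
  directly.
\<close>

lemma conv_has_derivative:
  fixes f :: "'a::euclidean_space \<Rightarrow> 'b::euclidean_space"
  assumes k: "\<And>x. GDERIV k x :> k' x" "continuous_on UNIV k'" "\<And>x. norm x \<ge> \<delta> \<Longrightarrow> k x = 0"
    and f: "locally_integrable f"
  shows "(conv k f has_derivative (\<lambda>h. conv (\<lambda>z. h \<bullet> k' z) f x)) (at x)"
proof -
  have k0: "continuous_on UNIV k" by (rule GDERIV_imp_continuous) (rule k(1))
  have k'0: "norm x \<ge> \<delta> \<Longrightarrow> k' x = 0" for x by (rule GDERIV_zero_outside_ball[OF k])
  have kh: "continuous_on UNIV (\<lambda>z. h \<bullet> k' z)" for h by (intro continuous_intros k(2))
  have int: "integrable lebesgue (\<lambda>y. (h \<bullet> k' (x - y)) *\<^sub>R f y)" for h x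
    using conv_integrable[OF kh _ f, where \<delta> = \<delta>] k'0 by simp
  have int0: "integrable lebesgue (\<lambda>y. k (x - y) *\<^sub>R f y)" for x
    by (rule conv_integrable[OF k0 k(3) f])
  have "linear (\<lambda>h. conv (\<lambda>z. h \<bullet> k' z) f x)"
  proof (rule linearI)
    fix h g :: 'a and r :: real
    show "conv (\<lambda>z. (h + g) \<bullet> k' z) f x = conv (\<lambda>z. h \<bullet> k' z) f x + conv (\<lambda>z. g \<bullet> k' z) f x"
      unfolding conv_def inner_add_left scaleR_left_distrib
      by (intro Bochner_Integration.integral_add int)
    show "conv (\<lambda>z. (r *\<^sub>R h) \<bullet> k' z) f x = r *\<^sub>R conv (\<lambda>z. h \<bullet> k' z) f x"
      unfolding conv_def inner_scaleR_left scaleR_scaleR[symmetric] by (rule integral_scaleR_right)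
  qed
  then have bl: "bounded_linear (\<lambda>h. conv (\<lambda>z. h \<bullet> k' z) f x)" by (simp add: linear_linear)
  show ?thesis
    unfolding has_derivative_at_alt
  proof (intro conjI bl allI impI)
    fix e :: real assume "e > 0"
    define I where "I = (\<integral>y. norm (indicator (cball 0 (norm x + \<delta> + 1)) y *\<^sub>R f y) \<partial>lebesgue)"
    have I: "I \<ge> 0" unfolding I_def by simp
    obtain d where d: "0 < d" "d \<le> 1" "\<And>z h. norm h < d \<Longrightarrow> norm (k' (z + h) - k' z) \<le> e / (I + 1)"
      using continuous_bounded_support_uniform[where f = k' and R = \<delta> and e = "e / (I + 1)"] k(2) k'0 \<open>e > 0\<close> I by auto
    show "\<exists>d>0. \<forall>x'. norm (x' - x) < d \<longrightarrow>
       norm (conv k f x' - conv k f x - conv (\<lambda>z. (x' - x) \<bullet> k' z) f x) \<le> e * norm (x' - x)"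
    proof (intro exI[of _ d] conjI allI impI)
      fix x' :: 'a assume x': "norm (x' - x) < d"
      let ?q = "\<lambda>y. k (x' - y) - k (x - y) - (x' - x) \<bullet> k' (x - y)"
      have small: "\<bar>?q y\<bar> \<le> e / (I + 1) * norm (x' - x)" for y
      proof -
        have "norm (k' ((x - y) + t *\<^sub>R (x' - x)) - k' (x - y)) \<le> e / (I + 1)"
          if "0 \<le> t" "t \<le> 1" for t
        proof (rule d(3))
          show "norm (t *\<^sub>R (x' - x)) < d"
            using that x' mult_right_mono[of t 1 "norm (x' - x)"] by simp
        qed
        from GDERIV_linear_error[OF k(1) this] show ?thesis by simp
      qed
      have "norm (\<integral>y. ?q y *\<^sub>R f y \<partial>lebesgue) \<le> e / (I + 1) * norm (x' - x) * I"
        unfolding I_def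
      proof (rule locally_integrable_dominated(2)[OF f])
        show "?q \<in> borel_measurable borel"
          by (intro borel_measurable_continuous_onI continuous_intros
            continuous_on_compose2[OF k0] continuous_on_compose2[OF k(2)]) auto
        fix y :: 'a assume y: "norm y > norm x + \<delta> + 1"
        have 1: "norm (x - y) \<ge> \<delta>" using y norm_triangle_ineq2[of y x] by (simp add: norm_minus_commute)
        moreover have "norm (x' - y) \<ge> \<delta>"
          using y norm_triangle_ineq2[of y x'] norm_triangle_ineq2[of x' x] x' d(2)
          by (simp add: norm_minus_commute dist_norm)
        ultimately show "?q y = 0" using k(3) k'0 by simp
      qed (use small in \<open>auto simp: I_def\<close>)
      also have "\<dots> = (e * norm (x' - x)) * (I / (I + 1))" by simp
      also have "\<dots> \<le> (e * norm (x' - x)) * 1"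
        using I \<open>e > 0\<close> by (intro mult_left_mono) (auto simp: divide_simps)
      also have "(\<integral>y. ?q y *\<^sub>R f y \<partial>lebesgue) = conv k f x' - conv k f x - conv (\<lambda>z. (x' - x) \<bullet> k' z) f x"
        unfolding conv_def scaleR_left_diff_distrib
        by (simp add: int int0 Bochner_Integration.integral_diff)
      finally show "norm (conv k f x' - conv k f x - conv (\<lambda>z. (x' - x) \<bullet> k' z) f x) \<le> e * norm (x' - x)"
        by simp
    qed (use d in auto)
  qed
qed

section \<open>Integrals of derivatives\<close>

text \<open>
  Convolving \<open>k\<close> with the indicator of a large ball gives the constant \<open>\<integral>k\<close> near the origin, and its
  derivative there is the integral of the derivative of \<open>k\<close>. This is the divergence theorem for
  fields of bounded support.
\<close>

lemma integral_gradient_zero: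
  fixes k :: "'a::euclidean_space \<Rightarrow> real"
  assumes k: "\<And>x. GDERIV k x :> k' x" "continuous_on UNIV k'" "\<And>x. norm x \<ge> R \<Longrightarrow> k x = 0"
  shows "(\<integral>y. h \<bullet> k' y \<partial>lebesgue) = 0"
proof -
  \<comment> \<open>The extra unit keeps the convolution constant on the unit ball, not only at the origin.\<close>
  define f :: "'a \<Rightarrow> real" where "f = indicator (cball 0 (R + 1))"
  have "integrable lebesgue f"
    unfolding f_def by (rule integrable_real_indicator) (use emeasure_bounded_finite[of "cball (0::'a) (R + 1)"] in auto)
  then have f: "locally_integrable f" by (rule integrable_imp_locally_integrable)
  have k0: "continuous_on UNIV k" by (rule GDERIV_imp_continuous) (rule k(1))
  have k'0: "norm x \<ge> R \<Longrightarrow> k' x = 0" for x by (rule GDERIV_zero_outside_ball[OF k])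
  have f1: "f y = 1" if "norm x \<le> 1" "norm (x - y) < R" for x y
    using that norm_triangle_ineq4[of x "x - y"] by (auto simp: f_def)
  have const: "conv k f x = (\<integral>y. k y \<partial>lebesgue)" if "norm x \<le> 1" for x
  proof -
    have "k (x - y) * f y = k (x - y)" for y
      using f1[OF that, of y] k(3)[of "x - y"] by (cases "norm (x - y) < R") auto
    then show ?thesis
      unfolding conv_def real_scaleR_def using integral_reflect[OF borel_measurable_continuous_onI[OF k0], of x]
      by (simp only:)
  qed
  have "(conv k f has_derivative (\<lambda>h. 0)) (at 0)"
    by (rule has_derivative_transform_within_open[of "\<lambda>x. \<integral>y. k y \<partial>lebesgue" _ _ _ "ball 0 1"])
      (auto simp: const)
  moreover have "(conv k f has_derivative (\<lambda>h. conv (\<lambda>z. h \<bullet> k' z) f 0)) (at 0)"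
    by (rule conv_has_derivative[OF k f])
  ultimately have "conv (\<lambda>z. h \<bullet> k' z) f 0 = 0"
    by (rule has_derivative_unique[THEN fun_cong, symmetric])
  moreover have "(h \<bullet> k' (0 - y)) * f y = h \<bullet> k' (0 - y)" for y
    using f1[of 0 y] k'0[of "0 - y"] by (cases "norm (0 - y) < R") auto
  ultimately have "(\<integral>y. h \<bullet> k' (0 - y) \<partial>lebesgue) = 0"
    unfolding conv_def real_scaleR_def by (simp only:)
  moreover have "(\<lambda>y. h \<bullet> k' y) \<in> borel_measurable borel"
    by (intro borel_measurable_continuous_onI continuous_intros k(2))
  ultimately show ?thesis using integral_reflect[of "\<lambda>y. h \<bullet> k' y" 0] by simp
qed

lemma integral_derivative_zero:
  fixes k :: "'a::euclidean_space \<Rightarrow> real"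
  assumes k: "\<And>x. (k has_derivative k' x) (at x)" "\<And>h. continuous_on UNIV (\<lambda>x. k' x h)"
    and supp: "\<And>x. norm x \<ge> R \<Longrightarrow> k x = 0"
  shows "(\<integral>y. k' y h \<partial>lebesgue) = 0"
proof -
  have lin: "linear (k' x)" for x using has_derivative_linear[OF k(1)] .
  have eq: "h \<bullet> (\<Sum>b\<in>Basis. k' x b *\<^sub>R b) = k' x h" for x h
  proof -
    have "k' x h = k' x (\<Sum>b\<in>Basis. (h \<bullet> b) *\<^sub>R b)" by (simp add: euclidean_representation)
    also have "\<dots> = (\<Sum>b\<in>Basis. (h \<bullet> b) * k' x b)"
      by (simp add: linear_sum[OF lin] linear_cmul[OF lin])
    finally show ?thesis by (simp add: inner_sum_right mult.commute)
  qed
  have "(\<integral>y. h \<bullet> (\<Sum>b\<in>Basis. k' y b *\<^sub>R b) \<partial>lebesgue) = 0"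
  proof (rule integral_gradient_zero[OF _ _ supp])
    show "GDERIV k x :> (\<Sum>b\<in>Basis. k' x b *\<^sub>R b)" for x
      unfolding gderiv_def eq using k(1) by simp
    show "continuous_on UNIV (\<lambda>x. \<Sum>b\<in>Basis. k' x b *\<^sub>R b)" by (intro continuous_intros k(2))
  qed
  then show ?thesis unfolding eq .
qed

section \<open>Mollifiers\<close>

text \<open>
  Weak derivatives are tested against \<open>C\<^sup>1\<close> functions, so a \<open>C\<^sup>1\<close> kernel is enough to transfer them to
  the convolution. The kernel is even in order to have unit mass in each variable of
  \<open>\<rho> (x - y)\<close>.
\<close>

definition mollifier :: "real \<Rightarrow> (real^'d \<Rightarrow> real) \<Rightarrow> (real^'d \<Rightarrow> real^'d) \<Rightarrow> bool" where
  "mollifier \<delta> \<rho> \<rho>' \<longleftrightarrow>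
     (\<forall>x. GDERIV \<rho> x :> \<rho>' x) \<and> continuous_on UNIV \<rho>' \<and> (\<forall>x. 0 \<le> \<rho> x) \<and>
     (\<forall>x. norm x \<ge> \<delta> \<longrightarrow> \<rho> x = 0) \<and> (\<forall>x. \<rho> (- x) = \<rho> x) \<and> (\<integral>x. \<rho> x \<partial>lebesgue) = 1"

lemma mollifier_exists:
  assumes "\<delta> > 0"
  obtains \<rho> :: "real^'d \<Rightarrow> real" and \<rho>' where "mollifier \<delta> \<rho> \<rho>'"
proof -
  \<comment> \<open>The unnormalised kernel; it is at least \<open>(\<delta>\<^sup>2 / 2)\<^sup>2\<close> on the ball of half the radius.\<close>
  define k :: "real^'d \<Rightarrow> real" where "k x = (max 0 (\<delta>\<^sup>2 - x \<bullet> x))\<^sup>2" for x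
  define k' :: "real^'d \<Rightarrow> real^'d" where "k' x = (2 * max 0 (\<delta>\<^sup>2 - x \<bullet> x)) *\<^sub>R (- (2 *\<^sub>R x))" for x
  define c where "c = (\<integral>x. k x \<partial>lebesgue)"
  have D: "GDERIV k x :> k' x" for x
  proof -
    have "GDERIV (\<lambda>x. \<delta>\<^sup>2 - x \<bullet> x) x :> - (2 *\<^sub>R x)"
      unfolding gderiv_def by (auto intro!: derivative_eq_intros simp: inner_commute)
    from GDERIV_DERIV_compose[OF this DERIV_pos_part_square] show ?thesis by (simp add: k_def[abs_def] k'_def)
  qed
  have ck: "continuous_on UNIV k" unfolding k_def by (intro continuous_intros)
  have k0: "k x = 0" if "norm x \<ge> \<delta>" for x
  proof -
    have "\<delta>\<^sup>2 \<le> x \<bullet> x" using power_mono[OF that, of 2] assms by (simp add: power2_norm_eq_inner)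
    then show ?thesis by (simp add: k_def)
  qed
  have "integrable lebesgue k" using k0 by (intro integrable_continuous_bounded_support[OF ck, of \<delta>]) auto
  moreover have "integrable lebesgue (\<lambda>x. (\<delta>\<^sup>2 / 2)\<^sup>2 * indicator (ball (0::real^'d) (\<delta>/2)) x)"
    by (intro integrable_mult_right integrable_real_indicator) (use emeasure_bounded_finite[of "ball (0::real^'d) (\<delta>/2)"] in auto)
  moreover have "(\<delta>\<^sup>2 / 2)\<^sup>2 * indicator (ball 0 (\<delta>/2)) x \<le> k x" for x
  proof (cases "norm x < \<delta>/2")
    case True
    then have "x \<bullet> x \<le> (\<delta>/2)\<^sup>2"
      unfolding power2_norm_eq_inner[symmetric] by (intro power_mono) auto
    also have "\<dots> \<le> \<delta>\<^sup>2 / 2" by (simp add: power_divide)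
    finally have "\<delta>\<^sup>2 / 2 \<le> max 0 (\<delta>\<^sup>2 - x \<bullet> x)" by (simp add: le_max_iff_disj)
    then have "(\<delta>\<^sup>2 / 2)\<^sup>2 \<le> k x" unfolding k_def by (intro power_mono) auto
    then show ?thesis using True by simp
  qed (simp add: k_def)
  ultimately have "(\<integral>x. (\<delta>\<^sup>2 / 2)\<^sup>2 * indicator (ball (0::real^'d) (\<delta>/2)) x \<partial>lebesgue) \<le> c"
    unfolding c_def by (intro integral_mono) auto
  moreover have "(\<integral>x. (\<delta>\<^sup>2 / 2)\<^sup>2 * indicator (ball (0::real^'d) (\<delta>/2)) x \<partial>lebesgue) > 0"
    using content_ball_pos[of "\<delta>/2" "0::real^'d"] assms by simp
  ultimately have c: "c > 0" by simp
  have "mollifier \<delta> (\<lambda>x. k x / c) (\<lambda>x. (1 / c) *\<^sub>R k' x)"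
    unfolding mollifier_def
  proof (intro conjI allI impI)
    show "GDERIV (\<lambda>x. k x / c) x :> (1 / c) *\<^sub>R k' x" for x
      using D[of x] c unfolding gderiv_def inner_scaleR_right
      by (auto intro!: derivative_eq_intros simp: field_simps)
    show "continuous_on UNIV (\<lambda>x. (1 / c) *\<^sub>R k' x)"
      unfolding k'_def by (intro continuous_intros)
    show "(\<integral>x. k x / c \<partial>lebesgue) = 1" using c by (simp add: c_def[symmetric])
  qed (use c k0 in \<open>auto simp: k_def\<close>)
  then show ?thesis by (rule that)
qed

context
  fixes \<delta> \<rho> and \<rho>' :: "real^'d \<Rightarrow> real^'d"
  assumes moll: "mollifier \<delta> \<rho> \<rho>'"
begin

lemma mollifierD:
  "GDERIV \<rho> x :> \<rho>' x" "continuous_on UNIV \<rho>'" "0 \<le> \<rho> x" "norm x \<ge> \<delta> \<Longrightarrow> \<rho> x = 0" "\<rho> (- x) = \<rho> x"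
  "(\<integral>x. \<rho> x \<partial>lebesgue) = 1" "continuous_on UNIV \<rho>" "norm x \<ge> \<delta> \<Longrightarrow> \<rho>' x = 0"
proof -
  show 1: "GDERIV \<rho> x :> \<rho>' x" "continuous_on UNIV \<rho>'" "0 \<le> \<rho> x" "norm x \<ge> \<delta> \<Longrightarrow> \<rho> x = 0" "\<rho> (- x) = \<rho> x"
    "(\<integral>x. \<rho> x \<partial>lebesgue) = 1" for x
    using moll by (auto simp: mollifier_def)
  show "continuous_on UNIV \<rho>" by (rule GDERIV_imp_continuous) (rule 1)
  show "norm x \<ge> \<delta> \<Longrightarrow> \<rho>' x = 0" by (rule GDERIV_zero_outside_ball[OF 1(1,2,4)])
qed

lemma mollifier_conv_integrable:
  "locally_integrable f \<Longrightarrow> integrable lebesgue (\<lambda>y. \<rho> (x - y) *\<^sub>R f y)"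
  by (rule conv_integrable[OF mollifierD(7,4)])

lemma mollifier_conv_continuous:
  "locally_integrable f \<Longrightarrow> continuous_on UNIV (conv \<rho> f)"
  by (rule conv_continuous[OF mollifierD(7,4)])

lemma mollifier_conv_has_derivative:
  "locally_integrable f \<Longrightarrow> (conv \<rho> f has_derivative (\<lambda>h. conv (\<lambda>z. h \<bullet> \<rho>' z) f x)) (at x)"
  by (rule conv_has_derivative[OF mollifierD(1,2,4)])

lemma mollifier_conv_derivative_continuous:
  "locally_integrable f \<Longrightarrow> continuous_on UNIV (conv (\<lambda>z. h \<bullet> \<rho>' z) f)"
  by (rule conv_continuous[where \<delta> = \<delta>]) (auto intro!: continuous_intros mollifierD(2) simp: mollifierD(8))

lemma conv_bounded_linear:
  assumes "bounded_linear T" "locally_integrable f"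
  shows "conv \<rho> (\<lambda>y. T (f y)) x = T (conv \<rho> f x)"
  unfolding conv_def integral_bounded_linear[OF assms(1) mollifier_conv_integrable[OF assms(2)], symmetric]
  by (simp add: linear_cmul[OF bounded_linear.linear[OF assms(1)]])

lemma mollifier_mass:
  "integrable lebesgue (\<lambda>y. \<rho> (x - y))" "(\<integral>y. \<rho> (x - y) \<partial>lebesgue) = 1"
proof -
  show "integrable lebesgue (\<lambda>y. \<rho> (x - y))"
    using mollifier_conv_integrable[OF continuous_imp_locally_integrable[OF continuous_on_const], of x "1::real"]
    by simp
  show "(\<integral>y. \<rho> (x - y) \<partial>lebesgue) = 1"
    using integral_reflect[of \<rho> x] mollifierD(6,7) by (simp add: borel_measurable_continuous_onI)
qed

lemma mollifier_conv_diff_le: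
  fixes f :: "real^'d \<Rightarrow> 'b::euclidean_space"
  assumes f: "locally_integrable f" and B: "\<And>y. norm (x - y) < \<delta> \<Longrightarrow> norm (f y - c) \<le> B"
  shows "norm (conv \<rho> f x - c) \<le> B"
proof -
  have int: "integrable lebesgue (\<lambda>y. \<rho> (x - y) *\<^sub>R c)"
    by (intro integrable_scaleR_left) (simp add: mollifier_mass)
  have "c = (\<integral>y. \<rho> (x - y) *\<^sub>R c \<partial>lebesgue)" using mollifier_mass by simp
  then have "conv \<rho> f x - c = (\<integral>y. \<rho> (x - y) *\<^sub>R f y - \<rho> (x - y) *\<^sub>R c \<partial>lebesgue)"
    unfolding conv_def
    by (subst Bochner_Integration.integral_diff[OF mollifier_conv_integrable[OF f] int]) simp
  also have "norm \<dots> \<le> (\<integral>y. \<rho> (x - y) * B \<partial>lebesgue)"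
  proof (rule Bochner_Integration.integral_norm_bound_integral)
    fix y
    show "norm (\<rho> (x - y) *\<^sub>R f y - \<rho> (x - y) *\<^sub>R c) \<le> \<rho> (x - y) * B"
    proof (cases "norm (x - y) < \<delta>")
      case True
      then show ?thesis
        using mult_left_mono[OF B[OF True] mollifierD(3)[of "x - y"]] mollifierD(3)[of "x - y"]
        by (simp add: scaleR_diff_right[symmetric])
    qed (simp add: mollifierD(4))
  qed (use mollifier_conv_integrable[OF f] int mollifier_mass in auto)
  also have "\<dots> = B" using mollifier_mass by simp
  finally show ?thesis .
qed

lemma mollifier_conv_ge:
  fixes f :: "real^'d \<Rightarrow> real"
  assumes f: "locally_integrable f" and B: "\<And>y. norm (x - y) < \<delta> \<Longrightarrow> B \<le> f y"
  shows "B \<le> conv \<rho> f x"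
proof -
  have "B = (\<integral>y. \<rho> (x - y) * B \<partial>lebesgue)" using mollifier_mass by simp
  also have "\<dots> \<le> conv \<rho> f x"
    unfolding conv_def real_scaleR_def
  proof (rule integral_mono)
    fix y
    show "\<rho> (x - y) * B \<le> \<rho> (x - y) * f y"
      using B[of y] mollifierD(3)[of "x - y"] mollifierD(4)[of "x - y"]
      by (cases "norm (x - y) < \<delta>") (auto intro: mult_left_mono)
  qed (use mollifier_conv_integrable[OF f, of x] mollifier_mass in auto)
  finally show ?thesis .
qed

lemma mollifier_conv_le:
  fixes f :: "real^'d \<Rightarrow> real"
  assumes f: "locally_integrable f" and B: "\<And>y. norm (x - y) < \<delta> \<Longrightarrow> f y \<le> B"
  shows "conv \<rho> f x \<le> B"
proof -
  have "conv \<rho> f x \<le> (\<integral>y. \<rho> (x - y) * B \<partial>lebesgue)"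
    unfolding conv_def real_scaleR_def
  proof (rule integral_mono)
    fix y
    show "\<rho> (x - y) * f y \<le> \<rho> (x - y) * B"
      using B[of y] mollifierD(3)[of "x - y"] mollifierD(4)[of "x - y"]
      by (cases "norm (x - y) < \<delta>") (auto intro: mult_left_mono)
  qed (use mollifier_conv_integrable[OF f, of x] mollifier_mass in auto)
  also have "\<dots> = B" using mollifier_mass by simp
  finally show ?thesis .
qed

text \<open>
  Tonelli's theorem, applied to a Borel representative of \<open>g\<close> so that the integrand is measurable for
  the product of two Borel measures. It turns pointwise commutator bounds into bounds in \<open>L\<^sup>1\<close>.
\<close>

lemma integral_mollifier_conv:
  fixes g :: "real^'d \<Rightarrow> real"
  assumes g: "integrable lebesgue g" and pos: "\<And>x. 0 \<le> g x"
  shows "integrable lebesgue (conv \<rho> g)" "(\<integral>x. conv \<rho> g x \<partial>lebesgue) = (\<integral>x. g x \<partial>lebesgue)"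
proof -
  have \<rho>m: "\<rho> \<in> borel_measurable borel" using mollifierD(7) by (rule borel_measurable_continuous_onI)
  obtain g0 where g0: "g0 \<in> borel_measurable lborel" "AE x in lborel. g x = g0 x"
    using completion_ex_borel_measurable_real[OF borel_measurable_integrable[OF g]] by blast
  define g' where "g' x = max 0 (g0 x)" for x
  have g': "g' \<in> borel_measurable borel" "\<And>x. 0 \<le> g' x" using g0(1) by (auto simp: g'_def[abs_def])
  have ae: "AE x in lborel. g x = g' x" using g0(2)
  proof (rule eventually_mono)
    show "g x = g' x" if "g x = g0 x" for x using that pos[of x] by (simp add: g'_def)
  qed
  then have ael: "AE x in lebesgue. g x = g' x" by (rule AE_completion)
  have gl: "locally_integrable g" by (rule integrable_imp_locally_integrable[OF g])
  have conv_nn: "ennreal (conv \<rho> g x) = (\<integral>\<^sup>+y. ennreal (\<rho> (x - y) * g' y) \<partial>lborel)" for x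
  proof -
    have "ennreal (conv \<rho> g x) = (\<integral>\<^sup>+y. ennreal (\<rho> (x - y) * g y) \<partial>lebesgue)"
      unfolding conv_def real_scaleR_def
      using mollifier_conv_integrable[OF gl, of x] pos mollifierD(3)
      by (subst nn_integral_eq_integral) auto
    also have "\<dots> = (\<integral>\<^sup>+y. ennreal (\<rho> (x - y) * g' y) \<partial>lebesgue)"
      using ael by (intro nn_integral_cong_AE) (auto elim!: eventually_mono)
    finally show ?thesis by (simp add: nn_integral_completion)
  qed
  have m1: "\<integral>\<^sup>+x. ennreal (\<rho> (x - y)) \<partial>lborel = 1" for y
  proof -
    have sym: "\<rho> (x - y) = \<rho> (y - x)" for x using mollifierD(5)[of "x - y"] by simp
    have "\<integral>\<^sup>+x. ennreal (\<rho> (y - x)) \<partial>lebesgue = ennreal (\<integral>x. \<rho> (y - x) \<partial>lebesgue)"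
      using mollifier_mass(1) mollifierD(3) by (intro nn_integral_eq_integral) auto
    then show ?thesis unfolding sym by (simp add: nn_integral_completion mollifier_mass(2))
  qed
  have "(\<integral>\<^sup>+x. ennreal (conv \<rho> g x) \<partial>lborel) = (\<integral>\<^sup>+x. \<integral>\<^sup>+y. ennreal (\<rho> (x - y) * g' y) \<partial>lborel \<partial>lborel)"
    by (simp only: conv_nn)
  also have "\<dots> = (\<integral>\<^sup>+y. \<integral>\<^sup>+x. ennreal (\<rho> (x - y) * g' y) \<partial>lborel \<partial>lborel)"
  proof (rule lborel_pair.Fubini')
    have "(\<lambda>p. \<rho> (snd p - fst p)) \<in> borel_measurable (borel \<Otimes>\<^sub>M borel)"
      by (intro measurable_compose[OF _ \<rho>m] borel_measurable_diff measurable_fst measurable_snd)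
    moreover have "(\<lambda>p. g' (fst p)) \<in> borel_measurable (borel \<Otimes>\<^sub>M borel)"
      by (rule measurable_compose[OF measurable_fst g'(1)])
    ultimately have "(\<lambda>p. ennreal (\<rho> (snd p - fst p) * g' (fst p))) \<in> borel_measurable (borel \<Otimes>\<^sub>M borel)"
      by measurable
    then show "(\<lambda>(y, x). ennreal (\<rho> (x - y) * g' y)) \<in> borel_measurable (lborel \<Otimes>\<^sub>M lborel)"
      by (simp add: case_prod_beta' cong: measurable_cong_sets sets_pair_measure_cong)
  qed
  also have "\<dots> = (\<integral>\<^sup>+y. (\<integral>\<^sup>+x. ennreal (\<rho> (x - y)) \<partial>lborel) * ennreal (g' y) \<partial>lborel)"
    using g'(2) mollifierD(3) \<rho>m by (intro nn_integral_cong, subst nn_integral_multc[symmetric]) (auto simp: ennreal_mult)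
  also have "\<dots> = (\<integral>\<^sup>+y. ennreal (g' y) \<partial>lborel)" by (simp add: m1)
  also have "\<dots> = (\<integral>\<^sup>+y. ennreal (g y) \<partial>lborel)"
    using ae by (intro nn_integral_cong_AE) (auto elim!: eventually_mono)
  finally have nn: "(\<integral>\<^sup>+x. ennreal (conv \<rho> g x) \<partial>lebesgue) = (\<integral>\<^sup>+y. ennreal (g y) \<partial>lebesgue)"
    by (simp add: nn_integral_completion)
  have cpos: "0 \<le> conv \<rho> g x" for x by (rule mollifier_conv_ge[OF gl]) (rule pos)
  have cm: "conv \<rho> g \<in> borel_measurable lebesgue"
    using borel_measurable_continuous_onI[OF mollifier_conv_continuous[OF gl]]
    by (intro measurable_completion) simp
  have fin: "(\<integral>\<^sup>+y. ennreal (g y) \<partial>lebesgue) = ennreal (\<integral>x. g x \<partial>lebesgue)"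
    using g pos by (intro nn_integral_eq_integral) auto
  show "integrable lebesgue (conv \<rho> g)"
    using cm cpos nn fin by (intro integrableI_nonneg) auto
  show "(\<integral>x. conv \<rho> g x \<partial>lebesgue) = (\<integral>x. g x \<partial>lebesgue)"
    using cm cpos nn g pos by (simp add: integral_eq_nn_integral borel_measurable_integrable)
qed

end

section \<open>Mollified weak derivatives and coefficients\<close>

lemma has_derivative_norm_le_lipschitz:
  fixes f :: "'a::real_normed_vector \<Rightarrow> 'b::real_normed_vector"
  assumes D: "(f has_derivative f') (at x)" and L: "\<And>y. norm (f y - f x) \<le> L * norm (y - x)"
  shows "norm (f' h) \<le> L * norm h"
proof (cases "h = 0")
  case True
  then show ?thesis using linear_0[OF has_derivative_linear[OF D]] by simp
next
  case False
  have "norm (f' h) \<le> L * norm h + e" if "e > 0" for e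
  proof -
    define e' where "e' = e / norm h"
    have "e' > 0" using that False by (simp add: e'_def)
    then obtain d where d: "d > 0"
      "\<And>y. norm (y - x) < d \<Longrightarrow> norm (f y - f x - f' (y - x)) \<le> e' * norm (y - x)"
      using D unfolding has_derivative_at_alt by blast
    define t where "t = d / (2 * norm h)"
    have t: "t > 0" "norm (t *\<^sub>R h) < d" using d(1) False by (auto simp: t_def)
    have "t * norm (f' h) = norm (f' (t *\<^sub>R h))"
      using linear_cmul[OF has_derivative_linear[OF D]] t by simp
    also have "\<dots> \<le> norm (f (x + t *\<^sub>R h) - f x) + norm (f (x + t *\<^sub>R h) - f x - f' (t *\<^sub>R h))"
      using norm_triangle_ineq4[of "f (x + t *\<^sub>R h) - f x" "f (x + t *\<^sub>R h) - f x - f' (t *\<^sub>R h)"] by simp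
    also have "\<dots> \<le> L * norm (t *\<^sub>R h) + e' * norm (t *\<^sub>R h)"
      using L[of "x + t *\<^sub>R h"] d(2)[of "x + t *\<^sub>R h"] t by (intro add_mono) auto
    also have "\<dots> = t * (L * norm h + e)" using t False by (simp add: e'_def field_simps)
    finally show ?thesis using t by simp
  qed
  then show ?thesis by (rule field_le_epsilon)
qed

lemma Lp_loc_integrable:
  assumes "Lp_loc 1 D f" "compact C" "C \<subseteq> D"
  shows "integrable lebesgue (\<lambda>y. indicator C y * f y)"
proof -
  have Dm: "(\<lambda>x. indicator D x *\<^sub>R f x) \<in> borel_measurable lebesgue"
    using assms(1) by (simp add: Lp_loc_def set_borel_measurable_def)
  have "C \<in> sets lebesgue" using assms(2) by (simp add: lmeasurable_compact fmeasurableD)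
  then have "(\<lambda>x. indicator C x * (indicator D x *\<^sub>R f x)) \<in> borel_measurable lebesgue"
    using Dm by (intro borel_measurable_times borel_measurable_indicator)
  moreover have "(\<lambda>x. indicator C x * (indicator D x *\<^sub>R f x)) = (\<lambda>x. indicator C x * f x)"
    using assms(3) by (auto simp: fun_eq_iff indicator_def)
  ultimately have m: "(\<lambda>x. indicator C x * f x) \<in> borel_measurable lebesgue" by simp
  have "integrable lebesgue (\<lambda>x. indicator C x *\<^sub>R (\<bar>f x\<bar> powr 1))"
    using assms by (simp add: Lp_loc_def set_integrable_def)
  then have "integrable lebesgue (\<lambda>x. norm (indicator C x * f x))"
    by (simp add: abs_mult)
  then show ?thesis using m by (rule integrable_norm_cancel)
qed

lemma integrable_vec:
  fixes f :: "'a \<Rightarrow> ('b::euclidean_space)^'n"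
  assumes "\<And>i. integrable M (\<lambda>x. f x $ i)"
  shows "integrable M f"
proof -
  have "integrable M (\<lambda>x. \<Sum>i\<in>UNIV. axis i (f x $ i))"
  proof (intro Bochner_Integration.integrable_sum integrable_bounded_linear[OF _ assms])
    show "bounded_linear (\<lambda>z::'b. axis i z :: 'b^'n)" for i
      by (rule linear_conv_bounded_linear[THEN iffD1]) (auto simp: linear_iff axis_def vec_eq_iff)
  qed
  also have "(\<lambda>x. \<Sum>i\<in>UNIV. axis i (f x $ i)) = f"
    by (auto simp: fun_eq_iff vec_eq_iff axis_def if_distrib cong: if_cong)
  finally show ?thesis .
qed

context
  fixes \<delta> \<rho> and \<rho>' :: "real^'d \<Rightarrow> real^'d"
  assumes moll: "mollifier \<delta> \<rho> \<rho>'"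
begin

text \<open>
  The function \<open>\<lambda>y. \<rho> (x - y)\<close> is itself an admissible test function when the ball around \<open>x\<close> lies in
  \<open>C\<close>, so the definition of the weak gradient moves the derivative from the kernel to \<open>u\<close>.
\<close>

lemma conv_weak_gradient:
  assumes w: "weak_gradient D u G" and C: "compact C" "C \<subseteq> D" and x: "ball x \<delta> \<subseteq> C"
  shows "conv (\<lambda>z. h \<bullet> \<rho>' z) (\<lambda>y. indicator C y * u y) x = h \<bullet> conv \<rho> (\<lambda>y. indicator C y *\<^sub>R G y) x"
proof -
  note M = mollifierD[OF moll]
  let ?u = "\<lambda>y. indicator C y * u y" and ?G = "\<lambda>y. indicator C y *\<^sub>R G y"
  have u: "locally_integrable ?u"
    using w C by (intro integrable_imp_locally_integrable Lp_loc_integrable) (auto simp: weak_gradient_def)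
  have "integrable lebesgue ?G"
    using w C by (intro integrable_vec) (auto intro!: Lp_loc_integrable simp: weak_gradient_def)
  then have G: "locally_integrable ?G" by (rule integrable_imp_locally_integrable)
  have C1: "y \<in> C" "y \<in> D" if "norm (x - y) < \<delta>" for y
    using that x C(2) by (auto simp: dist_norm)
  have comp: "conv (\<lambda>z. \<rho>' z $ j) ?u x = conv \<rho> ?G x $ j" for j
  proof -
    define \<eta> where "\<eta> y = \<rho> (x - y)" for y
    define \<eta>' where "\<eta>' y = - \<rho>' (x - y)" for y
    have 1: "GDERIV \<eta> y :> \<eta>' y" for y
    proof -
      have "((\<lambda>y. x - y) has_derivative (\<lambda>h. - h)) (at y)" by (auto intro!: derivative_eq_intros)
      from has_derivative_compose[OF this M(1)[of "x - y", unfolded gderiv_def]]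
      show ?thesis by (simp add: gderiv_def \<eta>_def[abs_def] \<eta>'_def)
    qed
    have 2: "continuous_on UNIV \<eta>'"
      unfolding \<eta>'_def by (intro continuous_intros continuous_on_compose2[OF M(2)]) auto
    have 3: "\<eta> y = 0" if "y \<notin> C" for y
      using that C1(1)[of y] M(4)[of "x - y"] by (cases "norm (x - y) < \<delta>") (auto simp: \<eta>_def)
    have "(LINT x:D|lebesgue. u x * \<eta>' x $ j) = - (LINT x:D|lebesgue. G x $ j * \<eta> x)"
      using w 1 2 3 C unfolding weak_gradient_def by blast
    moreover have "indicator D y *\<^sub>R (u y * \<eta>' y $ j) = - ((\<rho>' (x - y) $ j) *\<^sub>R ?u y)" for y
      using C1[of y] M(8)[of "x - y"] by (cases "norm (x - y) < \<delta>") (auto simp: \<eta>'_def)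
    moreover have "indicator D y *\<^sub>R (G y $ j * \<eta> y) = \<rho> (x - y) *\<^sub>R (?G y $ j)" for y
      using C1[of y] M(4)[of "x - y"] by (cases "norm (x - y) < \<delta>") (auto simp: \<eta>_def)
    ultimately have "conv (\<lambda>z. \<rho>' z $ j) ?u x = conv \<rho> (\<lambda>y. ?G y $ j) x"
      unfolding set_lebesgue_integral_def conv_def by (simp only: Bochner_Integration.integral_minus)
    also have "\<dots> = conv \<rho> ?G x $ j" by (rule conv_bounded_linear[OF moll bounded_linear_vec_nth G])
    finally show ?thesis .
  qed
  have "conv (\<lambda>z. h \<bullet> \<rho>' z) ?u x = (\<integral>y. (\<Sum>j\<in>UNIV. h $ j *\<^sub>R ((\<rho>' (x - y) $ j) *\<^sub>R ?u y)) \<partial>lebesgue)"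
    unfolding conv_def by (simp add: inner_vec_def sum_distrib_right mult.assoc)
  also have "\<dots> = (\<Sum>j\<in>UNIV. h $ j *\<^sub>R conv (\<lambda>z. \<rho>' z $ j) ?u x)"
    unfolding conv_def
  proof (subst Bochner_Integration.integral_sum)
    fix j
    show "integrable lebesgue (\<lambda>y. h $ j *\<^sub>R ((\<rho>' (x - y) $ j) *\<^sub>R ?u y))"
      by (intro integrable_scaleR_right conv_integrable[OF _ _ u, where \<delta> = \<delta> and k = "\<lambda>z. \<rho>' z $ j"]
         continuous_intros M(2)) (simp add: M(8))
  qed (simp only: integral_scaleR_right)
  also have "\<dots> = h \<bullet> conv \<rho> ?G x" by (simp add: comp inner_vec_def)
  finally show ?thesis .
qed

lemma conv_weak_gradient_vec:
  fixes G :: "real^'d \<Rightarrow> real^'d"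
  assumes w: "\<And>i. weak_gradient D (\<lambda>x. G x $ i) (\<lambda>x. H x $ i)" and C: "compact C" "C \<subseteq> D"
    and x: "ball x \<delta> \<subseteq> C"
  shows "conv (\<lambda>z. h \<bullet> \<rho>' z) (\<lambda>y. indicator C y *\<^sub>R G y) x = conv \<rho> (\<lambda>y. indicator C y *\<^sub>R H y) x *v h"
proof -
  note M = mollifierD[OF moll]
  let ?G = "\<lambda>y. indicator C y *\<^sub>R G y" and ?H = "\<lambda>y. indicator C y *\<^sub>R H y"
  have "integrable lebesgue ?G"
    using w C by (intro integrable_vec) (auto intro!: Lp_loc_integrable simp: weak_gradient_def)
  then have G: "locally_integrable ?G" by (rule integrable_imp_locally_integrable)
  have "integrable lebesgue ?H"
    using w C by (intro integrable_vec) (auto intro!: Lp_loc_integrable simp: weak_gradient_def)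
  then have H: "locally_integrable ?H" by (rule integrable_imp_locally_integrable)
  have int: "integrable lebesgue (\<lambda>y. (h \<bullet> \<rho>' (x - y)) *\<^sub>R ?G y)"
    by (rule conv_integrable[OF _ _ G, where \<delta> = \<delta> and k = "\<lambda>z. h \<bullet> \<rho>' z"])
       (auto intro!: continuous_intros M(2) simp: M(8))
  show ?thesis
  proof (rule vec_eq_iff[THEN iffD2], rule allI)
    fix i
    have "conv (\<lambda>z. h \<bullet> \<rho>' z) ?G x $ i = conv (\<lambda>z. h \<bullet> \<rho>' z) (\<lambda>y. indicator C y * G y $ i) x"
      unfolding conv_def
      using integral_bounded_linear[OF bounded_linear_vec_nth int, of i] by (simp add: mult.assoc)
    also have "\<dots> = h \<bullet> conv \<rho> (\<lambda>y. indicator C y *\<^sub>R (H y $ i)) x"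
      by (rule conv_weak_gradient[OF w C x])
    also have "conv \<rho> (\<lambda>y. indicator C y *\<^sub>R (H y $ i)) x = conv \<rho> ?H x $ i"
      using conv_bounded_linear[OF moll bounded_linear_vec_nth H, of i x] by simp
    finally show "conv (\<lambda>z. h \<bullet> \<rho>' z) ?G x $ i = (conv \<rho> ?H x *v h) $ i"
      by (simp add: matrix_vector_mul_component inner_commute)
  qed
qed

text \<open>
  Mollifying preserves the Lipschitz constant, which bounds the derivative of the mollified
  coefficient independently of the scale \<open>\<delta>\<close>.
\<close>

lemma mollifier_conv_lipschitz:
  fixes f :: "real^'d \<Rightarrow> 'b::euclidean_space"
  assumes f: "continuous_on UNIV f" and L: "\<And>x y. norm (f x - f y) \<le> L * norm (x - y)"
  shows "norm (conv \<rho> f x - conv \<rho> f x') \<le> L * norm (x - x')"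
proof -
  note M = mollifierD[OF moll]
  have f': "locally_integrable f" by (rule continuous_imp_locally_integrable[OF f])
  have eq: "conv \<rho> f x = (\<integral>z. \<rho> z *\<^sub>R f (x - z) \<partial>lebesgue)" for x
    unfolding conv_def using integral_reflect[of "\<lambda>z. \<rho> z *\<^sub>R f (x - z)" x]
    by (simp add: borel_measurable_continuous_onI M(7) f continuous_on_compose2[OF f] continuous_intros)
  have int: "integrable lebesgue (\<lambda>z. \<rho> z *\<^sub>R f (x - z))" for x
    by (rule integrable_continuous_bounded_support[of _ \<delta>])
       (auto intro!: M(7) f continuous_on_compose2[OF f] continuous_intros simp: M(4))
  have "norm (conv \<rho> f x - conv \<rho> f x') = norm (\<integral>z. \<rho> z *\<^sub>R f (x - z) - \<rho> z *\<^sub>R f (x' - z) \<partial>lebesgue)"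
    unfolding eq by (simp add: int Bochner_Integration.integral_diff)
  also have "\<dots> \<le> (\<integral>z. \<rho> z * (L * norm (x - x')) \<partial>lebesgue)"
  proof (rule Bochner_Integration.integral_norm_bound_integral)
    show "integrable lebesgue (\<lambda>z. \<rho> z * (L * norm (x - x')))"
      using mollifier_mass(1)[OF moll, of 0] M(5) by simp
    show "norm (\<rho> z *\<^sub>R f (x - z) - \<rho> z *\<^sub>R f (x' - z)) \<le> \<rho> z * (L * norm (x - x'))" for z
      using mult_left_mono[OF L[of "x - z" "x' - z"] M(3)[of z]] M(3)[of z]
      by (simp add: scaleR_diff_right[symmetric])
  qed (use int in auto)
  also have "\<dots> = L * norm (x - x')" using M(6) by simp
  finally show ?thesis .
qed

lemma mollifier_conv_elliptic:
  fixes a :: "real^'d \<Rightarrow> real^'d^'d"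
  assumes a: "continuous_on UNIV a" and ell: "\<And>x \<xi>. \<kappa> * (\<xi> \<bullet> \<xi>) \<le> \<xi> \<bullet> (a x *v \<xi>)"
  shows "\<kappa> * (\<xi> \<bullet> \<xi>) \<le> \<xi> \<bullet> (conv \<rho> a x *v \<xi>)"
proof -
  have T: "bounded_linear (\<lambda>N::real^'d^'d. \<xi> \<bullet> (N *v \<xi>))"
    by (intro bounded_linear_compose[OF bounded_linear_inner_right]
         bounded_bilinear.bounded_linear_left[OF bounded_bilinear_matrix_vector])
  have "\<kappa> * (\<xi> \<bullet> \<xi>) \<le> conv \<rho> (\<lambda>y. \<xi> \<bullet> (a y *v \<xi>)) x"
    using ell by (intro mollifier_conv_ge[OF moll] continuous_imp_locally_integrable
        bounded_linear.continuous_on[OF T a])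
  also have "\<dots> = \<xi> \<bullet> (conv \<rho> a x *v \<xi>)"
    by (rule conv_bounded_linear[OF moll T continuous_imp_locally_integrable[OF a]])
  finally show ?thesis .
qed

end

section \<open>The approximate weak equation\<close>

text \<open>
  Here \<open>v\<close>, \<open>V\<close> and \<open>\<alpha>\<close> stand for the mollified eigenfunction, its gradient and the mollified
  diffusion matrix. The function \<open>m\<close> is the part of \<open>div (\<alpha> V)\<close> in which the derivative falls on
  \<open>\<alpha>\<close>. The integral is the weak form of \<open>\<mu> v + b \<bullet> V + \<epsilon> / 2 * trace (\<alpha> V') = 0\<close>; test functions are
  supported in \<open>S\<close>, and the error is measured against their supremum norm.
\<close>

definition approximate_weak_solution ::
  "(real^'d) set \<Rightarrow> real \<Rightarrow> real \<Rightarrow> real \<Rightarrow> (real^'d \<Rightarrow> real^'d) \<Rightarrow>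
     (real^'d \<Rightarrow> real) \<Rightarrow> (real^'d \<Rightarrow> real^'d) \<Rightarrow> (real^'d \<Rightarrow> real^'d^'d) \<Rightarrow> (real^'d \<Rightarrow> real) \<Rightarrow> bool" where
  "approximate_weak_solution S e \<epsilon> \<mu> b v V \<alpha> m \<longleftrightarrow>
     continuous_on UNIV v \<and> continuous_on UNIV V \<and> continuous_on UNIV \<alpha> \<and> continuous_on UNIV m \<and>
     (\<forall>x\<in>S. GDERIV v x :> V x) \<and>
     (\<forall>\<phi> \<phi>' N. (\<forall>x. GDERIV \<phi> x :> \<phi>' x) \<and> continuous_on UNIV \<phi>' \<and>
        (\<forall>x. x \<notin> S \<longrightarrow> \<phi> x = 0) \<and> (\<forall>x. \<bar>\<phi> x\<bar> \<le> N) \<longrightarrow>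
        \<bar>(\<integral>x. \<mu> * v x * \<phi> x + \<phi> x * (b x \<bullet> V x) -
             \<epsilon> / 2 * (\<phi> x * m x + \<phi>' x \<bullet> (\<alpha> x *v V x)) \<partial>lebesgue)\<bar> \<le> e * N)"

text \<open>
  The coefficients are Lipschitz on the whole space, so that they can be mollified without regard
  to the domain.
\<close>

locale positive_eigenfunction =
  fixes D :: "(real^'d) set" and u :: "real^'d \<Rightarrow> real"
    and G :: "real^'d \<Rightarrow> real^'d" and H :: "real^'d \<Rightarrow> real^'d^'d"
    and a :: "real^'d \<Rightarrow> real^'d^'d" and b :: "real^'d \<Rightarrow> real^'d"
    and La Lb \<kappa> \<epsilon> \<mu> :: real
  assumes gradient_u: "weak_gradient D u G"
    and hessian_u: "\<And>i. weak_gradient D (\<lambda>x. G x $ i) (\<lambda>x. H x $ i)"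
    and a_lipschitz: "\<And>x y. norm (a x - a y) \<le> La * norm (x - y)"
    and a_elliptic: "\<And>x \<xi>. \<kappa> * (\<xi> \<bullet> \<xi>) \<le> \<xi> \<bullet> (a x *v \<xi>)"
    and b_lipschitz: "\<And>x y. norm (b x - b y) \<le> Lb * norm (x - y)"
    and constants: "\<kappa> > 0" "\<epsilon> > 0" "La \<ge> 0" "Lb \<ge> 0"
    and eigen_equation:
      "AE x in lebesgue. x \<in> D \<longrightarrow> G x \<bullet> b x + \<epsilon> / 2 * trace (a x ** H x) = - (\<mu> * u x)"
    and u_continuous: "continuous_on D u"
    and u_pos: "\<And>x. x \<in> D \<Longrightarrow> u x > 0"
begin

text \<open>
  Let \<open>E\<close> be what the mollified eigenfunction leaves over when inserted into the equation with
  coefficients \<open>\<alpha>\<close> and \<open>b\<close>. Since the equation holds for \<open>u\<close>, only the differences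
  \<open>\<alpha> x - a y\<close> and \<open>b x - b y\<close> with \<open>\<bar>x - y\<bar> < \<delta>\<close> contribute to \<open>E\<close>, so \<open>\<bar>E\<bar>\<close> is at most \<open>\<delta>\<close> times the
  mollification of a fixed integrable function. Integrating the divergence of \<open>\<phi> \<alpha> V\<close> then gives
  the weak form.
\<close>

lemma approximate_weak_formulation:
  assumes C: "compact C" "C \<subseteq> D" and C0: "closed C0" and r: "r > 0" "\<And>x. x \<in> C0 \<Longrightarrow> ball x r \<subseteq> C"
    and e: "e > 0"
  obtains \<delta> \<rho> \<rho>' v V \<alpha> m where
    "0 < \<delta>" "\<delta> \<le> r" "mollifier \<delta> \<rho> \<rho>'"
    "locally_integrable (\<lambda>y. indicator C y * u y)" "v = conv \<rho> (\<lambda>y. indicator C y * u y)"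
    "approximate_weak_solution C0 e \<epsilon> \<mu> b v V \<alpha> m"
    "\<forall>x \<xi>. \<kappa> * (\<xi> \<bullet> \<xi>) \<le> \<xi> \<bullet> (\<alpha> x *v \<xi>)"
    "\<forall>x. norm (\<alpha> x - a x) \<le> 1"
    "\<forall>x. \<bar>m x\<bar> \<le> real CARD('d) * La * norm (V x)"
proof -
  note a = a_lipschitz and b = b_lipschitz and ell = a_elliptic
    and \<kappa> = constants(1) and \<epsilon> = constants(2) and La = constants(3) and Lb = constants(4)
  define uC where "uC y = indicator C y * u y" for y
  define GC where "GC y = indicator C y *\<^sub>R G y" for y
  define HC where "HC y = indicator C y *\<^sub>R H y" for y
  have iu: "integrable lebesgue uC"
    unfolding uC_def using gradient_u C by (intro Lp_loc_integrable) (auto simp: weak_gradient_def)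
  have iG: "integrable lebesgue GC"
    unfolding GC_def using gradient_u C by (intro integrable_vec) (auto intro!: Lp_loc_integrable simp: weak_gradient_def)
  have iH: "integrable lebesgue HC"
    unfolding HC_def using hessian_u C by (intro integrable_vec) (auto intro!: Lp_loc_integrable simp: weak_gradient_def)
  note li = integrable_imp_locally_integrable[OF iu] integrable_imp_locally_integrable[OF iG]
    integrable_imp_locally_integrable[OF iH]
  have ca: "continuous_on UNIV a" by (rule lipschitz_imp_continuous_on_UNIV[OF a La])
  have cb: "continuous_on UNIV b" by (rule lipschitz_imp_continuous_on_UNIV[OF b Lb])
  note lia = continuous_imp_locally_integrable[OF ca]
  \<comment> \<open>The integrable function whose mollification dominates the error.\<close>
  define g where "g y = norm (HC y) + norm (GC y)" for y
  have ig: "integrable lebesgue g" unfolding g_def by (intro Bochner_Integration.integrable_add integrable_norm iG iH)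
  have g0: "g y \<ge> 0" for y by (simp add: g_def)
  define I where "I = (\<integral>y. g y \<partial>lebesgue)"
  have I0: "I \<ge> 0" unfolding I_def using g0 by (rule Bochner_Integration.integral_nonneg)
  define KH where "KH = \<epsilon> / 2 * ((real CARD('d))\<^sup>2 * (2 * La))"
  define K where "K = KH + Lb"
  have K: "KH \<ge> 0" "KH \<le> K" "Lb \<le> K" "K \<ge> 0" using La Lb \<epsilon> by (auto simp: K_def KH_def)
  \<comment> \<open>The three bounds keep the kernels around points of \<open>C0\<close> inside \<open>C\<close>, the error below \<open>e\<close>, and \<open>\<alpha>\<close> within distance 1 of \<open>a\<close>.\<close>
  define \<delta> where "\<delta> = min r (min (e / (K * I + 1)) (1 / (La + 1)))"
  have KI: "K * I \<ge> 0" using K(4) I0 by simp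
  have \<delta>: "\<delta> > 0" "\<delta> \<le> r" "\<delta> * (K * I) \<le> e" "La * \<delta> \<le> 1"
  proof -
    show "\<delta> > 0" unfolding \<delta>_def using r(1) e KI La by simp
    show "\<delta> \<le> r" by (simp add: \<delta>_def)
    have "\<delta> \<le> e / (K * I + 1)" by (simp add: \<delta>_def)
    then have "\<delta> * (K * I) \<le> e / (K * I + 1) * (K * I)" using KI by (rule mult_right_mono)
    also have "\<dots> = e * ((K * I) / (K * I + 1))" by simp
    also have "\<dots> \<le> e * 1" using KI e by (intro mult_left_mono) (auto simp: divide_simps)
    finally show "\<delta> * (K * I) \<le> e" by simp
    have "La * \<delta> \<le> La * (1 / (La + 1))" using La by (intro mult_left_mono) (auto simp: \<delta>_def)
    also have "\<dots> \<le> 1" using La by (simp add: divide_simps)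
    finally show "La * \<delta> \<le> 1" .
  qed
  obtain \<rho> \<rho>' where moll: "mollifier \<delta> \<rho> (\<rho>' :: real^'d \<Rightarrow> real^'d)" using mollifier_exists[OF \<delta>(1)] by blast
  note M = mollifierD[OF moll]
  define v where "v = conv \<rho> uC"
  define V where "V = conv \<rho> GC"
  define W where "W = conv \<rho> HC"
  define \<alpha> where "\<alpha> = conv \<rho> a"
  define \<alpha>' where "\<alpha>' x h = conv (\<lambda>z. h \<bullet> \<rho>' z) a x" for x h
  define m where "m x = (\<Sum>i\<in>UNIV. (\<alpha>' x (axis i 1) *v V x) $ i)" for x
  have cont: "continuous_on UNIV v" "continuous_on UNIV V" "continuous_on UNIV W" "continuous_on UNIV \<alpha>"
    "continuous_on UNIV (\<lambda>x. \<alpha>' x h)" for h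
    unfolding v_def V_def W_def \<alpha>_def \<alpha>'_def
    by (intro mollifier_conv_continuous[OF moll] mollifier_conv_derivative_continuous[OF moll] li lia)+
  note cmv = bounded_bilinear.continuous_on[OF bounded_bilinear_matrix_vector]
  have cm: "continuous_on UNIV m"
    unfolding m_def by (intro continuous_intros cmv cont)
  have ball: "ball x \<delta> \<subseteq> C" if "x \<in> C0" for x using r(2)[OF that] \<delta>(2) by auto
  have dv: "GDERIV v x :> V x" if "x \<in> C0" for x
    using mollifier_conv_has_derivative[OF moll li(1), of x] conv_weak_gradient[OF moll gradient_u C ball[OF that]]
    unfolding gderiv_def v_def V_def uC_def GC_def by simp
  have dV: "(V has_derivative (\<lambda>h. W x *v h)) (at x)" if "x \<in> C0" for x
    using mollifier_conv_has_derivative[OF moll li(2), of x] conv_weak_gradient_vec[OF moll hessian_u C ball[OF that]]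
    unfolding V_def W_def GC_def HC_def by simp
  have d\<alpha>: "(\<alpha> has_derivative \<alpha>' x) (at x)" for x
    using mollifier_conv_has_derivative[OF moll lia, of x] unfolding \<alpha>_def \<alpha>'_def[abs_def] .
  have \<alpha>'_le: "norm (\<alpha>' x h) \<le> La * norm h" for x h
    by (rule has_derivative_norm_le_lipschitz[OF d\<alpha>]) (unfold \<alpha>_def, rule mollifier_conv_lipschitz[OF moll ca a])
  have \<alpha>_a: "norm (\<alpha> x - a y) \<le> 2 * La * \<delta>" if "norm (x - y) < \<delta>" for x y
    unfolding \<alpha>_def
  proof (rule mollifier_conv_diff_le[OF moll lia])
    fix z assume "norm (x - z) < \<delta>"
    then have "norm (z - y) \<le> 2 * \<delta>"
      using norm_triangle_ineq[of "z - x" "x - y"] that by (simp add: norm_minus_commute)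
    then show "norm (a z - a y) \<le> 2 * La * \<delta>"
      using a[of z y] mult_left_mono[OF _ La, of "norm (z - y)" "2 * \<delta>"] by simp
  qed
  have \<alpha>_near: "norm (\<alpha> x - a x) \<le> 1" for x
    unfolding \<alpha>_def
  proof (rule mollifier_conv_diff_le[OF moll lia])
    fix z assume "norm (x - z) < \<delta>"
    then have "La * norm (z - x) \<le> La * \<delta>" using La by (intro mult_left_mono) (auto simp: norm_minus_commute)
    then show "norm (a z - a x) \<le> 1" using a[of z x] \<delta>(4) by simp
  qed
  have m_le: "\<bar>m x\<bar> \<le> real CARD('d) * La * norm (V x)" for x
  proof -
    have "\<bar>(\<alpha>' x (axis i 1) *v V x) $ i\<bar> \<le> La * norm (V x)" for i
    proof -
      have "\<bar>(\<alpha>' x (axis i 1) *v V x) $ i\<bar> \<le> norm (\<alpha>' x (axis i 1) *v V x)" by (rule component_le_norm_cart)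
      also have "\<dots> \<le> norm (\<alpha>' x (axis i 1)) * norm (V x)" by (rule norm_matrix_vector_mult_le)
      also have "\<dots> \<le> (La * norm (axis i (1::real) :: real^'d)) * norm (V x)" by (intro mult_right_mono \<alpha>'_le) auto
      finally show ?thesis by simp
    qed
    then have "\<bar>m x\<bar> \<le> (\<Sum>i\<in>(UNIV::'d set). La * norm (V x))"
      unfolding m_def by (intro order_trans[OF sum_abs] sum_mono)
    then show ?thesis by simp
  qed
  define E where "E x = \<epsilon> / 2 * trace (\<alpha> x ** W x) + b x \<bullet> V x + \<mu> * v x" for x
  have cE: "continuous_on UNIV E"
    unfolding E_def
    by (intro continuous_intros cont cb bounded_bilinear.continuous_on[OF bounded_bilinear_trace_mult])
  have E_le: "\<bar>E x\<bar> \<le> \<delta> * K * conv \<rho> g x" if x: "x \<in> C0" for x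
  proof -
    let ?T = "\<lambda>N::real^'d^'d. \<epsilon> / 2 * trace (\<alpha> x ** N)"
    have T: "bounded_linear ?T"
      by (intro bounded_linear_const_mult bounded_bilinear.bounded_linear_right[OF bounded_bilinear_trace_mult])
    have e1: "conv \<rho> (\<lambda>y. ?T (HC y)) x = ?T (W x)"
      unfolding W_def by (rule conv_bounded_linear[OF moll T li(3)])
    have e2: "conv \<rho> (\<lambda>y. b x \<bullet> GC y) x = b x \<bullet> V x"
      unfolding V_def by (rule conv_bounded_linear[OF moll bounded_linear_inner_right li(2)])
    have e3: "conv \<rho> (\<lambda>y. \<mu> * uC y) x = \<mu> * v x"
      unfolding v_def by (rule conv_bounded_linear[OF moll bounded_linear_mult_right li(1)])
    have i1: "integrable lebesgue (\<lambda>y. \<rho> (x - y) *\<^sub>R ?T (HC y))"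
      by (intro mollifier_conv_integrable[OF moll] integrable_imp_locally_integrable
          integrable_bounded_linear[OF T] iH)
    have i2: "integrable lebesgue (\<lambda>y. \<rho> (x - y) *\<^sub>R (b x \<bullet> GC y))"
      by (intro mollifier_conv_integrable[OF moll] integrable_imp_locally_integrable
          integrable_inner_right iG)
    have i3: "integrable lebesgue (\<lambda>y. \<rho> (x - y) *\<^sub>R (\<mu> * uC y))"
      by (intro mollifier_conv_integrable[OF moll] integrable_imp_locally_integrable
          integrable_mult_right iu)
    let ?h = "\<lambda>y. \<rho> (x - y) * (?T (HC y) + b x \<bullet> GC y + \<mu> * uC y)"
    have ih: "integrable lebesgue ?h"
      using Bochner_Integration.integrable_add[OF Bochner_Integration.integrable_add[OF i1 i2] i3]
      by (simp add: algebra_simps)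
    have Eh: "E x = (\<integral>y. ?h y \<partial>lebesgue)"
    proof -
      have "E x = (\<integral>y. \<rho> (x - y) *\<^sub>R ?T (HC y) + \<rho> (x - y) *\<^sub>R (b x \<bullet> GC y) + \<rho> (x - y) *\<^sub>R (\<mu> * uC y) \<partial>lebesgue)"
        unfolding E_def e1[symmetric] e2[symmetric] e3[symmetric] conv_def
        using i1 i2 i3 by (simp add: Bochner_Integration.integral_add)
      then show ?thesis by (simp add: algebra_simps)
    qed
    have igr: "integrable lebesgue (\<lambda>y. \<delta> * K * (\<rho> (x - y) * g y))"
      using mollifier_conv_integrable[OF moll integrable_imp_locally_integrable[OF ig], of x]
      by (intro integrable_mult_right) simp
    have "\<bar>E x\<bar> \<le> (\<integral>y. \<bar>?h y\<bar> \<partial>lebesgue)" unfolding Eh by (rule integral_abs_bound)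
    also have "\<dots> \<le> (\<integral>y. \<delta> * K * (\<rho> (x - y) * g y) \<partial>lebesgue)"
    proof (rule integral_mono_AE)
      show "AE y in lebesgue. \<bar>?h y\<bar> \<le> \<delta> * K * (\<rho> (x - y) * g y)"
        using eigen_equation
      proof (rule eventually_mono)
        fix y assume y: "y \<in> D \<longrightarrow> G y \<bullet> b y + \<epsilon> / 2 * trace (a y ** H y) = - (\<mu> * u y)"
        show "\<bar>?h y\<bar> \<le> \<delta> * K * (\<rho> (x - y) * g y)"
        proof (cases "norm (x - y) < \<delta> \<and> y \<in> C")
          case True
          then have "y \<in> D" using C(2) by auto
          \<comment> \<open>Subtracting the equation at \<open>y\<close> leaves only differences of coefficients.\<close>
          have "?T (HC y) + b x \<bullet> GC y + \<mu> * uC y =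
              \<epsilon> / 2 * trace (\<alpha> x ** H y) + b x \<bullet> G y - (G y \<bullet> b y + \<epsilon> / 2 * trace (a y ** H y))"
            using y \<open>y \<in> D\<close> True by (simp add: HC_def GC_def uC_def)
          also have "\<dots> = \<epsilon> / 2 * trace ((\<alpha> x - a y) ** H y) + (b x - b y) \<bullet> G y"
            by (simp add: bounded_bilinear.diff_left[OF bounded_bilinear_trace_mult] inner_diff_left
                inner_commute algebra_simps)
          finally have eq: "?T (HC y) + b x \<bullet> GC y + \<mu> * uC y = \<dots>" .
          have "\<bar>\<epsilon> / 2 * trace ((\<alpha> x - a y) ** H y)\<bar> \<le> \<epsilon> / 2 * ((real CARD('d))\<^sup>2 * norm (\<alpha> x - a y) * norm (H y))"
            using abs_trace_mult_le[of "\<alpha> x - a y" "H y"] \<epsilon> by (simp add: abs_mult)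
          also have "\<dots> \<le> \<epsilon> / 2 * ((real CARD('d))\<^sup>2 * (2 * La * \<delta>) * norm (H y))"
            using \<alpha>_a[of x y] True \<epsilon> by (intro mult_left_mono mult_right_mono) auto
          also have "\<dots> = KH * \<delta> * norm (H y)" by (simp add: KH_def)
          also have "\<dots> \<le> K * \<delta> * norm (H y)" using K \<delta>(1) by (intro mult_right_mono) auto
          finally have 1: "\<bar>\<epsilon> / 2 * trace ((\<alpha> x - a y) ** H y)\<bar> \<le> K * \<delta> * norm (H y)" .
          have "\<bar>(b x - b y) \<bullet> G y\<bar> \<le> norm (b x - b y) * norm (G y)" by (rule Cauchy_Schwarz_ineq2)
          also have "\<dots> \<le> (Lb * \<delta>) * norm (G y)"
            using order_trans[OF b[of x y] mult_left_mono[OF _ Lb, of "norm (x - y)" \<delta>]] True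
            by (intro mult_right_mono) auto
          also have "\<dots> \<le> K * \<delta> * norm (G y)" using K \<delta>(1) by (intro mult_right_mono) auto
          finally have "\<bar>?T (HC y) + b x \<bullet> GC y + \<mu> * uC y\<bar> \<le> K * \<delta> * (norm (H y) + norm (G y))"
            unfolding eq using 1 by (simp add: algebra_simps)
          then have "\<bar>?h y\<bar> \<le> \<rho> (x - y) * (K * \<delta> * (norm (H y) + norm (G y)))"
            unfolding abs_mult using M(3)[of "x - y"] by (simp add: mult_left_mono)
          then show ?thesis using True by (simp add: g_def HC_def GC_def mult_ac)
        next
          case False
          then have "\<rho> (x - y) = 0 \<or> y \<notin> C" using M(4)[of "x - y"] by auto
          then show ?thesis using \<delta>(1) K(4) M(3)[of "x - y"] g0[of y]
            by (auto simp: HC_def GC_def uC_def trace_matrix_mult)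
        qed
      qed
    qed (use ih igr in auto)
    also have "\<dots> = \<delta> * K * conv \<rho> g x" by (simp add: conv_def)
    finally show ?thesis .
  qed
  have C0C: "C0 \<subseteq> C" using r by (auto dest!: r(2))
  obtain R where R: "\<And>x. x \<in> C0 \<Longrightarrow> norm x < R"
    using compact_imp_bounded[OF C(1)] C0C unfolding bounded_pos_less by blast
  have main: "\<bar>(\<integral>x. \<mu> * v x * \<phi> x + \<phi> x * (b x \<bullet> V x) -
             \<epsilon> / 2 * (\<phi> x * m x + \<phi>' x \<bullet> (\<alpha> x *v V x)) \<partial>lebesgue)\<bar> \<le> e * N"
    if \<phi>: "\<And>x. GDERIV \<phi> x :> \<phi>' x" "continuous_on UNIV \<phi>'" "\<And>x. x \<notin> C0 \<Longrightarrow> \<phi> x = 0"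
      and N: "\<And>x. \<bar>\<phi> x\<bar> \<le> N" for \<phi> \<phi>' N
  proof -
    have c\<phi>: "continuous_on UNIV \<phi>" by (rule GDERIV_imp_continuous) (rule \<phi>(1))
    have \<phi>'0: "\<phi>' x = 0" if "x \<notin> C0" for x by (rule GDERIV_zero_outside[OF \<phi>(1) that C0 \<phi>(3)])
    have out: "x \<notin> C0" if "norm x \<ge> R" for x using R[of x] that by auto
    have int: "integrable lebesgue f" if "continuous_on UNIV f" "\<And>x. x \<notin> C0 \<Longrightarrow> f x = 0" for f :: "real^'d \<Rightarrow> real"
      using that out by (intro integrable_continuous_bounded_support[where R = R]) auto
    \<comment> \<open>The derivative of the \<open>i\<close>-th component of \<open>\<phi> \<alpha> V\<close> in direction \<open>h\<close>.\<close>
    define F' where "F' i x h = (h \<bullet> \<phi>' x) * (\<alpha> x *v V x) $ i +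
        \<phi> x * ((\<alpha>' x h *v V x) $ i + (\<alpha> x *v (W x *v h)) $ i)" for i x h
    have F: "((\<lambda>x. \<phi> x * (\<alpha> x *v V x) $ i) has_derivative F' i x) (at x)" for i x
    proof (cases "x \<in> C0")
      case True
      have "((\<lambda>x. \<alpha> x *v V x) has_derivative (\<lambda>h. \<alpha> x *v (W x *v h) + \<alpha>' x h *v V x)) (at x)"
        by (rule bounded_bilinear.FDERIV[OF bounded_bilinear_matrix_vector d\<alpha> dV[OF True]])
      from bounded_linear.has_derivative[OF bounded_linear_vec_nth this, of i]
      have "((\<lambda>x. (\<alpha> x *v V x) $ i) has_derivative (\<lambda>h. (\<alpha> x *v (W x *v h) + \<alpha>' x h *v V x) $ i)) (at x)" .
      from has_derivative_mult[OF \<phi>(1)[of x, unfolded gderiv_def] this]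
      show ?thesis by (rule has_derivative_eq_rhs) (auto simp: F'_def fun_eq_iff algebra_simps)
    next
      case False
      have "((\<lambda>x. \<phi> x * (\<alpha> x *v V x) $ i) has_derivative (\<lambda>h. 0)) (at x)"
        by (rule has_derivative_transform_within_open[of "\<lambda>x. 0" _ _ _ "- C0"])
          (use C0 False \<phi>(3) in auto)
      then show ?thesis
        by (rule has_derivative_eq_rhs) (auto simp: F'_def fun_eq_iff \<phi>(3)[OF False] \<phi>'0[OF False])
    qed
    have cF: "continuous_on UNIV (\<lambda>x. F' i x h)" for i h
      unfolding F'_def by (intro continuous_intros cmv cont c\<phi> \<phi>(2))
    have "(\<integral>x. F' i x (axis i 1) \<partial>lebesgue) = 0" for i
      using out \<phi>(3) by (intro integral_derivative_zero[OF F cF, where R = R]) auto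
    moreover have "integrable lebesgue (\<lambda>x. F' i x (axis i 1))" for i
      using \<phi>(3) \<phi>'0 by (intro int cF) (auto simp: F'_def)
    ultimately have 0: "(\<integral>x. (\<Sum>i\<in>UNIV. F' i x (axis i 1)) \<partial>lebesgue) = 0"
      by (subst Bochner_Integration.integral_sum) auto
    have div: "(\<Sum>i\<in>UNIV. F' i x (axis i 1)) = \<phi>' x \<bullet> (\<alpha> x *v V x) + \<phi> x * m x + \<phi> x * trace (\<alpha> x ** W x)" for x
    proof -
      have "(\<Sum>i\<in>UNIV. (axis i 1 \<bullet> \<phi>' x) * (\<alpha> x *v V x) $ i) = \<phi>' x \<bullet> (\<alpha> x *v V x)"
        unfolding inner_axis' by (simp add: inner_vec_def)
      moreover have "(\<Sum>i\<in>UNIV. (\<alpha> x *v (W x *v axis i 1)) $ i) = trace (\<alpha> x ** W x)"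
        unfolding matrix_vector_mult_basis trace_matrix_mult
        by (simp add: matrix_vector_mult_def column_def)
      ultimately show ?thesis
        by (simp add: F'_def m_def sum.distrib sum_distrib_left[symmetric] distrib_left)
    qed
    let ?L = "\<lambda>x. \<mu> * v x * \<phi> x + \<phi> x * (b x \<bullet> V x) - \<epsilon> / 2 * (\<phi> x * m x + \<phi>' x \<bullet> (\<alpha> x *v V x))"
    have Leq: "?L x = \<phi> x * E x - \<epsilon> / 2 * (\<Sum>i\<in>UNIV. F' i x (axis i 1))" for x
      unfolding div E_def by (simp add: field_simps)
    have iE: "integrable lebesgue (\<lambda>x. \<phi> x * E x)"
      using \<phi>(3) by (intro int continuous_intros c\<phi> cE) auto
    have iF: "integrable lebesgue (\<lambda>x. \<epsilon> / 2 * (\<Sum>i\<in>UNIV. F' i x (axis i 1)))"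
      by (intro int continuous_intros cF) (auto simp: div \<phi>(3) \<phi>'0)
    have "(\<integral>x. ?L x \<partial>lebesgue) = (\<integral>x. \<phi> x * E x \<partial>lebesgue)"
      unfolding Leq Bochner_Integration.integral_diff[OF iE iF] by (simp add: 0)
    also have "\<bar>\<dots>\<bar> \<le> (\<integral>x. N * (\<delta> * K) * conv \<rho> g x \<partial>lebesgue)"
    proof (rule order_trans[OF integral_abs_bound integral_mono])
      note cg = integral_mollifier_conv[OF moll ig g0]
      show "integrable lebesgue (\<lambda>x. \<bar>\<phi> x * E x\<bar>)" using iE by (rule integrable_abs)
      show "integrable lebesgue (\<lambda>x. N * (\<delta> * K) * conv \<rho> g x)" by (rule integrable_mult_right[OF cg(1)])
      have N0: "N \<ge> 0" using N[of undefined] by simp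
      have cg0: "0 \<le> conv \<rho> g x" for x
        by (rule mollifier_conv_ge[OF moll integrable_imp_locally_integrable[OF ig] g0])
      show "\<bar>\<phi> x * E x\<bar> \<le> N * (\<delta> * K) * conv \<rho> g x" for x
      proof (cases "x \<in> C0")
        case True
        have "\<bar>\<phi> x\<bar> * \<bar>E x\<bar> \<le> N * (\<delta> * K * conv \<rho> g x)"
          using N0 by (intro mult_mono N E_le[OF True]) auto
        then show ?thesis by (simp add: abs_mult mult_ac)
      qed (use \<phi>(3) N0 cg0 \<delta>(1) K(4) in auto)
    qed
    also have "\<dots> = (\<delta> * (K * I)) * N"
      using integral_mollifier_conv(2)[OF moll ig g0] by (simp add: I_def mult_ac)
    also have "\<dots> \<le> e * N" using \<delta>(3) N[of undefined] by (intro mult_right_mono) auto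
    finally show ?thesis .
  qed
  show ?thesis
  proof (rule that[OF \<delta>(1,2) moll])
    show "approximate_weak_solution C0 e \<epsilon> \<mu> b v V \<alpha> m"
      unfolding approximate_weak_solution_def using cont(1,2,4) cm dv main by blast
    show "\<forall>x. norm (\<alpha> x - a x) \<le> 1" using \<alpha>_near ..
    show "\<forall>x. \<bar>m x\<bar> \<le> real CARD('d) * La * norm (V x)" using m_le ..
    show "locally_integrable (\<lambda>y. indicator C y * u y)" using li(1) unfolding uC_def .
    show "v = conv \<rho> (\<lambda>y. indicator C y * u y)" unfolding v_def uC_def ..
    show "\<forall>x \<xi>. \<kappa> * (\<xi> \<bullet> \<xi>) \<le> \<xi> \<bullet> (\<alpha> x *v \<xi>)"
      unfolding \<alpha>_def by (intro allI mollifier_conv_elliptic[OF moll ca ell])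
  qed
qed

text \<open>
  The multiplier \<open>\<eta>\<^sup>2 / u\<close>, applied to the mollified equation. With
  \<open>t = \<bar>\<eta>\<bar> \<bar>V\<bar> / v\<close> the diffusion yields \<open>\<epsilon> \<kappa> t\<^sup>2 / 2\<close> and all other terms are at most linear in \<open>t\<close>, so
  the square can be completed pointwise. The right-hand side no longer depends on \<open>u\<close>.
\<close>

lemma eigenvalue_test_function_bound:
  assumes R: "R > 0" "cball z (2 * R) \<subseteq> D"
    and bd: "\<And>x. x \<in> cball z R \<Longrightarrow> norm (b x) \<le> \<beta>" "\<And>x. x \<in> cball z R \<Longrightarrow> norm (a x) \<le> A"
    and \<eta>: "\<And>x. GDERIV \<eta> x :> \<eta>' x" "continuous_on UNIV \<eta>'" "\<And>x. x \<notin> cball z R \<Longrightarrow> \<eta> x = 0"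
  shows "\<mu> * (\<integral>x. (\<eta> x)\<^sup>2 \<partial>lebesgue) \<le>
    (\<integral>x. (\<bar>\<eta> x\<bar> * (\<beta> + \<epsilon> * (real CARD('d) * La / 2)) + \<epsilon> * (A + 1) * norm (\<eta>' x))\<^sup>2 / (2 * \<epsilon> * \<kappa>) \<partial>lebesgue)"
    (is "_ \<le> (\<integral>x. ?S x \<partial>lebesgue)")
proof (rule field_le_epsilon)
  fix e :: real assume e: "e > 0"
  note a = a_lipschitz and b = b_lipschitz and ell = a_elliptic
    and \<kappa> = constants(1) and \<epsilon> = constants(2) and La = constants(3) and Lb = constants(4)
  note u = u_continuous u_pos
  let ?C = "cball z (2 * R)" and ?B = "cball z R"
  have C0C: "ball x R \<subseteq> ?C" if "x \<in> ?B" for x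
  proof
    fix y assume "y \<in> ball x R"
    then show "y \<in> ?C" using that dist_triangle[of z y x] by auto
  qed
  have "compact (u ` ?C)" by (rule compact_continuous_image[OF continuous_on_subset[OF u(1) R(2)]]) simp
  moreover have "u ` ?C \<noteq> {}" using R(1) by auto
  ultimately obtain u0 where "u0 \<in> u ` ?C" "\<And>y. y \<in> u ` ?C \<Longrightarrow> u0 \<le> y"
    using compact_attains_inf by metis
  then have u0: "u0 > 0" "\<And>y. y \<in> ?C \<Longrightarrow> u0 \<le> u y" using u(2) R(2) by auto
  have c\<eta>: "continuous_on UNIV \<eta>" by (rule GDERIV_imp_continuous) (rule \<eta>(1))
  have \<eta>'0: "\<eta>' x = 0" if "x \<notin> ?B" for x by (rule GDERIV_zero_outside[OF \<eta>(1) that _ \<eta>(3)]) auto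
  have "compact (\<eta> ` ?B)" by (rule compact_continuous_image[OF continuous_on_subset[OF c\<eta>]]) auto
  then obtain N1 where "\<And>y. y \<in> \<eta> ` ?B \<Longrightarrow> norm y \<le> N1" "N1 > 0"
    using compact_imp_bounded bounded_pos by metis
  then have N1: "N1 > 0" "\<And>x. \<bar>\<eta> x\<bar> \<le> N1" using \<eta>(3) by (auto, metis abs_zero imageI less_imp_le mem_cball)
  define N where "N = N1\<^sup>2 / u0"
  have N: "N > 0" using N1(1) u0(1) by (simp add: N_def)
  have eN: "e / N > 0" using e N by simp
  obtain \<delta> \<rho> \<rho>' v V \<alpha> m where
    "0 < \<delta>" and \<delta>r: "\<delta> \<le> R" and moll: "mollifier \<delta> \<rho> \<rho>'" and
    li: "locally_integrable (\<lambda>y. indicator ?C y * u y)" and v_def: "v = conv \<rho> (\<lambda>y. indicator ?C y * u y)" and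
    aws: "approximate_weak_solution ?B (e / N) \<epsilon> \<mu> b v V \<alpha> m" and
    ell': "\<forall>x \<xi>. \<kappa> * (\<xi> \<bullet> \<xi>) \<le> \<xi> \<bullet> (\<alpha> x *v \<xi>)" and
    near': "\<forall>x. norm (\<alpha> x - a x) \<le> 1" and
    m_le': "\<forall>x. \<bar>m x\<bar> \<le> real CARD('d) * La * norm (V x)"
    by (rule approximate_weak_formulation[OF compact_cball R(2) closed_cball R(1) C0C eN])
  note ell\<alpha> = ell'[rule_format] and \<alpha>_near = near'[rule_format] and m_le = m_le'[rule_format]
  have cont: "continuous_on UNIV v" "continuous_on UNIV V" "continuous_on UNIV \<alpha>" "continuous_on UNIV m"
    and dv: "\<And>x. x \<in> ?B \<Longrightarrow> GDERIV v x :> V x"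
    using aws unfolding approximate_weak_solution_def by blast+
  have vpos: "v x \<ge> u0" if "x \<in> ?B" for x
    unfolding v_def
  proof (rule mollifier_conv_ge[OF moll li])
    fix y assume "norm (x - y) < \<delta>"
    then have "y \<in> ball x R" using \<delta>r by (simp add: dist_norm)
    then have "y \<in> ?C" using C0C[OF that] by blast
    then show "u0 \<le> indicator ?C y * u y" using u0(2) by simp
  qed
  \<comment> \<open>Off the ball \<open>\<eta>\<close> vanishes, so possible zeros of \<open>v\<close> there do no harm.\<close>
  define \<phi> where "\<phi> x = (\<eta> x)\<^sup>2 / v x" for x
  define \<phi>' where "\<phi>' x = (2 * \<eta> x / v x) *\<^sub>R \<eta>' x - ((\<eta> x)\<^sup>2 / (v x)\<^sup>2) *\<^sub>R V x" for x
  have \<phi>0: "\<phi> x = 0" "\<phi>' x = 0" if "x \<notin> ?B" for x using \<eta>(3)[OF that] by (auto simp: \<phi>_def \<phi>'_def)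
  have d\<phi>: "GDERIV \<phi> x :> \<phi>' x" for x
  proof (cases "x \<in> ?B")
    case True
    have "(\<eta> has_derivative (\<lambda>h. h \<bullet> \<eta>' x)) (at x)" "(v has_derivative (\<lambda>h. h \<bullet> V x)) (at x)"
      using \<eta>(1) dv[OF True] by (auto simp: gderiv_def)
    moreover have "v x \<noteq> 0" using vpos[OF True] u0 by auto
    ultimately show ?thesis
      unfolding gderiv_def \<phi>_def[abs_def] \<phi>'_def
      by (auto intro!: derivative_eq_intros simp: fun_eq_iff inner_diff_right power2_eq_square field_simps)
  next
    case False
    have "(\<phi> has_derivative (\<lambda>h. 0)) (at x)"
      by (rule has_derivative_transform_within_open[of "\<lambda>x. 0" _ _ _ "- ?B"]) (use False \<phi>0 in auto)
    then show ?thesis using \<phi>0[OF False] by (simp add: gderiv_def)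
  qed
  have c\<phi>': "continuous_on UNIV \<phi>'"
  proof -
    have "continuous_on {x. 0 < v x} \<phi>'"
      unfolding \<phi>'_def
      by (intro continuous_intros continuous_on_subset[OF c\<eta>] continuous_on_subset[OF \<eta>(2)]
          continuous_on_subset[OF cont(1)] continuous_on_subset[OF cont(2)]) auto
    moreover have "continuous_on (- ?B) \<phi>'"
      by (rule continuous_on_eq[of _ "\<lambda>x. 0"]) (auto simp: \<phi>0)
    moreover have "open {x. 0 < v x}" using cont(1) by (intro open_Collect_less continuous_intros)
    ultimately have "continuous_on ({x. 0 < v x} \<union> - ?B) \<phi>'"
      by (intro continuous_on_open_Un) auto
    moreover have "{x. 0 < v x} \<union> - ?B = UNIV" using vpos u0(1) by force
    ultimately show ?thesis by simp
  qed
  have \<phi>N: "\<bar>\<phi> x\<bar> \<le> N" for x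
  proof (cases "x \<in> ?B")
    case True
    have "\<bar>\<phi> x\<bar> = (\<eta> x)\<^sup>2 / v x" using vpos[OF True] u0 by (simp add: \<phi>_def)
    also have "\<dots> \<le> N1\<^sup>2 / u0"
      using vpos[OF True] u0 N1 power_mono[OF N1(2)[of x], of 2] by (intro frac_le) auto
    finally show ?thesis by (simp add: N_def)
  qed (use \<phi>0 N in auto)
  let ?L = "\<lambda>x. \<mu> * v x * \<phi> x + \<phi> x * (b x \<bullet> V x) - \<epsilon> / 2 * (\<phi> x * m x + \<phi>' x \<bullet> (\<alpha> x *v V x))"
  have cb: "continuous_on UNIV b" by (rule lipschitz_imp_continuous_on_UNIV[OF b Lb])
  have c\<phi>: "continuous_on UNIV \<phi>" by (rule GDERIV_imp_continuous) (rule d\<phi>)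
  have int: "integrable lebesgue f" if "continuous_on UNIV f" "\<And>x. x \<notin> ?B \<Longrightarrow> f x = 0" for f :: "real^'d \<Rightarrow> real"
  proof (rule integrable_continuous_bounded_support[OF that(1), where R = "norm z + R"])
    fix x :: "real^'d" assume "norm x > norm z + R"
    then have "x \<notin> ?B" using norm_triangle_ineq2[of x z] by (auto simp: dist_norm norm_minus_commute)
    then show "f x = 0" by (rule that(2))
  qed
  have iL: "integrable lebesgue ?L"
    by (intro int continuous_intros c\<phi> c\<phi>' cont cb
       bounded_bilinear.continuous_on[OF bounded_bilinear_matrix_vector]) (auto simp: \<phi>0)
  have i\<eta>: "integrable lebesgue (\<lambda>x. \<mu> * (\<eta> x)\<^sup>2)"
    by (intro int continuous_intros c\<eta>) (auto simp: \<eta>(3))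
  have iS: "integrable lebesgue ?S"
    using \<epsilon> \<kappa> by (intro int continuous_intros c\<eta> \<eta>(2)) (auto simp: \<eta>(3) \<eta>'0)
  have ptw: "\<mu> * (\<eta> x)\<^sup>2 - ?S x \<le> ?L x" for x
  proof (cases "x \<in> ?B")
    case True
    have v: "v x > 0" using vpos[OF True] u0(1) by simp
    define t where "t = \<bar>\<eta> x\<bar> * norm (V x) / v x"
    have t: "t \<ge> 0" using v by (simp add: t_def)
    have \<phi>V: "\<phi> x * norm (V x) = \<bar>\<eta> x\<bar> * t"
    proof -
      have "(\<eta> x)\<^sup>2 = \<bar>\<eta> x\<bar> * \<bar>\<eta> x\<bar>" by (simp add: power2_eq_square)
      then show ?thesis
        by (simp only: \<phi>_def t_def times_divide_eq_left times_divide_eq_right mult.assoc)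
    qed
    have \<phi>pos: "\<phi> x \<ge> 0" using v by (simp add: \<phi>_def)
    have 1: "\<bar>\<phi> x * (b x \<bullet> V x)\<bar> \<le> \<bar>\<eta> x\<bar> * \<beta> * t"
    proof -
      have "\<bar>\<phi> x * (b x \<bullet> V x)\<bar> \<le> \<phi> x * (norm (b x) * norm (V x))"
        unfolding abs_mult using \<phi>pos by (simp add: mult_left_mono Cauchy_Schwarz_ineq2)
      also have "\<dots> \<le> \<phi> x * (\<beta> * norm (V x))" using \<phi>pos bd(1)[OF True] by (intro mult_left_mono mult_right_mono) auto
      also have "\<dots> = \<beta> * (\<phi> x * norm (V x))" by simp
      finally show ?thesis unfolding \<phi>V by (simp add: mult_ac)
    qed
    have 2: "\<bar>\<epsilon> / 2 * (\<phi> x * m x)\<bar> \<le> \<bar>\<eta> x\<bar> * (\<epsilon> * (real CARD('d) * La / 2)) * t"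
    proof -
      have "\<bar>\<epsilon> / 2 * (\<phi> x * m x)\<bar> \<le> \<epsilon> / 2 * (\<phi> x * (real CARD('d) * La * norm (V x)))"
        unfolding abs_mult using \<phi>pos \<epsilon> by (simp add: mult_left_mono m_le)
      also have "\<dots> = \<epsilon> / 2 * (real CARD('d) * La) * (\<phi> x * norm (V x))" by simp
      finally show ?thesis unfolding \<phi>V by (simp add: mult_ac)
    qed
    have 3: "\<bar>\<epsilon> / 2 * ((2 * \<eta> x / v x) * (\<eta>' x \<bullet> (\<alpha> x *v V x)))\<bar> \<le> \<epsilon> * (A + 1) * norm (\<eta>' x) * t"
    proof -
      have "norm (\<alpha> x) \<le> A + 1"
        using \<alpha>_near[of x] bd(2)[OF True] norm_triangle_ineq2[of "\<alpha> x" "a x"] by simp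
      then have "\<bar>\<eta>' x \<bullet> (\<alpha> x *v V x)\<bar> \<le> (A + 1) * norm (\<eta>' x) * norm (V x)"
        by (intro order_trans[OF inner_matrix_le] mult_right_mono) auto
      then have "\<epsilon> * (\<bar>\<eta> x\<bar> / v x) * \<bar>\<eta>' x \<bullet> (\<alpha> x *v V x)\<bar> \<le> \<epsilon> * (\<bar>\<eta> x\<bar> / v x) * ((A + 1) * norm (\<eta>' x) * norm (V x))"
        using \<epsilon> v by (intro mult_left_mono) auto
      then show ?thesis using \<epsilon> v by (simp add: abs_mult t_def mult_ac)
    qed
    have 4: "\<epsilon> / 2 * (\<kappa> * t\<^sup>2) \<le> \<epsilon> / 2 * ((\<eta> x)\<^sup>2 / (v x)\<^sup>2 * (V x \<bullet> (\<alpha> x *v V x)))"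
    proof -
      have "\<kappa> * t\<^sup>2 = (\<eta> x)\<^sup>2 / (v x)\<^sup>2 * (\<kappa> * (V x \<bullet> V x))"
        by (simp add: t_def power_mult_distrib power_divide power2_norm_eq_inner[symmetric])
      also have "\<dots> \<le> (\<eta> x)\<^sup>2 / (v x)\<^sup>2 * (V x \<bullet> (\<alpha> x *v V x))" by (intro mult_left_mono ell\<alpha>) auto
      finally show ?thesis using \<epsilon> by (intro mult_left_mono) auto
    qed
    define Y where "Y = \<bar>\<eta> x\<bar> * (\<beta> + \<epsilon> * (real CARD('d) * La / 2)) + \<epsilon> * (A + 1) * norm (\<eta>' x)"
    have sq: "\<epsilon> / 2 * (\<kappa> * t\<^sup>2) - Y * t \<ge> - (Y\<^sup>2 / (2 * \<epsilon> * \<kappa>))"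
    proof -
      have "0 \<le> (\<epsilon> * \<kappa> * t - Y)\<^sup>2 / (2 * \<epsilon> * \<kappa>)" using \<epsilon> \<kappa> by simp
      also have "\<dots> = \<epsilon> / 2 * (\<kappa> * t\<^sup>2) - Y * t + Y\<^sup>2 / (2 * \<epsilon> * \<kappa>)"
        using \<epsilon> \<kappa> by (simp add: power2_eq_square field_simps)
      finally show ?thesis by simp
    qed
    have "Y * t = \<bar>\<eta> x\<bar> * \<beta> * t + \<bar>\<eta> x\<bar> * (\<epsilon> * (real CARD('d) * La / 2)) * t + \<epsilon> * (A + 1) * norm (\<eta>' x) * t"
      by (simp add: Y_def algebra_simps)
    moreover have "?L x = \<mu> * (\<eta> x)\<^sup>2 + \<phi> x * (b x \<bullet> V x) - \<epsilon> / 2 * (\<phi> x * m x)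
        - \<epsilon> / 2 * ((2 * \<eta> x / v x) * (\<eta>' x \<bullet> (\<alpha> x *v V x)))
        + \<epsilon> / 2 * ((\<eta> x)\<^sup>2 / (v x)\<^sup>2 * (V x \<bullet> (\<alpha> x *v V x)))"
    proof -
      have "v x * \<phi> x = (\<eta> x)\<^sup>2" using v by (simp add: \<phi>_def)
      moreover have "\<phi>' x \<bullet> (\<alpha> x *v V x) = (2 * \<eta> x / v x) * (\<eta>' x \<bullet> (\<alpha> x *v V x)) -
          (\<eta> x)\<^sup>2 / (v x)\<^sup>2 * (V x \<bullet> (\<alpha> x *v V x))"
        by (simp add: \<phi>'_def inner_diff_left)
      ultimately show ?thesis by (simp only: mult.assoc) (simp add: algebra_simps)
    qed
    ultimately show ?thesis using 1 2 3 4 sq unfolding Y_def[symmetric] by linarith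
  next
    case False
    then show ?thesis using \<phi>0[OF False] \<eta>(3)[OF False] \<eta>'0[OF False] by simp
  qed
  have weak: "\<bar>\<integral>x. ?L x \<partial>lebesgue\<bar> \<le> (e / N) * N"
    using aws d\<phi> c\<phi>' \<phi>0(1) \<phi>N unfolding approximate_weak_solution_def by blast
  have "\<mu> * (\<integral>x. (\<eta> x)\<^sup>2 \<partial>lebesgue) - (\<integral>x. ?S x \<partial>lebesgue) = (\<integral>x. \<mu> * (\<eta> x)\<^sup>2 - ?S x \<partial>lebesgue)"
    by (subst Bochner_Integration.integral_diff[OF i\<eta> iS]) simp
  also have "\<dots> \<le> (\<integral>x. ?L x \<partial>lebesgue)"
    by (intro integral_mono Bochner_Integration.integrable_diff i\<eta> iS iL ptw)
  also have "\<dots> \<le> (e / N) * N" using weak by linarith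
  also have "\<dots> = e" using N by simp
  finally show "\<mu> * (\<integral>x. (\<eta> x)\<^sup>2 \<partial>lebesgue) \<le> (\<integral>x. ?S x \<partial>lebesgue) + e" by simp
qed

text \<open>
  Suppose \<open>\<mu> < 0\<close> and put \<open>w = (v - k)\<^sup>+\<close>. Testing with \<open>w\<^sup>2\<close>, the diffusion yields
  \<open>\<epsilon> \<kappa> w \<bar>V\<bar>\<^sup>2\<close> and the first-order terms are at most \<open>Q w\<^sup>2 \<bar>V\<bar>\<close> for a constant \<open>Q\<close>, so their surplus is at most
  \<open>w\<^sup>3 Q\<^sup>2 / (4 \<epsilon> \<kappa>)\<close>. As \<open>w \<le> max u - k\<close> is small, the term \<open>\<mu> v w\<^sup>2\<close> dominates and the weak form is strictly
  negative, uniformly in the scale of mollification.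
\<close>

lemma eigenvalue_nonneg:
  assumes D: "open D" "bounded D" "D \<noteq> {}"
    and boundary: "continuous_on (closure D) u" "\<And>x. x \<in> frontier D \<Longrightarrow> u x = 0"
  shows "\<mu> \<ge> 0"
proof (rule ccontr)
  note a = a_lipschitz and b = b_lipschitz and ell = a_elliptic
    and \<kappa> = constants(1) and \<epsilon> = constants(2) and La = constants(3) and Lb = constants(4)
  note u = boundary(1) u_pos boundary(2)
  assume "\<not> \<mu> \<ge> 0"
  then have \<mu>: "\<mu> < 0" by simp
  have cl: "compact (closure D)" using D(2) by (simp add: compact_closure)
  obtain xm where xm: "xm \<in> closure D" "\<And>y. y \<in> closure D \<Longrightarrow> u y \<le> u xm"
    using continuous_attains_sup[OF cl _ u(1)] D(3) by auto
  define M where "M = u xm"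
  obtain x1 where "x1 \<in> D" using D(3) by blast
  then have M: "M > 0" using u(2)[of x1] xm(2)[of x1] closure_subset[of D] by (auto simp: M_def)
  have inD: "x \<in> D" if "x \<in> closure D" "u x > 0" for x
    using that u(3)[of x] D(1) by (auto simp: frontier_def interior_open)
  have xmD: "xm \<in> D" using inD xm(1) M by (simp add: M_def)
  obtain \<beta> where "\<beta> > 0" "\<And>x. x \<in> closure D \<Longrightarrow> norm (b x) \<le> \<beta>"
    using continuous_on_compact_norm_bound[OF cl
      continuous_on_subset[OF lipschitz_imp_continuous_on_UNIV[OF b Lb] subset_UNIV]] by blast
  then have \<beta>: "\<And>x. x \<in> D \<Longrightarrow> norm (b x) \<le> \<beta>" "\<beta> > 0" using closure_subset[of D] by auto
  define Q where "Q = \<beta> + \<epsilon> * (real CARD('d) * La / 2)"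
  have Q: "Q > 0" using \<beta>(2) \<epsilon> La by (simp add: Q_def add_pos_nonneg)
  \<comment> \<open>Chosen so that \<open>s Q\<^sup>2 / (4 \<epsilon> \<kappa>) = \<bar>\<mu>\<bar> M / 8\<close>, a quarter of the least gain \<open>\<bar>\<mu>\<bar> M / 2\<close>.\<close>
  define s where "s = \<bar>\<mu>\<bar> * M * (\<epsilon> * \<kappa>) / (2 * Q\<^sup>2)"
  have s: "s > 0" unfolding s_def using \<mu> M \<epsilon> \<kappa> Q by (intro divide_pos_pos mult_pos_pos) auto
  define k where "k = max (M / 2) (M - s)"
  have k: "M / 2 \<le> k" "k < M" "M - k \<le> s" "k > 0" using M s by (auto simp: k_def)
  define K1 where "K1 = {x \<in> closure D. k \<le> u x}"
  have K1D: "K1 \<subseteq> D" using inD k(4) by (force simp: K1_def)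
  have K1c: "compact K1"
  proof -
    have "K1 = closure D \<inter> u -` {k..}" by (auto simp: K1_def)
    then have "closed K1" using continuous_closed_preimage[OF u(1) closed_closure closed_atLeast] by simp
    moreover have "K1 = closure D \<inter> K1" by (auto simp: K1_def)
    ultimately show ?thesis using cl compact_Int_closed by metis
  qed
  obtain d where d: "d > 0" "(\<Union>x\<in>K1. cball x d) \<subseteq> D"
    using compact_subset_open_imp_cball_epsilon_subset[OF K1c D(1) K1D] .
  \<comment> \<open>Mollifying on \<open>C\<close>, the set where \<open>v > k\<close> stays within \<open>B\<close>: such a point is close to one of \<open>K1\<close>.\<close>
  define C where "C = (\<Union>x\<in>K1. cball x d)"
  define B where "B = (\<Union>x\<in>K1. cball x (d / 2))"
  have neigh: "compact (\<Union>x\<in>K1. cball x t)" for t :: real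
  proof -
    have "(\<Union>x\<in>K1. cball x t) = {x + y | x y. x \<in> K1 \<and> y \<in> cball 0 t}"
    proof (intro equalityI subsetI)
      fix y assume "y \<in> (\<Union>x\<in>K1. cball x t)"
      then obtain x where "x \<in> K1" "dist x y \<le> t" by auto
      then have "y = x + (y - x)" "x \<in> K1" "y - x \<in> cball 0 t" by (auto simp: dist_norm norm_minus_commute)
      then show "y \<in> {x + y | x y. x \<in> K1 \<and> y \<in> cball 0 t}" by blast
    next
      fix w assume "w \<in> {x + y | x y. x \<in> K1 \<and> y \<in> cball 0 t}"
      then obtain x y where "w = x + y" "x \<in> K1" "norm y \<le> t" by auto
      then have "x \<in> K1" "w \<in> cball x t" by (auto simp: dist_norm)
      then show "w \<in> (\<Union>x\<in>K1. cball x t)" by blast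
    qed
    then show ?thesis using compact_sums[OF K1c compact_cball[of 0 t]] by simp
  qed
  have CD: "C \<subseteq> D" and Cc: "compact C" and Bc: "closed B"
    using d neigh[of d] compact_imp_closed[OF neigh[of "d/2"]] by (auto simp: C_def B_def)
  have K1C: "K1 \<subseteq> C" using d(1) by (force simp: C_def)
  \<comment> \<open>Near its maximum \<open>u\<close> stays above \<open>k'\<close>, hence so does \<open>v\<close>; this bounds \<open>\<integral>\<phi>\<close> below independently of \<open>\<delta>\<close>.\<close>
  define k' where "k' = (k + M) / 2"
  have k': "k < k'" "k' < M" using k by (auto simp: k'_def)
  have "\<exists>r>0. \<forall>x\<in>closure D. dist x xm < r \<longrightarrow> dist (u x) (u xm) < M - k'"
    using u(1) xm(1) k' unfolding continuous_on_iff by simp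
  then obtain r1 where r1: "r1 > 0" "\<And>x. x \<in> closure D \<Longrightarrow> dist x xm < r1 \<Longrightarrow> dist (u x) (u xm) < M - k'" by blast
  obtain r2 where r2: "r2 > 0" "ball xm r2 \<subseteq> D" using D(1) xmD open_contains_ball by blast
  define r3 where "r3 = min r1 r2"
  have r3: "r3 > 0" "\<And>x. x \<in> ball xm r3 \<Longrightarrow> x \<in> C \<and> k' \<le> u x"
  proof -
    show "r3 > 0" using r1(1) r2(1) by (simp add: r3_def)
    fix x assume x: "x \<in> ball xm r3"
    then have xD: "x \<in> closure D" using r2(2) closure_subset[of D] by (auto simp: r3_def)
    then have "k' \<le> u x" using r1(2)[of x] x by (auto simp: r3_def dist_commute dist_real_def M_def)
    moreover have "x \<in> K1" using xD k'(1) \<open>k' \<le> u x\<close> by (simp add: K1_def)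
    ultimately show "x \<in> C \<and> k' \<le> u x" using K1C by blast
  qed
  define r where "r = min (d / 2) (r3 / 2)"
  have r: "r > 0" "r \<le> d / 2" "r \<le> r3 / 2" using d(1) r3(1) by (auto simp: r_def)
  have BC: "ball x r \<subseteq> C" if "x \<in> B" for x
  proof
    fix y assume y: "y \<in> ball x r"
    obtain w where w: "w \<in> K1" "dist w x \<le> d / 2" using \<open>x \<in> B\<close> by (auto simp: B_def)
    then have "dist w y \<le> d" using dist_triangle[of w y x] y r(2) by auto
    then show "y \<in> C" using w(1) by (auto simp: C_def)
  qed
  define c0 where "c0 = (k' - k)\<^sup>2 * measure lebesgue (ball xm (r3 / 2))"
  have c0: "c0 > 0" using k' r3(1) content_ball_pos[of "r3/2" xm] by (simp add: c0_def)
  \<comment> \<open>The weak form is at most \<open>- 3 / 8 * \<bar>\<mu>\<bar> * M * c0\<close>, which exceeds the error \<open>e * M\<^sup>2\<close> in modulus.\<close>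
  define e where "e = \<bar>\<mu>\<bar> * M * c0 / (4 * M\<^sup>2)"
  have e: "e > 0" unfolding e_def using \<mu> M c0 by (intro divide_pos_pos mult_pos_pos) auto
  obtain \<delta> \<rho> \<rho>' v V \<alpha> m where
    "0 < \<delta>" and \<delta>r: "\<delta> \<le> r" and moll: "mollifier \<delta> \<rho> \<rho>'" and
    li: "locally_integrable (\<lambda>y. indicator C y * u y)" and v_def: "v = conv \<rho> (\<lambda>y. indicator C y * u y)" and
    aws: "approximate_weak_solution B e \<epsilon> \<mu> b v V \<alpha> m" and
    ell': "\<forall>x \<xi>. \<kappa> * (\<xi> \<bullet> \<xi>) \<le> \<xi> \<bullet> (\<alpha> x *v \<xi>)" and
    near': "\<forall>x. norm (\<alpha> x - a x) \<le> 1" and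
    m_le': "\<forall>x. \<bar>m x\<bar> \<le> real CARD('d) * La * norm (V x)"
    by (rule approximate_weak_formulation[OF Cc CD Bc r(1) BC e])
  note ell\<alpha> = ell'[rule_format] and m_le = m_le'[rule_format]
  have cont: "continuous_on UNIV v" "continuous_on UNIV V" "continuous_on UNIV \<alpha>" "continuous_on UNIV m"
    and dv: "\<And>x. x \<in> B \<Longrightarrow> GDERIV v x :> V x"
    using aws unfolding approximate_weak_solution_def by blast+
  have vM: "v x \<le> M" for x
    unfolding v_def
  proof (rule mollifier_conv_le[OF moll li])
    show "indicator C y * u y \<le> M" for y
      using xm(2)[of y] CD closure_subset[of D] M by (auto simp: indicator_def M_def)
  qed
  have vk: "v x \<le> k" if "x \<notin> B" for x
    unfolding v_def
  proof (rule mollifier_conv_le[OF moll li])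
    fix y assume y: "norm (x - y) < \<delta>"
    show "indicator C y * u y \<le> k"
    proof (rule ccontr)
      assume "\<not> ?thesis"
      then have "y \<in> C" "k \<le> u y" using k(4) by (cases "y \<in> C"; simp)+
      then have "y \<in> K1" using CD closure_subset[of D] by (auto simp: K1_def)
      moreover have "x \<in> cball y (d / 2)" using y \<delta>r r(2) by (simp add: dist_norm norm_minus_commute)
      ultimately show False using that by (auto simp: B_def)
    qed
  qed
  have vk': "k' \<le> v x" if "x \<in> ball xm (r3 / 2)" for x
    unfolding v_def
  proof (rule mollifier_conv_ge[OF moll li])
    fix y assume "norm (x - y) < \<delta>"
    then have "y \<in> ball xm r3"
      using that dist_triangle[of xm y x] \<delta>r r(3) by (simp add: dist_norm)
    then show "k' \<le> indicator C y * u y" using r3(2) by auto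
  qed
  define \<phi> where "\<phi> x = (max 0 (v x - k))\<^sup>2" for x
  define \<phi>' where "\<phi>' x = (2 * max 0 (v x - k)) *\<^sub>R V x" for x
  have \<phi>0: "\<phi> x = 0" "\<phi>' x = 0" if "x \<notin> B" for x using vk[OF that] by (auto simp: \<phi>_def \<phi>'_def)
  have d\<phi>: "GDERIV \<phi> x :> \<phi>' x" for x
  proof (cases "x \<in> B")
    case True
    have "GDERIV (\<lambda>x. v x - k) x :> V x" using GDERIV_diff[OF dv[OF True] GDERIV_const] by simp
    from GDERIV_DERIV_compose[OF this DERIV_pos_part_square] show ?thesis
      by (simp add: \<phi>_def[abs_def] \<phi>'_def)
  next
    case False
    have "(\<phi> has_derivative (\<lambda>h. 0)) (at x)"
      by (rule has_derivative_transform_within_open[of "\<lambda>x. 0" _ _ _ "- B"]) (use False \<phi>0 Bc in auto)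
    then show ?thesis using \<phi>0[OF False] by (simp add: gderiv_def)
  qed
  have c\<phi>': "continuous_on UNIV \<phi>'" unfolding \<phi>'_def by (intro continuous_intros cont)
  have c\<phi>: "continuous_on UNIV \<phi>" by (rule GDERIV_imp_continuous) (rule d\<phi>)
  have pos_le: "max 0 (v x - k) \<le> M - k" for x using vM[of x] k by auto
  have \<phi>N: "\<bar>\<phi> x\<bar> \<le> M\<^sup>2" for x
  proof -
    have "(max 0 (v x - k))\<^sup>2 \<le> M\<^sup>2" using pos_le[of x] k by (intro power_mono) auto
    then show ?thesis by (simp add: \<phi>_def)
  qed
  let ?L = "\<lambda>x. \<mu> * v x * \<phi> x + \<phi> x * (b x \<bullet> V x) - \<epsilon> / 2 * (\<phi> x * m x + \<phi>' x \<bullet> (\<alpha> x *v V x))"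
  have cb: "continuous_on UNIV b" by (rule lipschitz_imp_continuous_on_UNIV[OF b Lb])
  obtain R where R: "\<And>x. x \<in> B \<Longrightarrow> norm x \<le> R"
    using compact_imp_bounded[OF neigh[of "d/2"]] unfolding bounded_iff B_def by blast
  have int: "integrable lebesgue f" if "continuous_on UNIV f" "\<And>x. x \<notin> B \<Longrightarrow> f x = 0" for f :: "real^'d \<Rightarrow> real"
    using that(2) R by (intro integrable_continuous_bounded_support[OF that(1), where R = R]) (meson not_le)
  have iL: "integrable lebesgue ?L"
    by (intro int continuous_intros c\<phi> c\<phi>' cont cb
       bounded_bilinear.continuous_on[OF bounded_bilinear_matrix_vector]) (auto simp: \<phi>0)
  have i\<phi>: "integrable lebesgue \<phi>" by (intro int c\<phi>) (simp add: \<phi>0)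
  have ptw: "?L x \<le> - (3 / 8 * \<bar>\<mu>\<bar> * M) * \<phi> x" for x
  proof (cases "v x \<le> k \<or> x \<notin> B")
    case True
    then have "\<phi> x = 0" "\<phi>' x = 0" using \<phi>0[of x] by (auto simp: \<phi>_def \<phi>'_def)
    then show ?thesis by simp
  next
    case False
    then have xB: "x \<in> B" and "v x > k" by auto
    define w where "w = v x - k"
    have w: "w > 0" "w \<le> M - k" "max 0 (v x - k) = w" using \<open>v x > k\<close> vM[of x] by (auto simp: w_def)
    have \<phi>w: "\<phi> x = w\<^sup>2" "\<phi>' x = (2 * w) *\<^sub>R V x" using w(3) by (auto simp: \<phi>_def \<phi>'_def)
    have xD: "x \<in> D" using BC[OF xB] r(1) CD by (meson centre_in_ball subsetD)
    define t where "t = norm (V x)"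
    have 1: "\<phi> x * (b x \<bullet> V x) \<le> w\<^sup>2 * (\<beta> * t)"
    proof -
      have "b x \<bullet> V x \<le> norm (b x) * t" unfolding t_def by (rule norm_cauchy_schwarz)
      also have "\<dots> \<le> \<beta> * t" using \<beta>(1)[OF xD] by (intro mult_right_mono) (auto simp: t_def)
      finally show ?thesis unfolding \<phi>w by (intro mult_left_mono) auto
    qed
    have 2: "- (\<epsilon> / 2 * (\<phi> x * m x)) \<le> w\<^sup>2 * (\<epsilon> * (real CARD('d) * La / 2) * t)"
    proof -
      have "- m x \<le> real CARD('d) * La * t" using m_le[of x] by (simp add: t_def)
      then have "\<epsilon> / 2 * w\<^sup>2 * (- m x) \<le> \<epsilon> / 2 * w\<^sup>2 * (real CARD('d) * La * t)"
        using \<epsilon> by (intro mult_left_mono) auto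
      then show ?thesis by (simp add: \<phi>w mult_ac)
    qed
    have 3: "\<epsilon> * w * (\<kappa> * t\<^sup>2) \<le> \<epsilon> / 2 * (\<phi>' x \<bullet> (\<alpha> x *v V x))"
    proof -
      have "\<kappa> * t\<^sup>2 \<le> V x \<bullet> (\<alpha> x *v V x)" using ell\<alpha>[of "V x" x] by (simp add: t_def power2_norm_eq_inner)
      then have "\<epsilon> * w * (\<kappa> * t\<^sup>2) \<le> \<epsilon> * w * (V x \<bullet> (\<alpha> x *v V x))"
        using \<epsilon> w(1) by (intro mult_left_mono) auto
      then show ?thesis by (simp add: \<phi>w)
    qed
    have 4: "\<mu> * v x * \<phi> x \<le> - (\<bar>\<mu>\<bar> * (M / 2)) * \<phi> x"
    proof -
      have "\<mu> * v x \<le> \<mu> * (M / 2)" using \<mu> k(1) \<open>v x > k\<close> by (intro mult_left_mono_neg) auto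
      then have "\<mu> * v x * \<phi> x \<le> \<mu> * (M / 2) * \<phi> x" by (rule mult_right_mono) (simp add: \<phi>w)
      also have "\<mu> * (M / 2) = - (\<bar>\<mu>\<bar> * (M / 2))" using \<mu> by simp
      finally show ?thesis .
    qed
    have 5: "w\<^sup>2 * (Q * t) - \<epsilon> * w * (\<kappa> * t\<^sup>2) \<le> \<bar>\<mu>\<bar> * M / 8 * \<phi> x"
    proof -
      have "0 \<le> w * (Q * w - 2 * \<epsilon> * \<kappa> * t)\<^sup>2 / (4 * \<epsilon> * \<kappa>)" using w(1) \<epsilon> \<kappa> by simp
      also have "\<dots> = w\<^sup>2 * (w * Q\<^sup>2 / (4 * \<epsilon> * \<kappa>)) - (w\<^sup>2 * (Q * t) - \<epsilon> * w * (\<kappa> * t\<^sup>2))"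
        using \<epsilon> \<kappa> by (simp add: power2_eq_square field_simps)
      finally have "w\<^sup>2 * (Q * t) - \<epsilon> * w * (\<kappa> * t\<^sup>2) \<le> w\<^sup>2 * (w * Q\<^sup>2 / (4 * \<epsilon> * \<kappa>))" by simp
      also have "\<dots> \<le> w\<^sup>2 * (s * Q\<^sup>2 / (4 * \<epsilon> * \<kappa>))"
        using w(2) k(3) \<epsilon> \<kappa> by (intro mult_left_mono divide_right_mono mult_right_mono) auto
      also have "s * Q\<^sup>2 / (4 * \<epsilon> * \<kappa>) = \<bar>\<mu>\<bar> * M / 8" using Q \<epsilon> \<kappa> by (simp add: s_def field_simps)
      finally show ?thesis by (simp add: \<phi>w mult.commute)
    qed
    have "?L x = \<mu> * v x * \<phi> x + \<phi> x * (b x \<bullet> V x) + - (\<epsilon> / 2 * (\<phi> x * m x)) - \<epsilon> / 2 * (\<phi>' x \<bullet> (\<alpha> x *v V x))"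
      by (simp add: algebra_simps)
    also have "\<dots> \<le> - (\<bar>\<mu>\<bar> * (M / 2)) * \<phi> x + (w\<^sup>2 * (Q * t) - \<epsilon> * w * (\<kappa> * t\<^sup>2))"
      using 1 2 3 4 by (simp add: Q_def algebra_simps)
    also have "\<dots> \<le> - (\<bar>\<mu>\<bar> * (M / 2)) * \<phi> x + \<bar>\<mu>\<bar> * M / 8 * \<phi> x" by (rule add_left_mono[OF 5])
    also have "\<dots> = - (3 / 8 * \<bar>\<mu>\<bar> * M) * \<phi> x" by (simp add: algebra_simps)
    finally show ?thesis .
  qed
  have "c0 = (\<integral>x. (k' - k)\<^sup>2 * indicator (ball xm (r3 / 2)) x \<partial>lebesgue)" by (simp add: c0_def)
  also have "\<dots> \<le> (\<integral>x. \<phi> x \<partial>lebesgue)"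
  proof (rule integral_mono[OF _ i\<phi>])
    show "integrable lebesgue (\<lambda>x. (k' - k)\<^sup>2 * indicator (ball xm (r3 / 2)) x)"
      by (intro integrable_mult_right integrable_real_indicator)
        (use emeasure_bounded_finite[of "ball xm (r3/2)"] in auto)
    show "(k' - k)\<^sup>2 * indicator (ball xm (r3 / 2)) x \<le> \<phi> x" for x
    proof (cases "x \<in> ball xm (r3 / 2)")
      case True
      then have "(k' - k)\<^sup>2 \<le> (max 0 (v x - k))\<^sup>2" using vk'[OF True] k' by (intro power_mono) auto
      then show ?thesis using True by (simp add: \<phi>_def)
    qed (simp add: \<phi>_def)
  qed
  finally have c0\<phi>: "c0 \<le> (\<integral>x. \<phi> x \<partial>lebesgue)" .
  have "\<bar>\<integral>x. ?L x \<partial>lebesgue\<bar> \<le> e * M\<^sup>2"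
    using aws d\<phi> c\<phi>' \<phi>0(1) \<phi>N unfolding approximate_weak_solution_def by blast
  moreover have "(\<integral>x. ?L x \<partial>lebesgue) \<le> (\<integral>x. - (3 / 8 * \<bar>\<mu>\<bar> * M) * \<phi> x \<partial>lebesgue)"
    by (intro integral_mono iL integrable_mult_right i\<phi> ptw)
  ultimately have "3 / 8 * \<bar>\<mu>\<bar> * M * (\<integral>x. \<phi> x \<partial>lebesgue) \<le> e * M\<^sup>2" by simp
  moreover have "3 / 8 * \<bar>\<mu>\<bar> * M * c0 \<le> 3 / 8 * \<bar>\<mu>\<bar> * M * (\<integral>x. \<phi> x \<partial>lebesgue)"
    using c0\<phi> M by (intro mult_left_mono) auto
  moreover have "e * M\<^sup>2 = \<bar>\<mu>\<bar> * M * c0 / 4" using M by (simp add: e_def)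
  ultimately have "3 / 8 * \<bar>\<mu>\<bar> * M * c0 \<le> \<bar>\<mu>\<bar> * M * c0 / 4" by linarith
  then have "3 / 8 * (\<bar>\<mu>\<bar> * M * c0) \<le> (\<bar>\<mu>\<bar> * M * c0) / 4" by (simp only: mult.assoc)
  moreover have "\<bar>\<mu>\<bar> * M * c0 > 0" using \<mu> M c0 by (intro mult_pos_pos) auto
  ultimately show False by linarith
qed

end

section \<open>Eigenvalues under small noise\<close>

text \<open>
  Near a zero \<open>p\<close> of the drift, one bump function serves for all \<open>\<epsilon>\<close>; the bound for \<open>\<epsilon> \<mu>\<close> then tends to
  \<open>\<beta>\<^sup>2 / \<kappa>\<close> as \<open>\<epsilon> \<rightarrow> 0\<close>, where \<open>\<beta>\<close> bounds the drift near \<open>p\<close>.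
\<close>

lemma eventually_scaled_eigenvalue_le:
  fixes b :: "real^'d \<Rightarrow> real^'d" and a :: "real^'d \<Rightarrow> real^'d^'d" and D :: "(real^'d) set"
  assumes D: "open D" and eq: "p \<in> closure D" "b p = 0"
    and sol: "\<And>\<epsilon>. \<epsilon> > 0 \<Longrightarrow> \<exists>u G H. positive_eigenfunction D u G H a b La Lb \<kappa> \<epsilon> (\<mu> \<epsilon>)"
    and c: "c > 0"
  shows "eventually (\<lambda>\<epsilon>. \<epsilon> * \<mu> \<epsilon> \<le> c) (at_right 0)"
proof -
  obtain u1 G1 H1 where "positive_eigenfunction D u1 G1 H1 a b La Lb \<kappa> 1 (\<mu> 1)"
    using sol[of 1] by auto
  then interpret s1: positive_eigenfunction D u1 G1 H1 a b La Lb \<kappa> 1 "\<mu> 1" .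
  note a = s1.a_lipschitz and b = s1.b_lipschitz and \<kappa> = s1.constants(1)
    and La = s1.constants(3) and Lb = s1.constants(4)
  define \<beta> where "\<beta> = sqrt (c * \<kappa>) / 2"
  have \<beta>: "\<beta> > 0" "\<beta>\<^sup>2 / \<kappa> = c / 4" using c \<kappa> by (auto simp: \<beta>_def power_divide)
  define d where "d = \<beta> / (Lb + 1)"
  have d: "d > 0" "Lb * d \<le> \<beta>" using \<beta>(1) Lb by (auto simp: d_def field_simps)
  have "d / 2 > 0" using d(1) by simp
  then obtain z where z: "z \<in> D" "dist z p < d / 2"
    using eq(1) unfolding closure_approachable by blast
  obtain r where r: "r > 0" "ball z r \<subseteq> D" using D z(1) open_contains_ball by blast
  define R where "R = min (r / 4) (d / 2)"
  have R: "R > 0" "R \<le> r / 4" "R \<le> d / 2" using r(1) d(1) by (auto simp: R_def)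
  have R2: "cball z (2 * R) \<subseteq> D"
  proof
    fix y assume "y \<in> cball z (2 * R)"
    then have "y \<in> ball z r" using R(2) r(1) by auto
    then show "y \<in> D" using r(2) by blast
  qed
  have b\<beta>: "norm (b x) \<le> \<beta>" if "x \<in> cball z R" for x
  proof -
    have "dist x p \<le> d" using that z(2) R(3) dist_triangle[of x p z] by (simp add: dist_commute)
    then have "Lb * norm (x - p) \<le> Lb * d" using Lb by (intro mult_left_mono) (auto simp: dist_norm)
    then show ?thesis using b[of x p] eq(2) d(2) by simp
  qed
  obtain A where A: "A > 0" "\<And>x. x \<in> cball z R \<Longrightarrow> norm (a x) \<le> A"
    using continuous_on_compact_norm_bound[OF compact_cball
      continuous_on_subset[OF lipschitz_imp_continuous_on_UNIV[OF a La] subset_UNIV]] by blast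
  obtain \<rho> \<rho>' where moll: "mollifier R \<rho> (\<rho>' :: real^'d \<Rightarrow> real^'d)" using mollifier_exists[OF R(1)] by blast
  note M = mollifierD[OF moll]
  define \<eta> where "\<eta> x = \<rho> (x - z)" for x
  define \<eta>' where "\<eta>' x = \<rho>' (x - z)" for x
  have d\<eta>: "GDERIV \<eta> x :> \<eta>' x" for x
  proof -
    have "((\<lambda>x. x - z) has_derivative (\<lambda>h. h)) (at x)" by (auto intro!: derivative_eq_intros)
    from has_derivative_compose[OF this M(1)[of "x - z", unfolded gderiv_def]]
    show ?thesis by (simp add: gderiv_def \<eta>_def[abs_def] \<eta>'_def)
  qed
  have c\<eta>': "continuous_on UNIV \<eta>'"
    unfolding \<eta>'_def by (intro continuous_on_compose2[OF M(2)] continuous_intros) auto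
  have c\<eta>: "continuous_on UNIV \<eta>" by (rule GDERIV_imp_continuous) (rule d\<eta>)
  have \<eta>0: "\<eta> x = 0" if "x \<notin> cball z R" for x
    unfolding \<eta>_def using that by (intro M(4)) (auto simp: dist_norm norm_minus_commute)
  have \<eta>'0: "\<eta>' x = 0" if "x \<notin> cball z R" for x
    by (rule GDERIV_zero_outside[OF d\<eta> that _ \<eta>0]) auto
  have int: "integrable lebesgue f" if "continuous_on UNIV f" "\<And>x. x \<notin> cball z R \<Longrightarrow> f x = 0" for f :: "real^'d \<Rightarrow> real"
  proof (rule integrable_continuous_bounded_support[OF that(1), where R = "norm z + R"])
    fix x :: "real^'d" assume "norm x > norm z + R"
    then have "x \<notin> cball z R" using norm_triangle_ineq2[of x z] by (auto simp: dist_norm norm_minus_commute)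
    then show "f x = 0" by (rule that(2))
  qed
  define J where "J = (\<integral>x. (\<eta> x)\<^sup>2 \<partial>lebesgue)"
  define h where "h x = \<bar>\<eta> x\<bar> * (real CARD('d) * La / 2) + (A + 1) * norm (\<eta>' x)" for x
  define J1 where "J1 = (\<integral>x. (h x)\<^sup>2 \<partial>lebesgue)"
  have i\<eta>: "integrable lebesgue (\<lambda>x. (\<eta> x)\<^sup>2)" by (intro int continuous_intros c\<eta>) (simp add: \<eta>0)
  have ch: "continuous_on UNIV h" unfolding h_def by (intro continuous_intros c\<eta> c\<eta>')
  have h0: "h x = 0" if "x \<notin> cball z R" for x using \<eta>0[OF that] \<eta>'0[OF that] by (simp add: h_def)
  have ih: "integrable lebesgue (\<lambda>x. (h x)\<^sup>2)" by (intro int continuous_intros ch) (simp add: h0)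
  have J: "J > 0"
  proof -
    have "J \<noteq> 0"
    proof
      assume "J = 0"
      then have "AE x in lebesgue. (\<eta> x)\<^sup>2 = 0"
        unfolding J_def by (subst (asm) integral_nonneg_eq_0_iff_AE[OF i\<eta>]) auto
      then have "AE x in lebesgue. \<rho> (z - x) = 0"
        by (rule eventually_mono) (use M(5)[of "z - x" for x] in \<open>simp add: \<eta>_def\<close>)
      then have "(\<integral>x. \<rho> (z - x) \<partial>lebesgue) = 0" by (rule integral_eq_zero_AE)
      then show False using mollifier_mass(2)[OF moll, of z] by simp
    qed
    moreover have "J \<ge> 0" unfolding J_def by (rule Bochner_Integration.integral_nonneg) simp
    ultimately show ?thesis by simp
  qed
  have J1: "J1 \<ge> 0" unfolding J1_def by (rule Bochner_Integration.integral_nonneg) simp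
  have bound: "\<epsilon> * \<mu> \<epsilon> \<le> c / 4 + \<epsilon>\<^sup>2 * (J1 / (\<kappa> * J))" if \<epsilon>: "\<epsilon> > 0" for \<epsilon>
  proof -
    obtain u G H where s: "positive_eigenfunction D u G H a b La Lb \<kappa> \<epsilon> (\<mu> \<epsilon>)"
      using sol[OF \<epsilon>] by blast
    let ?S = "\<lambda>x. (\<bar>\<eta> x\<bar> * (\<beta> + \<epsilon> * (real CARD('d) * La / 2)) + \<epsilon> * (A + 1) * norm (\<eta>' x))\<^sup>2 / (2 * \<epsilon> * \<kappa>)"
    have iS: "integrable lebesgue ?S"
      using \<epsilon> \<kappa> by (intro int continuous_intros c\<eta> c\<eta>') (auto simp: \<eta>0 \<eta>'0)
    have "\<mu> \<epsilon> * J \<le> (\<integral>x. ?S x \<partial>lebesgue)"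
      unfolding J_def
      by (rule positive_eigenfunction.eigenvalue_test_function_bound[OF s R(1) R2 b\<beta> A(2) d\<eta> c\<eta>' \<eta>0])
    also have "\<dots> \<le> (\<integral>x. \<beta>\<^sup>2 / (\<epsilon> * \<kappa>) * (\<eta> x)\<^sup>2 + \<epsilon> / \<kappa> * (h x)\<^sup>2 \<partial>lebesgue)"
    proof (intro integral_mono iS Bochner_Integration.integrable_add integrable_mult_right i\<eta> ih)
      fix x
      have "(\<bar>\<eta> x\<bar> * \<beta> + \<epsilon> * h x)\<^sup>2 \<le> 2 * (\<bar>\<eta> x\<bar> * \<beta>)\<^sup>2 + 2 * (\<epsilon> * h x)\<^sup>2"
        using sum_squares_ge_zero[of "\<bar>\<eta> x\<bar> * \<beta> - \<epsilon> * h x" 0] by (simp add: power2_eq_square algebra_simps)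
      also have "\<dots> = (2 * \<epsilon> * \<kappa>) * (\<beta>\<^sup>2 / (\<epsilon> * \<kappa>) * (\<eta> x)\<^sup>2 + \<epsilon> / \<kappa> * (h x)\<^sup>2)"
        using \<epsilon> \<kappa> by (simp add: power2_eq_square field_simps)
      finally have "(\<bar>\<eta> x\<bar> * \<beta> + \<epsilon> * h x)\<^sup>2 / (2 * \<epsilon> * \<kappa>) \<le> \<beta>\<^sup>2 / (\<epsilon> * \<kappa>) * (\<eta> x)\<^sup>2 + \<epsilon> / \<kappa> * (h x)\<^sup>2"
        using \<epsilon> \<kappa> by (simp add: pos_divide_le_eq mult.commute)
      then show "?S x \<le> \<beta>\<^sup>2 / (\<epsilon> * \<kappa>) * (\<eta> x)\<^sup>2 + \<epsilon> / \<kappa> * (h x)\<^sup>2"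
        by (simp add: h_def algebra_simps)
    qed
    also have "\<dots> = \<beta>\<^sup>2 / (\<epsilon> * \<kappa>) * J + \<epsilon> / \<kappa> * J1"
      unfolding J_def J1_def using i\<eta> ih by (subst Bochner_Integration.integral_add) auto
    finally have "\<epsilon> * (\<mu> \<epsilon> * J) \<le> \<epsilon> * (\<beta>\<^sup>2 / (\<epsilon> * \<kappa>) * J + \<epsilon> / \<kappa> * J1)" using \<epsilon> by (intro mult_left_mono) auto
    also have "\<dots> = (\<beta>\<^sup>2 / \<kappa>  + \<epsilon>\<^sup>2 * (J1 / (\<kappa> * J))) * J"
      using \<epsilon> \<kappa> J by (simp add: power2_eq_square field_simps)
    finally have "(\<epsilon> * \<mu> \<epsilon>) * J \<le> (c / 4 + \<epsilon>\<^sup>2 * (J1 / (\<kappa> * J))) * J" unfolding \<beta>(2) by (simp add: mult.assoc)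
    then show ?thesis using J by simp
  qed
  have "((\<lambda>\<epsilon>. c / 4 + \<epsilon>\<^sup>2 * (J1 / (\<kappa> * J))) \<longlongrightarrow> c / 4 + 0\<^sup>2 * (J1 / (\<kappa> * J))) (at_right 0)"
    by (intro tendsto_intros)
  then have "eventually (\<lambda>\<epsilon>. c / 4 + \<epsilon>\<^sup>2 * (J1 / (\<kappa> * J)) < c) (at_right 0)"
    by (rule order_tendstoD(2)) (use c in simp)
  moreover have "eventually (\<lambda>\<epsilon>::real. \<epsilon> > 0) (at_right 0)" by (rule eventually_at_right_less)
  ultimately show ?thesis by eventually_elim (use bound in force)
qed

section \<open>The action rate\<close>

lemma lipschitz_imp_absolutely_continuous_path:
  assumes "\<And>s t. 0 \<le> s \<Longrightarrow> s \<le> t \<Longrightarrow> t \<le> T \<Longrightarrow> norm (\<phi> t - \<phi> s) \<le> L * (t - s)" and L: "L \<ge> 0"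
  shows "absolutely_continuous_path T \<phi>"
  unfolding absolutely_continuous_path_def
proof (intro allI impI)
  fix e :: real assume e: "e > 0"
  show "\<exists>\<delta>>0. \<forall>(n::nat) s t. (\<forall>k<n. 0 \<le> s k \<and> s k \<le> t k \<and> t k \<le> T) \<and>
        disjoint_family_on (\<lambda>k. {s k<..<t k}) {..<n} \<and> (\<Sum>k<n. t k - s k) < \<delta> \<longrightarrow>
        (\<Sum>k<n. norm (\<phi> (t k) - \<phi> (s k))) < e"
  proof (intro exI[of _ "e / (L + 1)"] conjI allI impI; (elim conjE)?)
    show "e / (L + 1) > 0" using e L by simp
    fix n :: nat and s t :: "nat \<Rightarrow> real"
    assume st: "\<forall>k<n. 0 \<le> s k \<and> s k \<le> t k \<and> t k \<le> T" and less: "(\<Sum>k<n. t k - s k) < e / (L + 1)"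
    have "(\<Sum>k<n. norm (\<phi> (t k) - \<phi> (s k))) \<le> (\<Sum>k<n. L * (t k - s k))"
      using st by (intro sum_mono assms(1)) auto
    also have "\<dots> = L * (\<Sum>k<n. t k - s k)" by (simp add: sum_distrib_left)
    also have "\<dots> \<le> L * (e / (L + 1))" using less L by (intro mult_left_mono) auto
    also have "\<dots> < e" using e L by (simp add: field_simps)
    finally show "(\<Sum>k<n. norm (\<phi> (t k) - \<phi> (s k))) < e" .
  qed
qed

text \<open>
  A polynomial path leads within \<open>D\<close> from \<open>x0\<close> to a point \<open>z\<close> near the zero \<open>p\<close> of the drift, and
  stops. Its action over \<open>[0, T]\<close> is at most a constant plus \<open>T \<bar>b z\<bar>\<^sup>2 / (2 \<kappa>)\<close>. Stopping short of \<open>p\<close>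
  keeps the path inside the open set \<open>D\<close> also when \<open>p\<close> is on the boundary.
\<close>

lemma action_rate_zero:
  fixes b :: "real^'d \<Rightarrow> real^'d" and \<sigma> :: "real^'d \<Rightarrow> real^'d^'d" and D :: "(real^'d) set"
  assumes D: "open D" "connected D" "bounded D" and x0: "x0 \<in> D"
    and b: "continuous_on UNIV b" and p: "p \<in> closure D" "b p = 0"
    and \<kappa>: "\<kappa> > 0" and ell: "\<And>x \<xi>. \<kappa> * (\<xi> \<bullet> \<xi>) \<le> \<xi> \<bullet> ((\<sigma> x ** transpose (\<sigma> x)) *v \<xi>)"
  shows "action_rate D b \<sigma> x0 = 0"
proof (rule antisym)
  show "0 \<le> action_rate D b \<sigma> x0"
    unfolding action_rate_def
  proof (rule le_Limsup)
    show "\<forall>\<^sub>F T in at_top. 0 \<le> (INF \<phi>\<in>{\<phi>. continuous_on {0..T} \<phi> \<and> \<phi> 0 = x0 \<and> (\<forall>t\<in>{0..T}. \<phi> t \<in> closure D)}.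
         ereal (1 / T) * action b \<sigma> T \<phi>)"
      using eventually_gt_at_top[of 0]
      by eventually_elim (auto intro!: INF_greatest simp: action_def)
  qed simp
next
  have "compact (closure D)" using D(3) by (simp add: compact_closure)
  then obtain \<beta> where \<beta>: "\<beta> > 0" "\<And>x. x \<in> closure D \<Longrightarrow> norm (b x) \<le> \<beta>"
    using continuous_on_compact_norm_bound continuous_on_subset[OF b subset_UNIV] by blast
  have cost: "1 / 2 * (w \<bullet> (matrix_inv (\<sigma> x ** transpose (\<sigma> x)) *v w)) \<le> (norm w)\<^sup>2 / (2 * \<kappa>)" for w x
    using elliptic_matrix_inv_le[OF \<kappa> ell, of w x] by simp
  have "action_rate D b \<sigma> x0 \<le> ereal e" if e: "e > 0" for e
  proof -
    \<comment> \<open>Resting where \<open>\<bar>b\<bar> \<le> \<gamma>\<close> costs at most \<open>e / 2\<close> per unit of time.\<close>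
    define \<gamma> where "\<gamma> = sqrt (\<kappa> * e)"
    have \<gamma>: "\<gamma> > 0" "\<gamma>\<^sup>2 / (2 * \<kappa>) = e / 2" using \<kappa> e by (auto simp: \<gamma>_def)
    obtain d where d: "d > 0" "\<And>x. dist x p < d \<Longrightarrow> dist (b x) (b p) < \<gamma>"
      using b \<gamma>(1) unfolding continuous_on_iff by (metis UNIV_I)
    obtain z where z: "z \<in> D" "dist z p < d" using p(1) d(1) unfolding closure_approachable by blast
    have bz: "norm (b z) \<le> \<gamma>" using d(2)[OF z(2)] p(2) by (simp add: dist_norm)
    obtain g where g: "polynomial_function g" "path_image g \<subseteq> D" "pathstart g = x0" "pathfinish g = z"
      using connected_open_polynomial_connected[OF D(1,2) x0 z(1)] by blast
    obtain g' where g': "polynomial_function g'" "\<And>t. (g has_vector_derivative g' t) (at t)"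
      using has_vector_derivative_polynomial_function[OF g(1)] by blast
    obtain L where L: "L > 0" "\<And>t. t \<in> {0..1} \<Longrightarrow> norm (g' t) \<le> L"
      using continuous_on_compact_norm_bound[OF compact_Icc continuous_on_polymonial_function[OF g'(1)]] by blast
    define \<phi> where "\<phi> t = g (min t 1)" for t
    have \<phi>D: "\<phi> t \<in> D" if "0 \<le> t" for t
      using g(2) that unfolding \<phi>_def path_image_def by (simp add: image_subset_iff)
    have \<phi>0: "\<phi> 0 = x0" using g(3) by (simp add: \<phi>_def pathstart_def)
    have lip: "norm (\<phi> t - \<phi> s) \<le> L * (t - s)" if "0 \<le> s" "s \<le> t" for s t
    proof -
      have "norm (g (min t 1) - g (min s 1)) \<le> L * norm (min t 1 - min s 1)"
      proof (rule differentiable_bound[where S = "{0..1}"])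
        show "(g has_derivative (\<lambda>h. h *\<^sub>R g' t)) (at t within {0..1})" for t
          using g'(2)[of t] unfolding has_vector_derivative_def by (rule has_derivative_at_withinI)
        show "onorm (\<lambda>h. h *\<^sub>R g' t) \<le> L" if "t \<in> {0..1}" for t
        proof (rule onorm_bound)
          show "norm (h *\<^sub>R g' t) \<le> L * norm h" for h
            using mult_right_mono[OF L(2)[OF that], of "\<bar>h\<bar>"] by (simp add: mult.commute)
        qed (use L(1) in simp)
      qed (use that in auto)
      also have "\<dots> \<le> L * (t - s)" using that L(1) by (intro mult_left_mono) auto
      finally show ?thesis by (simp add: \<phi>_def)
    qed
    have ac: "absolutely_continuous_path T \<phi>" for T
      using lip L(1) by (intro lipschitz_imp_absolutely_continuous_path[of _ _ L]) auto
    have \<phi>c: "continuous_on S \<phi>" for S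
      unfolding \<phi>_def by (intro continuous_on_compose2[OF continuous_on_polymonial_function[OF g(1), of UNIV]] continuous_intros) auto
    define P where "P = (L + \<beta>)\<^sup>2 / (2 * \<kappa>)"
    have P: "P \<ge> 0" using \<kappa> by (simp add: P_def)
    let ?q = "\<lambda>t. 1 / 2 * ((vector_derivative \<phi> (at t) - b (\<phi> t)) \<bullet>
           (matrix_inv (\<sigma> (\<phi> t) ** transpose (\<sigma> (\<phi> t))) *v (vector_derivative \<phi> (at t) - b (\<phi> t))))"
    have q1: "?q t \<le> P" if "0 < t" "t < 1" for t
    proof -
      have "(\<phi> has_vector_derivative g' t) (at t)"
        by (rule has_vector_derivative_transform_within_open[OF g'(2), of "{0<..<1}"]) (use that in \<open>auto simp: \<phi>_def\<close>)
      then have "vector_derivative \<phi> (at t) = g' t" by (rule vector_derivative_at)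
      moreover have "norm (g' t - b (\<phi> t)) \<le> L + \<beta>"
        using norm_triangle_ineq4[of "g' t" "b (\<phi> t)"] L(2)[of t] \<beta>(2)[of "\<phi> t"] \<phi>D[of t] closure_subset[of D] that
        by auto
      then have "(norm (g' t - b (\<phi> t)))\<^sup>2 / (2 * \<kappa>) \<le> P"
        unfolding P_def using \<kappa> by (intro divide_right_mono power_mono) auto
      ultimately show ?thesis using cost[of "g' t - b (\<phi> t)" "\<phi> t"] by simp
    qed
    have q2: "?q t \<le> e / 2" if "1 < t" for t
    proof -
      have "(\<phi> has_vector_derivative 0) (at t)"
        by (rule has_vector_derivative_transform_within_open[of "\<lambda>t. z" _ _ "{1<..}"])
          (use that g(4) in \<open>auto simp: \<phi>_def pathfinish_def\<close>)
      then have "vector_derivative \<phi> (at t) = 0" by (rule vector_derivative_at)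
      moreover have "\<phi> t = z" using that g(4) by (simp add: \<phi>_def pathfinish_def)
      moreover have "(norm (0 - b z))\<^sup>2 / (2 * \<kappa>) \<le> e / 2"
        unfolding \<gamma>(2)[symmetric] using \<kappa> bz by (intro divide_right_mono power_mono) auto
      ultimately show ?thesis using cost[of "0 - b z" z] by simp
    qed
    have act: "action b \<sigma> T \<phi> \<le> ereal (P + T * (e / 2))" if T: "T > 0" for T
    proof -
      have "(\<integral>\<^sup>+t\<in>{0..T}. ennreal (?q t) \<partial>lebesgue) \<le>
          (\<integral>\<^sup>+t. ennreal P * indicator {0..1} t + ennreal (e / 2) * indicator {0..T} t \<partial>lebesgue)"
      proof (rule nn_integral_mono_AE)
        have "AE t in lebesgue. t \<noteq> 0" "AE t in lebesgue. t \<noteq> (1::real)"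
          by (auto intro!: AE_completion AE_lborel_singleton)
        then show "AE t in lebesgue. ennreal (?q t) * indicator {0..T} t \<le>
            ennreal P * indicator {0..1} t + ennreal (e / 2) * indicator {0..T} t"
        proof eventually_elim
          fix t :: real assume t: "t \<noteq> 0" "t \<noteq> 1"
          consider "t \<notin> {0..T}" | "t \<in> {0..T}" "0 < t" "t < 1" | "t \<in> {0..T}" "1 < t"
            using t by fastforce
          then show "ennreal (?q t) * indicator {0..T} t \<le>
            ennreal P * indicator {0..1} t + ennreal (e / 2) * indicator {0..T} t"
          proof cases
            case 2
            then have "ennreal (?q t) \<le> ennreal P" using q1 by (intro ennreal_leI) auto
            then show ?thesis using 2 by (simp add: add_increasing2)
          next
            case 3
            then have "ennreal (?q t) \<le> ennreal (e / 2)" using q2 by (intro ennreal_leI) auto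
            then show ?thesis using 3 by simp
          qed simp
        qed
      qed
      also have "\<dots> = ennreal P * emeasure lebesgue {0..1::real} + ennreal (e / 2) * emeasure lebesgue {0..T}"
        by (subst nn_integral_add) (auto intro!: borel_measurable_times_ennreal borel_measurable_indicator simp: nn_integral_cmult_indicator)
      also have "\<dots> = ennreal (P + T * (e / 2))"
        using P T e by (simp add: ennreal_plus ennreal_mult[symmetric] mult.commute)
      finally have "enn2ereal (\<integral>\<^sup>+t\<in>{0..T}. ennreal (?q t) \<partial>lebesgue) \<le> enn2ereal (ennreal (P + T * (e / 2)))"
        by (simp add: less_eq_ennreal.rep_eq)
      also have "\<dots> = ereal (P + T * (e / 2))" using P T e by (intro enn2ereal_ennreal) auto
      finally show ?thesis using ac[of T] by (simp only: action_def if_True)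
    qed
    show ?thesis
      unfolding action_rate_def
    proof (rule Limsup_bounded)
      show "\<forall>\<^sub>F T in at_top. (INF \<phi>\<in>{\<phi>. continuous_on {0..T} \<phi> \<and> \<phi> 0 = x0 \<and> (\<forall>t\<in>{0..T}. \<phi> t \<in> closure D)}.
         ereal (1 / T) * action b \<sigma> T \<phi>) \<le> ereal e"
        using eventually_gt_at_top[of 0] eventually_ge_at_top[of "2 * P / e"]
      proof eventually_elim
        fix T :: real assume T: "0 < T" "2 * P / e \<le> T"
        have "(INF \<phi>\<in>{\<phi>. continuous_on {0..T} \<phi> \<and> \<phi> 0 = x0 \<and> (\<forall>t\<in>{0..T}. \<phi> t \<in> closure D)}.
         ereal (1 / T) * action b \<sigma> T \<phi>) \<le> ereal (1 / T) * action b \<sigma> T \<phi>"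
          using \<phi>c \<phi>0 \<phi>D closure_subset[of D] by (intro INF_lower) auto
        also have "\<dots> \<le> ereal (1 / T) * ereal (P + T * (e / 2))"
          using T by (intro ereal_mult_left_mono act) auto
        also have "\<dots> \<le> ereal e"
          using T e by (simp add: field_simps)
        finally show "(INF \<phi>\<in>{\<phi>. continuous_on {0..T} \<phi> \<and> \<phi> 0 = x0 \<and> (\<forall>t\<in>{0..T}. \<phi> t \<in> closure D)}.
         ereal (1 / T) * action b \<sigma> T \<phi>) \<le> ereal e" .
      qed
    qed
  qed
  then show "action_rate D b \<sigma> x0 \<le> 0"
    using ereal_le_epsilon2[of "action_rate D b \<sigma> x0" 0] by simp
qed

section \<open>The feedback system\<close>

lemma linear_feedback_drift: "linear (feedback_drift A m r B K)"
proof (rule linearI)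
  have eq: "feedback_drift A m r B K x = A *v x + (\<Sum>i=1..m. \<Sum>j<r i. (K i j \<bullet> x) *\<^sub>R B i j)" for x
    by (simp add: feedback_drift_def cols_mult_def rows_mult_def)
  show "feedback_drift A m r B K (x + y) = feedback_drift A m r B K x + feedback_drift A m r B K y" for x y
    by (simp add: eq matrix_vector_right_distrib inner_add_right scaleR_left_distrib sum.distrib)
  show "feedback_drift A m r B K (c *\<^sub>R x) = c *\<^sub>R feedback_drift A m r B K x" for c x
    by (simp add: eq matrix_vector_mult_scaleR scaleR_add_right scaleR_sum_right)
qed

lemma lipschitz_gram_matrix:
  fixes s :: "real^'d \<Rightarrow> real^'d^'d"
  assumes s: "\<And>x y. norm (s x - s y) \<le> L * norm (x - y)" and L: "L \<ge> 0" and S: "\<And>x. norm (s x) \<le> S"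
  obtains La where "La \<ge> 0"
    "\<And>x y. norm (s x ** transpose (s x) - s y ** transpose (s y)) \<le> La * norm (x - y)"
proof -
  from bounded_bilinear.pos_bounded[OF bounded_bilinear_matrix_mult[where 'd = 'd]]
  obtain K where K1: "K > 0" "\<forall>(M :: real^'d^'d) (N :: real^'d^'d). norm (M ** N) \<le> norm M * norm N * K"
    by (elim exE conjE) (rule that)
  from bounded_linear.pos_bounded[OF bounded_linear_transpose[where 'd = 'd]]
  obtain K2 where K2': "K2 > 0" "\<forall>M :: real^'d^'d. norm (transpose M) \<le> norm M * K2"
    by (elim exE conjE) (rule that)
  note K = K1(1) K1(2)[rule_format] and K2 = K2'(1) K2'(2)[rule_format]
  have S0: "S \<ge> 0" by (rule order_trans[OF norm_ge_zero S])
  show ?thesis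
  proof (rule that[of "2 * (S * L * K2 * K)"])
    fix x y
    have "s x ** transpose (s x) - s y ** transpose (s y) =
        s x ** transpose (s x - s y) + (s x - s y) ** transpose (s y)"
      by (simp add: bounded_bilinear.diff_left[OF bounded_bilinear_matrix_mult]
          bounded_bilinear.diff_right[OF bounded_bilinear_matrix_mult]
          linear_diff[OF bounded_linear.linear[OF bounded_linear_transpose]])
    also have "norm \<dots> \<le> norm (s x ** transpose (s x - s y)) + norm ((s x - s y) ** transpose (s y))"
      by (rule norm_triangle_ineq)
    also have "norm (s x ** transpose (s x - s y)) \<le> S * (L * norm (x - y) * K2) * K"
      using K(1) K2(1) S0
      by (intro order_trans[OF K(2)] mult_right_mono mult_mono S order_trans[OF K2(2)] s) (auto intro!: mult_nonneg_nonneg L)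
    also have "norm ((s x - s y) ** transpose (s y)) \<le> (L * norm (x - y)) * (S * K2) * K"
      using K(1) K2(1) S0
      by (intro order_trans[OF K(2)] mult_right_mono mult_mono S order_trans[OF K2(2)] s) (auto intro!: mult_nonneg_nonneg L)
    finally show "norm (s x ** transpose (s x) - s y ** transpose (s y)) \<le> 2 * (S * L * K2 * K) * norm (x - y)"
      by (simp add: algebra_simps)
  qed (use S0 L K K2 in simp)
qed

theorem proposition1:
  fixes A :: "real^'d^'d"
    and m :: nat
    and r :: "nat \<Rightarrow> nat"
    and B :: "nat \<Rightarrow> nat \<Rightarrow> real^'d"
    and \<sigma> :: "real^'d \<Rightarrow> real^'d^'d"
    and \<kappa> :: real
    and D \<Omega> X \<Lambda> :: "(real^'d) set"
    and U :: "nat \<Rightarrow> (nat \<Rightarrow> real) set"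
    and \<K> :: "nat \<Rightarrow> (nat \<Rightarrow> real^'d) set"
    and Adm :: "(nat \<Rightarrow> nat \<Rightarrow> real^'d) set"
    and K :: "nat \<Rightarrow> nat \<Rightarrow> real^'d"
    and x0 :: "real^'d"
    and eigval :: "real \<Rightarrow> real"
  assumes lipschitz: "\<exists>L. L-lipschitz_on UNIV \<sigma>"
    and elliptic: "\<kappa> > 0" "\<And>x \<xi>. \<xi> \<bullet> ((\<sigma> x ** transpose (\<sigma> x)) *v \<xi>) \<ge> \<kappa> * (\<xi> \<bullet> \<xi>)"
    and domain: "open D" "connected D" "bounded D" "C2_hypersurface (frontier D)"
    and start: "x0 \<in> D"
    and controls: "\<And>i. i \<in> {1..m} \<Longrightarrow> U i \<in> sets (PiM {..<r i} (\<lambda>_. borel))"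
    and feedbacks: "\<And>i. i \<in> {1..m} \<Longrightarrow> feedback_space (r i) X (U i) (\<K> i)"
    and Omega: "openin (top_of_set (closure D)) \<Omega>" "bounded \<Omega>" "0 \<in> \<Omega>"
    and admissible: "Adm \<subseteq> admissible_feedbacks A m r B \<K> \<Omega>" "K \<in> Adm"
    and max_invariant: "max_closed_invariant D (feedback_drift A m r B K) \<Lambda>" "\<Lambda> \<noteq> {}"
    and eigenvalue:
      "\<And>\<epsilon>. \<epsilon> > 0 \<Longrightarrow> principal_eigenvalue D (feedback_drift A m r B K) \<sigma> \<epsilon> (eigval \<epsilon>)"
  shows "\<exists>\<rho>::real. action_rate D (feedback_drift A m r B K) \<sigma> x0 = ereal \<rho> \<and>
           (\<lambda>\<epsilon>. eigval \<epsilon> - \<rho> / \<epsilon>) \<in> o[at_right 0](\<lambda>\<epsilon>. 1 / \<epsilon>)"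
proof -
  let ?b = "feedback_drift A m r B K"
  have lin: "linear ?b" by (rule linear_feedback_drift)
  from bounded_linear.pos_bounded[OF lin[unfolded linear_linear[symmetric]]]
  obtain Lb where Lb: "Lb > 0" "\<And>x. norm (?b x) \<le> norm x * Lb" by blast
  have b: "norm (?b x - ?b y) \<le> Lb * norm (x - y)" for x y
    using Lb(2)[of "x - y"] by (simp add: linear_diff[OF lin] mult.commute)
  have b0: "?b 0 = 0" by (rule linear_0[OF lin])
  have zero: "0 \<in> closure D" using Omega(1,3) openin_imp_subset by blast
  obtain L where L: "L-lipschitz_on UNIV \<sigma>" using lipschitz by blast
  have L0: "L \<ge> 0" by (rule lipschitz_on_nonneg[OF L])
  obtain R where "R > 0" "\<forall>x\<in>D. norm x \<le> R" using domain(3) unfolding bounded_pos by blast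
  then have R: "R > 0" "D \<subseteq> cball 0 R" by auto
  \<comment> \<open>Precomposing with the projection onto a ball leaves \<open>\<sigma>\<close> unchanged on \<open>D\<close> and makes \<open>\<sigma> \<sigma>\<^sup>T\<close> globally Lipschitz.\<close>
  define s where "s x = \<sigma> (closest_point (cball 0 R) x)" for x
  define a where "a x = s x ** transpose (s x)" for x
  have cp: "convex (cball (0::real^'d) R)" "closed (cball (0::real^'d) R)" "cball (0::real^'d) R \<noteq> {}" using R by auto
  have sL: "norm (s x - s y) \<le> L * norm (x - y)" for x y
  proof -
    have "norm (s x - s y) \<le> L * dist (closest_point (cball 0 R) x) (closest_point (cball 0 R) y)"
      unfolding s_def using lipschitz_onD[OF L] by (simp add: dist_norm)
    also have "\<dots> \<le> L * dist x y" using closest_point_lipschitz[OF cp] L0 by (intro mult_left_mono) auto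
    finally show ?thesis by (simp add: dist_norm)
  qed
  obtain S where S: "\<And>x. x \<in> cball 0 R \<Longrightarrow> norm (\<sigma> x) \<le> S"
    using continuous_on_compact_norm_bound[OF compact_cball
      continuous_on_subset[OF lipschitz_on_continuous_on[OF L] subset_UNIV]] by blast
  have "norm (s x) \<le> S" for x
    unfolding s_def using closest_point_in_set[OF cp(2,3)] by (intro S) auto
  then obtain La where La: "La \<ge> 0" and a: "\<And>x y. norm (a x - a y) \<le> La * norm (x - y)"
    using lipschitz_gram_matrix[OF sL L0] unfolding a_def by metis
  have ell: "\<kappa> * (\<xi> \<bullet> \<xi>) \<le> \<xi> \<bullet> (a x *v \<xi>)" for x \<xi>
    unfolding a_def s_def by (rule elliptic(2))
  have a_D: "a x = \<sigma> x ** transpose (\<sigma> x)" if "x \<in> D" for x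
    using that R(2) by (simp add: a_def s_def closest_point_self subset_iff)
  have sol: "\<exists>u G H. positive_eigenfunction D u G H a ?b La Lb \<kappa> \<epsilon> (eigval \<epsilon>) \<and>
      continuous_on (closure D) u \<and> (\<forall>x\<in>frontier D. u x = 0)" if "\<epsilon> > 0" for \<epsilon>
  proof -
    obtain q u G H where q: "W2p_loc q D u G H" "continuous_on (closure D) u" "\<forall>x\<in>D. u x > 0"
        "AE x in lebesgue. x \<in> D \<longrightarrow> - generator ?b \<sigma> \<epsilon> G H x = eigval \<epsilon> * u x" "\<forall>x\<in>frontier D. u x = 0"
      using eigenvalue[OF \<open>\<epsilon> > 0\<close>] unfolding principal_eigenvalue_def by blast
    have "AE x in lebesgue. x \<in> D \<longrightarrow> G x \<bullet> ?b x + \<epsilon> / 2 * trace (a x ** H x) = - (eigval \<epsilon> * u x)"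
      using q(4) by (rule eventually_mono) (use a_D in \<open>force simp: generator_def\<close>)
    moreover have "weak_gradient D u G" "\<And>i. weak_gradient D (\<lambda>x. G x $ i) (\<lambda>x. H x $ i)"
      using q(1) unfolding W2p_loc_def by blast+
    moreover have "continuous_on D u" by (rule continuous_on_subset[OF q(2) closure_subset])
    ultimately have "positive_eigenfunction D u G H a ?b La Lb \<kappa> \<epsilon> (eigval \<epsilon>)"
      using a b ell La less_imp_le[OF Lb(1)] elliptic(1) that q(3) by unfold_locales auto
    then show ?thesis using q(2,5) by blast
  qed
  have nonneg: "eigval \<epsilon> \<ge> 0" if \<epsilon>: "\<epsilon> > 0" for \<epsilon>
  proof -
    obtain u G H where u: "positive_eigenfunction D u G H a ?b La Lb \<kappa> \<epsilon> (eigval \<epsilon>)"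
      "continuous_on (closure D) u" "\<And>x. x \<in> frontier D \<Longrightarrow> u x = 0"
      using sol[OF \<epsilon>] by blast
    have "D \<noteq> {}" using start by blast
    then show ?thesis
      by (rule positive_eigenfunction.eigenvalue_nonneg[OF u(1) domain(1,3) _ u(2,3)])
  qed
  have rate: "action_rate D ?b \<sigma> x0 = 0"
    by (rule action_rate_zero[OF domain(1-3) start lipschitz_imp_continuous_on_UNIV[OF b less_imp_le[OF Lb(1)]]
        zero b0 elliptic])
  have small: "(\<lambda>\<epsilon>. eigval \<epsilon> - 0 / \<epsilon>) \<in> o[at_right 0](\<lambda>\<epsilon>. 1 / \<epsilon>)"
  proof (rule landau_o.smallI)
    fix c :: real assume c: "c > 0"
    have "eventually (\<lambda>\<epsilon>. \<epsilon> * eigval \<epsilon> \<le> c) (at_right 0)"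
    proof (rule eventually_scaled_eigenvalue_le[where b = ?b and p = 0, OF domain(1) zero b0 _ c])
      show "\<exists>u G H. positive_eigenfunction D u G H a ?b La Lb \<kappa> \<epsilon> (eigval \<epsilon>)" if "\<epsilon> > 0" for \<epsilon>
        using sol[OF that] by blast
    qed
    then show "eventually (\<lambda>\<epsilon>. norm (eigval \<epsilon> - 0 / \<epsilon>) \<le> c * norm (1 / \<epsilon>)) (at_right 0)"
      using eventually_at_right_less
    proof eventually_elim
      fix \<epsilon> :: real assume "\<epsilon> * eigval \<epsilon> \<le> c" "0 < \<epsilon>"
      then show "norm (eigval \<epsilon> - 0 / \<epsilon>) \<le> c * norm (1 / \<epsilon>)"
        using nonneg[of \<epsilon>] by (simp add: field_simps)
    qed
  qed
  show ?thesis using rate small by (intro exI[of _ 0]) (simp add: zero_ereal_def)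
qed

end
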